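(* Let $\Lambda$ be a sequence in $\mathbb{D}$ satisfying the Blaschke condition $\sum_{\lambda\in\Lambda}(1-|\lambda|)<\infty$, and let $\mu_\Lambda:=\sum_{\lambda\in\Lambda}(1-|\lambda|)\delta_\lambda$, where $\delta_\lambda$ is the Dirac measure at $\lambda$. If $\mu_\Lambda$ has bounded balayage, then the following are equivalent: $\Lambda\in\mathrm{Int}\,N$; $\Lambda\in\mathrm{Int}\,N^+$; and $$\sum_{\lambda\in\Lambda}(1-|\lambda|)\log|B_\lambda(\lambda)|^{-1}<\infty.$$
   Context: $\mathbb{D}$ is the open unit disc. A sequence $\Lambda\subset\mathbb{D}$ means a discrete sequence of (distinct) points. The Poisson balayage of a finite positive measure $\mu$ on $\mathbb{D}$ is $B(\mu)(\zeta)=\int_{\mathbb{D}}P_z(\zeta)\,d\mu(z)$, $\zeta\in\partial\mathbb{D}$, where $P_z(\zeta)=\frac{1-|z|^2}{|\zeta-z|^2}$; $\mu$ has bounded balayage if $\sup_{\zeta\in\partial\mathbb{D}}B(\mu)(\zeta)<\infty$. For $\lambda\in\mathbb{D}$, $b_\lambda(z)=\frac{|\lambda|}{\lambda}\frac{\lambda-z}{1-\overline{\lambda}z}$ ($b_0(z)=z$); for $\lambda\in\Lambda$, $B_\lambda=\prod_{\lambda'\in\Lambda\setminus\{\lambda\}}b_{\lambda'}$. The Nevanlinna class is $N=\{f\in\mathrm{Hol}(\mathbb{D}):\lim_{r\to1}\frac1{2\pi}\int_0^{2\pi}\log^+|f(re^{i\theta})|\,d\theta<\infty\}$, and the Smirnov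 class $N^+$ is the set of $f\in N$ with $\lim_{r\to1}\frac1{2\pi}\int_0^{2\pi}\log^+|f(re^{i\theta})|\,d\theta=\frac1{2\pi}\int_0^{2\pi}\log^+|f(e^{i\theta})|\,d\theta$ (non-tangential boundary values). For a space $X$ of holomorphic functions on $\mathbb{D}$, $X|\Lambda=\{(f(\lambda))_{\lambda\in\Lambda}:f\in X\}$, and $\Lambda\in\mathrm{Int}\,X$ ($\Lambda$ is free interpolating for $X$) means that $X|\Lambda$ is ideal: $(a_\lambda)\in X|\Lambda$ and $(\omega_\lambda)\in\ell^\infty$ imply $(\omega_\lambda a_\lambda)\in X|\Lambda$. *)

theory Defs
  imports "HOL-Complex_Analysis.Complex_Analysis" "HOL-Probability.Giry_Monad"
begin

section \<open>Blaschke products\<close>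

definition blaschke_factor :: "complex \<Rightarrow> complex \<Rightarrow> complex" where
  "blaschke_factor a z =
     (if a = 0 then z else of_real (norm a) / a * ((a - z) / (1 - cnj a * z)))"

text \<open>The library has no product over an arbitrary index set, so the (unordered) Blaschke
  product is the limit of the finite subproducts, in analogy with \<^const>\<open>infsum\<close>.
  Under the Blaschke condition this limit exists at every point of the disc.\<close>

definition blaschke_product :: "complex set \<Rightarrow> complex \<Rightarrow> complex" where
  "blaschke_product \<Lambda> z = Lim (finite_subsets_at_top \<Lambda>) (\<lambda>F. \<Prod>a\<in>F. blaschke_factor a z)"

definition blaschke_without :: "complex set \<Rightarrow> complex \<Rightarrow> complex \<Rightarrow> complex" where
  "blaschke_without \<Lambda> a = blaschke_product (\<Lambda> - {a})"

definition blaschke_condition :: "complex set \<Rightarrow> bool" where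
  "blaschke_condition \<Lambda> \<longleftrightarrow> (\<lambda>a. 1 - norm a) summable_on \<Lambda>"

section \<open>Poisson balayage\<close>

definition poisson_kernel :: "complex \<Rightarrow> complex \<Rightarrow> real" where
  "poisson_kernel z \<zeta> = (1 - (norm z)\<^sup>2) / (norm (\<zeta> - z))\<^sup>2"

definition disc_borel :: "complex measure" where
  "disc_borel = restrict_space borel (ball 0 1)"

text \<open>Here \<^term>\<open>\<mu>\<close> is meant to be a measure on the disc, i.e. one with the space and the
  measurable sets of \<^const>\<open>disc_borel\<close>.\<close>

definition balayage :: "complex measure \<Rightarrow> complex \<Rightarrow> ennreal" where
  "balayage \<mu> \<zeta> = (\<integral>\<^sup>+z. ennreal (poisson_kernel z \<zeta>) \<partial>\<mu>)"

definition bounded_balayage :: "complex measure \<Rightarrow> bool" where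
  "bounded_balayage \<mu> \<longleftrightarrow> (SUP \<zeta>\<in>sphere 0 1. balayage \<mu> \<zeta>) < \<infinity>"

definition point_measure_of :: "complex set \<Rightarrow> complex measure" where
  "point_measure_of \<Lambda> = measure_of (space disc_borel) (sets disc_borel)
     (\<lambda>A. \<Sum>\<^sub>\<infinity>a\<in>\<Lambda>. ennreal (1 - norm a) * emeasure (return disc_borel a) A)"

lemma space_point_measure_of [simp]: "space (point_measure_of \<Lambda>) = ball 0 1"
  unfolding point_measure_of_def
  by (subst space_measure_of[OF sets.space_closed])
     (simp add: disc_borel_def space_restrict_space)

lemma sets_point_measure_of [simp, measurable_cong]:
  "sets (point_measure_of \<Lambda>) = sets disc_borel"
  by (simp add: point_measure_of_def)

lemma infsum_suminf_ennreal:
  fixes g :: "nat \<Rightarrow> 'a \<Rightarrow> ennreal"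
  shows "(\<Sum>\<^sub>\<infinity>x\<in>A. \<Sum>i. g i x) = (\<Sum>i. \<Sum>\<^sub>\<infinity>x\<in>A. g i x)"
proof -
  let ?F = "{F. finite F \<and> F \<subseteq> A}"
  have "(\<Sum>i. \<Sum>\<^sub>\<infinity>x\<in>A. g i x) = (SUP n. \<Sum>i<n. \<Sum>\<^sub>\<infinity>x\<in>A. g i x)"
    by (rule suminf_eq_SUP)
  also have "\<dots> = (SUP n. \<Sum>\<^sub>\<infinity>x\<in>A. \<Sum>i<n. g i x)"
  proof (intro SUP_cong refl)
    fix n show "(\<Sum>i<n. \<Sum>\<^sub>\<infinity>x\<in>A. g i x) = (\<Sum>\<^sub>\<infinity>x\<in>A. \<Sum>i<n. g i x)"
      by (induction n) (simp_all add: infsum_add nonneg_summable_on_complete)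
  qed
  also have "\<dots> = (SUP n. SUP F\<in>?F. \<Sum>x\<in>F. \<Sum>i<n. g i x)"
    by (intro SUP_cong refl nonneg_infsum_complete) simp
  also have "\<dots> = (SUP F\<in>?F. SUP n. \<Sum>x\<in>F. \<Sum>i<n. g i x)"
    by (rule SUP_commute)
  also have "\<dots> = (SUP F\<in>?F. SUP n. \<Sum>i<n. \<Sum>x\<in>F. g i x)"
    by (intro SUP_cong refl sum.swap)
  also have "\<dots> = (SUP F\<in>?F. \<Sum>i. \<Sum>x\<in>F. g i x)"
    by (simp only: suminf_eq_SUP)
  also have "\<dots> = (SUP F\<in>?F. \<Sum>x\<in>F. \<Sum>i. g i x)"
    by (intro SUP_cong refl suminf_sum) simp
  also have "\<dots> = (\<Sum>\<^sub>\<infinity>x\<in>A. \<Sum>i. g i x)"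
    by (intro nonneg_infsum_complete [symmetric]) simp
  finally show ?thesis by simp
qed

text \<open>\<^const>\<open>measure_of\<close> would silently return the zero measure for a set function that is not
  countably additive; this is not the case here.\<close>

lemma emeasure_point_measure_of:
  assumes "A \<in> sets disc_borel"
  shows "emeasure (point_measure_of \<Lambda>) A =
           (\<Sum>\<^sub>\<infinity>a\<in>\<Lambda>. ennreal (1 - norm a) * emeasure (return disc_borel a) A)"
proof (rule emeasure_measure_of [OF point_measure_of_def])
  show "sets disc_borel \<subseteq> Pow (space disc_borel)"
    by (rule sets.space_closed)
  show "positive (sets (point_measure_of \<Lambda>))
     (\<lambda>A. \<Sum>\<^sub>\<infinity>a\<in>\<Lambda>. ennreal (1 - norm a) * emeasure (return disc_borel a) A)"
    by (simp add: positive_def)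
  show "countably_additive (sets (point_measure_of \<Lambda>))
     (\<lambda>A. \<Sum>\<^sub>\<infinity>a\<in>\<Lambda>. ennreal (1 - norm a) * emeasure (return disc_borel a) A)"
  proof (rule countably_additiveI)
    fix F :: "nat \<Rightarrow> complex set"
    assume F: "range F \<subseteq> sets (point_measure_of \<Lambda>)" "disjoint_family F"
    have *: "emeasure (return disc_borel a) (\<Union>i. F i) =
             (\<Sum>i. emeasure (return disc_borel a) (F i))" for a
      using F by (intro suminf_emeasure [symmetric]) auto
    show "(\<Sum>i. \<Sum>\<^sub>\<infinity>a\<in>\<Lambda>. ennreal (1 - norm a) * emeasure (return disc_borel a) (F i)) =
          (\<Sum>\<^sub>\<infinity>a\<in>\<Lambda>. ennreal (1 - norm a) * emeasure (return disc_borel a) (\<Union>i. F i))"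
      by (simp only: * ennreal_suminf_cmult [symmetric] infsum_suminf_ennreal)
  qed
  show "A \<in> sets (point_measure_of \<Lambda>)"
    using assms by simp
qed

section \<open>The Nevanlinna and Smirnov classes\<close>

text \<open>\<^term>\<open>log_plus 0 = 0\<close>, as it should be, because \<^term>\<open>ln (0::real) = 0\<close>.\<close>

definition log_plus :: "real \<Rightarrow> real" where
  "log_plus x = max 0 (ln x)"

text \<open>The completed measure is used because radial and non-tangential limits exist only almost
  everywhere, so that boundary functions are merely Lebesgue measurable.\<close>

definition circle_mean :: "(real \<Rightarrow> real) \<Rightarrow> ennreal" where
  "circle_mean u = (\<integral>\<^sup>+\<theta>\<in>{0..2 * pi}. ennreal (u \<theta>) \<partial>lebesgue) / ennreal (2 * pi)"

definition log_plus_mean :: "(complex \<Rightarrow> complex) \<Rightarrow> real \<Rightarrow> ennreal" where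
  "log_plus_mean f r = circle_mean (\<lambda>\<theta>. log_plus (norm (f (of_real r * cis \<theta>))))"

definition nevanlinna_class :: "(complex \<Rightarrow> complex) set" where
  "nevanlinna_class = {f. f holomorphic_on ball 0 1 \<and>
     (\<exists>L<\<infinity>. (log_plus_mean f \<longlongrightarrow> L) (at_left 1))}"

definition stolz_region :: "real \<Rightarrow> complex \<Rightarrow> complex set" where
  "stolz_region \<alpha> \<zeta> = {z \<in> ball 0 1. norm (\<zeta> - z) < \<alpha> * (1 - norm z)}"

definition has_nontangential_limit :: "(complex \<Rightarrow> complex) \<Rightarrow> complex \<Rightarrow> complex \<Rightarrow> bool" where
  "has_nontangential_limit f w \<zeta> \<longleftrightarrow>
     (\<forall>\<alpha>>1. (f \<longlongrightarrow> w) (at \<zeta> within stolz_region \<alpha> \<zeta>))"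

text \<open>Functions of the Nevanlinna class have a finite non-tangential limit at almost every point
  of the circle; the value is unspecified on the exceptional null set.\<close>

definition boundary_value :: "(complex \<Rightarrow> complex) \<Rightarrow> complex \<Rightarrow> complex" where
  "boundary_value f \<zeta> = (THE w. has_nontangential_limit f w \<zeta>)"

definition smirnov_class :: "(complex \<Rightarrow> complex) set" where
  "smirnov_class = {f \<in> nevanlinna_class.
     (log_plus_mean f \<longlongrightarrow>
        circle_mean (\<lambda>\<theta>. log_plus (norm (boundary_value f (cis \<theta>))))) (at_left 1)}"

section \<open>Free interpolation\<close>

text \<open>Families indexed by \<^term>\<open>\<Lambda>\<close> are represented by extensional functions, i.e. functions
  equal to \<^const>\<open>undefined\<close> off \<^term>\<open>\<Lambda>\<close>.\<close>

definition trace_space :: "(complex \<Rightarrow> complex) set \<Rightarrow> complex set \<Rightarrow> (complex \<Rightarrow> complex) set" where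
  "trace_space X \<Lambda> = (\<lambda>f. restrict f \<Lambda>) ` X"

definition ideal_space :: "complex set \<Rightarrow> (complex \<Rightarrow> complex) set \<Rightarrow> bool" where
  "ideal_space \<Lambda> S \<longleftrightarrow>
     (\<forall>c\<in>S. \<forall>\<omega>. bounded (\<omega> ` \<Lambda>) \<longrightarrow> (\<lambda>a\<in>\<Lambda>. \<omega> a * c a) \<in> S)"

definition free_interpolating :: "(complex \<Rightarrow> complex) set \<Rightarrow> complex set \<Rightarrow> bool" where
  "free_interpolating X \<Lambda> \<longleftrightarrow> ideal_space \<Lambda> (trace_space X \<Lambda>)"

end

theory Submission
  imports Defs
begin

text \<open>
  Necessity. Put \<open>w(a, b) = (1 - |a|) log (1 / |b\<^sub>b(a)|)\<close>, so that the sum in question is the sum of \<open>w\<close> over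
  all pairs of distinct points. If it diverges, there is a subset \<open>A\<close> of \<open>\<Lambda>\<close> for which the sum over
  pairs \<open>(a, b)\<close> with \<open>a\<close> in \<open>\<Lambda> - A\<close> and \<open>b\<close> in \<open>A\<close> already diverges. Free interpolation gives \<open>f\<close> in the
  Nevanlinna class with \<open>f = 0\<close> on \<open>A\<close> and \<open>f = 1\<close> on \<open>\<Lambda> - A\<close>, and the Poisson-Jensen inequality at the
  points of \<open>\<Lambda> - A\<close>, summed with weights \<open>1 - |a|\<close>, bounds that sum by the balayage constant times the
  Nevanlinna characteristic of \<open>f\<close>.

  Sufficiency. With \<open>\<phi>(a) = log (1 / |B\<^sub>a(a)|)\<close>, the function \<open>G(z) = \<Sum>\<^sub>a \<phi>(a) (1 - |a|\<^sup>2) / (1 - cnj a z)\<close>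
  has positive quasi-bounded real part with \<open>Re G(a) \<ge> \<phi>(a)\<close>. Hence the values \<open>\<omega>(a) / exp (G(a))\<close> are
  dominated by \<open>|B\<^sub>a(a)|\<close> and are attained by a bounded function \<open>g\<close>: a limit of the finite sums of
  \<open>\<omega>(a) / (exp (G(a)) B\<^sub>a(a)) B\<^sub>a(z) ((1 - |a|\<^sup>2) / (1 - cnj a z))\<^sup>2\<close>, uniformly bounded by
  the balayage condition. Then \<open>f exp(G) g\<close> interpolates \<open>\<omega> f\<close> and stays in the class of \<open>f\<close>.
\<close>

section \<open>Blaschke factors and Poisson integrals\<close>

text \<open>Free interpolation supplies, for each 0-1 pattern, a function whose Nevanlinna bound
  depends on the pattern and is not controlled uniformly. Hence one single partition of
  \<open>\<Lambda>\<close> has to carry unbounded weight; this is why \<open>A\<close> is assembled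
  from disjoint finite blocks. A function of the class need not extend to the circle, so
  Poisson-Jensen is applied to the dilates f(r z), for circles of radius r free of zeros. A point a
  then moves to a / r, and the distortion of the Poisson kernel under this shift produces the 4 in
  the bound 4 K C. The hard point of sufficiency is the Smirnov class, whose definition compares a
  limit of means with a boundary integral. That needs Fatou's theorem, which is proved by passing to
  a primitive: it is Lipschitz up to the circle, so it has a derivative in the angle almost
  everywhere. Multiplying by exp(G) could in principle leave mass that the boundary integral does
  not see; it does not, because finite subsums h of G are holomorphic across the circle and Re G(0)
  - Re h(0) is as small as desired.\<close>

lemma norm_blaschke_factor: "norm (blaschke_factor a z) = norm (a - z) / norm (1 - cnj a * z)"
  by (simp add: blaschke_factor_def norm_mult norm_divide)

lemma one_minus_cnj_mult_nonzero:
  assumes "norm a < 1" "norm z \<le> 1"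
  shows "1 - cnj a * z \<noteq> 0"
proof -
  have "norm (cnj a * z) < 1"
    using assms mult_strict_mono'[of "norm a" 1 "norm z" "1 + 1"]
      mult_right_le_one_le[of "norm a" "norm z"] by (simp add: norm_mult)
  then show ?thesis by force
qed

text \<open>Dividing by |1 - cnj a z|^2 gives 1 - |b_a(z)|^2. The right side is nonnegative on the
  closed disc and zero on the circle, whence both modulus estimates for Blaschke factors.\<close>

lemma norm_sq_one_minus_cnj_mult:
  "(norm (1 - cnj a * z))\<^sup>2 - (norm (a - z))\<^sup>2 = (1 - (norm a)\<^sup>2) * (1 - (norm z)\<^sup>2)"
  unfolding cmod_power2 by (simp add: algebra_simps power2_eq_square)

lemma norm_blaschke_factor_le_1:
  assumes "norm a < 1" "norm z \<le> 1"
  shows "norm (blaschke_factor a z) \<le> 1"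
proof -
  have "(1 - (norm a)\<^sup>2) * (1 - (norm z)\<^sup>2) \<ge> 0"
    using assms by (intro mult_nonneg_nonneg) (auto simp: abs_square_le_1)
  then have "(norm (a - z))\<^sup>2 \<le> (norm (1 - cnj a * z))\<^sup>2"
    using norm_sq_one_minus_cnj_mult[of a z] by linarith
  then have "norm (a - z) \<le> norm (1 - cnj a * z)" by (rule power2_le_imp_le) simp
  then show ?thesis using one_minus_cnj_mult_nonzero[OF assms] by (simp add: norm_blaschke_factor)
qed

lemma norm_blaschke_factor_circle:
  assumes "norm a < 1" "norm z = 1"
  shows "norm (blaschke_factor a z) = 1"
proof -
  have "(norm (a - z))\<^sup>2 = (norm (1 - cnj a * z))\<^sup>2"
    using norm_sq_one_minus_cnj_mult[of a z] assms by simp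
  then have "norm (a - z) = norm (1 - cnj a * z)" by (simp add: power2_eq_iff_nonneg)
  then show ?thesis using one_minus_cnj_mult_nonzero[of a z] assms by (simp add: norm_blaschke_factor)
qed

lemma blaschke_factor_eq_0_iff:
  assumes "norm a < 1" "norm z \<le> 1"
  shows "blaschke_factor a z = 0 \<longleftrightarrow> z = a"
proof -
  have "norm (blaschke_factor a z) = 0 \<longleftrightarrow> z = a"
    using one_minus_cnj_mult_nonzero[OF assms] by (auto simp: norm_blaschke_factor)
  then show ?thesis by simp
qed

lemma norm_blaschke_factor_commute: "norm (blaschke_factor a z) = norm (blaschke_factor z a)"
proof -
  have "norm (1 - cnj a * z) = norm (cnj (1 - cnj a * z))" by (rule complex_mod_cnj[symmetric])
  then show ?thesis by (simp add: norm_blaschke_factor norm_minus_commute mult.commute)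
qed

lemma holomorphic_blaschke_factor:
  assumes "\<And>z. z \<in> S \<Longrightarrow> cnj a * z \<noteq> 1"
  shows "blaschke_factor a holomorphic_on S"
  unfolding blaschke_factor_def
  by (cases "a = 0") (use assms in \<open>auto intro!: holomorphic_intros\<close>)

section \<open>Poisson kernel and Poisson formula on the unit circle\<close>

lemma poisson_kernel_nonneg: "norm z \<le> 1 \<Longrightarrow> poisson_kernel z w \<ge> 0"
  by (auto simp: poisson_kernel_def abs_square_le_1)

lemma continuous_on_poisson_kernel:
  assumes "norm z < 1"
  shows "continuous_on (sphere 0 1) (poisson_kernel z)"
  unfolding poisson_kernel_def by (intro continuous_intros) (use assms in auto)

lemma continuous_on_cis_compose:
  assumes "continuous_on (sphere 0 1) u"
  shows "continuous_on A (\<lambda>t. u (cis t))"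
  by (rule continuous_on_compose2[OF assms]) (auto intro!: continuous_intros)

lemma cauchy_circle:
  assumes h: "h holomorphic_on ball 0 R" "1 < R" and z: "norm z < 1"
  shows "((\<lambda>t. h (cis t) * cis t / (cis t - z)) has_integral 2 * of_real pi * h z) {0..2*pi}"
proof -
  have "h holomorphic_on cball 0 1"
    using h by (auto intro: holomorphic_on_subset)
  then have "((\<lambda>u. h u / (u - z)) has_contour_integral 2 * of_real pi * \<i> * h z) (circlepath 0 1)"
    by (rule Cauchy_integral_circlepath_simple) (use z in auto)
  then have "((\<lambda>t. h (cis t) / (cis t - z) * \<i> * cis t) has_integral 2 * of_real pi * \<i> * h z) {0..2*pi}"
    unfolding circlepath_def by (subst (asm) has_contour_integral_part_circlepath_iff) auto
  then have "((\<lambda>t. - \<i> * (h (cis t) / (cis t - z) * \<i> * cis t)) has_integral - \<i> * (2 * of_real pi * \<i> * h z)) {0..2*pi}"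
    by (rule has_integral_mult_right)
  then show ?thesis by (simp add: algebra_simps)
qed

lemma cnj_eq_inverse_circle: "norm z = 1 \<Longrightarrow> cnj z = inverse z"
  by (metis complex_norm_square inverse_unique of_real_1 one_power2)

text \<open>Cauchy's formula is applied to \<open>h x * (1 - |z|\<^sup>2) / (1 - cnj z * x)\<close>, which agrees with
  \<open>h\<close> at \<open>z\<close>; on the circle the product with the Cauchy kernel is the Poisson kernel.\<close>

lemma poisson_formula_complex:
  assumes h: "h holomorphic_on ball 0 R" "1 < R" and z: "norm z < 1"
  shows "((\<lambda>t. of_real (poisson_kernel z (cis t)) * h (cis t)) has_integral 2 * of_real pi * h z) {0..2*pi}"
proof -
  \<comment> \<open>The extra factor has its pole at 1 / cnj z, of modulus 1 / |z| > 1; capping the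
    radius there keeps \<open>k\<close> holomorphic on a disc larger than the unit one.\<close>
  define R' where "R' = (if z = 0 then R else min R (1 / norm z))"
  have R': "1 < R'" "R' \<le> R" using h z by (auto simp: R'_def)
  have nz: "cnj z * x \<noteq> 1" if "x \<in> ball 0 R'" for x
  proof
    assume eq: "cnj z * x = 1"
    then have "norm z * norm x = 1" by (metis complex_mod_cnj norm_mult norm_one)
    moreover have "z \<noteq> 0" using eq by auto
    moreover have "norm x < 1 / norm z" using that \<open>z \<noteq> 0\<close> by (auto simp: R'_def)
    ultimately show False by (auto simp: field_simps)
  qed
  define k where "k = (\<lambda>x. h x * (1 - z * cnj z) / (1 - cnj z * x))"
  have "k holomorphic_on ball 0 R'"
    unfolding k_def using nz R' by (intro holomorphic_intros holomorphic_on_subset[OF h(1)]) auto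
  from cauchy_circle[OF this R'(1) z]
  have "((\<lambda>t. k (cis t) * cis t / (cis t - z)) has_integral 2 * of_real pi * k z) {0..2*pi}" .
  moreover have "k z = h z"
    using nz[of z] z R' by (auto simp: k_def mult.commute)
  moreover have "k (cis t) * cis t / (cis t - z) = of_real (poisson_kernel z (cis t)) * h (cis t)" for t
  proof -
    have ne: "cis t \<noteq> z" using z by auto
    have "of_real ((norm (cis t - z))\<^sup>2) = (cis t - z) * cnj (cis t - z)"
      by (rule complex_norm_square)
    also have "\<dots> = (cis t - z) * (1 - cnj z * cis t) / cis t"
      using cnj_eq_inverse_circle[of "cis t"] by (simp add: field_simps)
    finally have 1: "of_real ((norm (cis t - z))\<^sup>2) = (cis t - z) * (1 - cnj z * cis t) / cis t" .
    have 2: "of_real ((norm z)\<^sup>2) = z * cnj z" by (rule complex_norm_square)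
    have "1 - cnj z * cis t \<noteq> 0" using nz[of "cis t"] R' by simp
    then show ?thesis
      unfolding poisson_kernel_def k_def of_real_divide of_real_diff 1 2 using ne by (simp add: field_simps)
  qed
  ultimately show ?thesis by simp
qed

text \<open>A real-valued integral, so that estimates stay in the reals; at the origin it is the
  plain mean over the circle, which is how the means of log^+ enter.\<close>

definition poisson_integral :: "(complex \<Rightarrow> real) \<Rightarrow> complex \<Rightarrow> real" where
  "poisson_integral u z = integral {0..2*pi} (\<lambda>t. poisson_kernel z (cis t) * u (cis t)) / (2*pi)"

lemma poisson_integrable:
  assumes "continuous_on (sphere 0 1) u" "norm z < 1"
  shows "(\<lambda>t. poisson_kernel z (cis t) * u (cis t)) integrable_on {0..2*pi}"
  using assms
  by (intro integrable_continuous_interval continuous_on_mult continuous_on_cis_compose continuous_on_poisson_kernel)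

lemma poisson_integral_Re:
  assumes h: "h holomorphic_on ball 0 R" "1 < R" and z: "norm z < 1"
  shows "poisson_integral (\<lambda>x. Re (h x)) z = Re (h z)"
proof -
  have "((\<lambda>t. Re (of_real (poisson_kernel z (cis t)) * h (cis t))) has_integral Re (2 * of_real pi * h z)) {0..2*pi}"
    using poisson_formula_complex[OF assms] by (intro has_integral_Re)
  then have "integral {0..2*pi} (\<lambda>t. poisson_kernel z (cis t) * Re (h (cis t))) = 2 * pi * Re (h z)"
    by (intro integral_unique) simp
  then show ?thesis by (simp add: poisson_integral_def)
qed

lemma poisson_integral_const: "norm z < 1 \<Longrightarrow> poisson_integral (\<lambda>x. c) z = c"
  using poisson_integral_Re[OF holomorphic_on_const, of 2 z "of_real c"] by simp

lemma poisson_integral_mono: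
  assumes "continuous_on (sphere 0 1) u" "continuous_on (sphere 0 1) v" "norm z < 1"
    and "\<And>x. norm x = 1 \<Longrightarrow> u x \<le> v x"
  shows "poisson_integral u z \<le> poisson_integral v z"
proof -
  have "integral {0..2*pi} (\<lambda>t. poisson_kernel z (cis t) * u (cis t))
      \<le> integral {0..2*pi} (\<lambda>t. poisson_kernel z (cis t) * v (cis t))"
    using assms by (intro integral_le poisson_integrable mult_left_mono poisson_kernel_nonneg) simp_all
  then show ?thesis by (simp add: poisson_integral_def divide_right_mono)
qed

lemma poisson_integral_nonneg:
  assumes "continuous_on (sphere 0 1) u" "norm z < 1" and "\<And>x. norm x = 1 \<Longrightarrow> 0 \<le> u x"
  shows "0 \<le> poisson_integral u z"
  using poisson_integral_mono[OF continuous_on_const assms(1,2), of 0] assms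
  by (simp add: poisson_integral_const)

lemma poisson_integral_cong:
  assumes "\<And>x. norm x = 1 \<Longrightarrow> u x = v x"
  shows "poisson_integral u z = poisson_integral v z"
  unfolding poisson_integral_def using assms by (simp cong: integral_cong)

lemma poisson_kernel_0: "norm x = 1 \<Longrightarrow> poisson_kernel 0 x = 1"
  by (simp add: poisson_kernel_def)

lemma poisson_integral_0: "poisson_integral u 0 = integral {0..2*pi} (\<lambda>t. u (cis t)) / (2*pi)"
  by (simp add: poisson_integral_def poisson_kernel_0)

text \<open>By compactness an e-neighbourhood of the closed disc stays inside the open set where
  \<open>h\<close> is defined and nonzero; a point just outside the disc is reached from its radial
  projection. The margin makes a holomorphic logarithm available across the circle.\<close>

lemma zero_free_neighbourhood:
  assumes h: "h holomorphic_on ball 0 R" "1 < R" and nz: "\<And>z. norm z \<le> 1 \<Longrightarrow> h z \<noteq> (0::complex)"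
  obtains R' where "1 < R'" "R' \<le> R" "\<And>z::complex. norm z < R' \<Longrightarrow> h z \<noteq> 0"
proof -
  have "open {z \<in> ball 0 R. h z \<in> - {0}}"
    using continuous_open_preimage[OF holomorphic_on_imp_continuous_on[OF h(1)] open_ball, of "- {0}"]
    by (auto simp: Int_def vimage_def)
  moreover have "cball 0 1 \<subseteq> {z \<in> ball 0 R. h z \<in> - {0}}"
  proof
    fix x :: complex assume "x \<in> cball 0 1"
    then show "x \<in> {z \<in> ball 0 R. h z \<in> - {0}}" using h(2) nz[of x] by simp
  qed
  ultimately obtain e where e: "e > 0" "(\<Union>x\<in>cball 0 1. ball x e) \<subseteq> {z \<in> ball 0 R. h z \<in> - {0}}"
    by (rule compact_subset_open_imp_ball_epsilon_subset[OF compact_cball])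
  show ?thesis
  proof (rule that[of "min R (1 + e)"])
    fix z :: complex assume z: "norm z < min R (1 + e)"
    show "h z \<noteq> 0"
    proof (cases "norm z \<le> 1")
      case False
      have "dist (z / of_real (norm z)) z < e"
      proof -
        have "z \<noteq> 0" using False by (metis norm_zero zero_le_one)
        then have "z / of_real (norm z) - z = z * of_real (1 / norm z - 1)" by (simp add: field_simps)
        then have "dist (z / of_real (norm z)) z = norm z * \<bar>1 / norm z - 1\<bar>"
          by (metis dist_norm norm_mult norm_of_real)
        also have "\<dots> = norm z - 1" using False \<open>z \<noteq> 0\<close> by (simp add: abs_if field_simps)
        finally show ?thesis using z by simp
      qed
      moreover have "z / of_real (norm z) \<in> cball 0 1" by (simp add: norm_divide)
      ultimately have "z \<in> (\<Union>x\<in>cball 0 1. ball x e)" by (intro UN_I[of "z / of_real (norm z)"]) simp_all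
      with e(2) have "z \<in> {z \<in> ball 0 R. h z \<in> - {0}}" by (rule subsetD)
      then show ?thesis by simp
    next
      case True
      then show ?thesis by (rule nz)
    qed
  qed (use e(1) h(2) in simp_all)
qed

text \<open>Dividing by a power of the Blaschke factor instead of z - a keeps the modulus on the
  circle unchanged. The whole multiplicity is removed at once, so the number of distinct zeros
  drops; the point \<open>c\<close> excludes the zero function.\<close>

lemma divide_out_zero:
  assumes h: "h holomorphic_on ball 0 R" "1 < R" and a: "norm a < 1" "h a = 0"
    and nc: "h c \<noteq> 0" "norm c \<le> 1"
  obtains k R' n where "k holomorphic_on ball 0 R'" "1 < R'" "R' \<le> R" "0 < n" "k a \<noteq> 0"
    "\<And>z. norm z < R' \<Longrightarrow> h z = (blaschke_factor a z) ^ n * k z"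
proof -
  have nconst: "\<not> h constant_on ball 0 R"
  proof
    assume "h constant_on ball 0 R"
    then obtain d where d: "\<And>x. x \<in> ball 0 R \<Longrightarrow> h x = d" unfolding constant_on_def by blast
    from d[of a] d[of c] a nc h show False by simp
  qed
  obtain g r n where g: "0 < n" "0 < r" "ball a r \<subseteq> ball 0 R" "g holomorphic_on ball a r"
      "\<And>w. w \<in> ball a r \<Longrightarrow> h w = (w - a)^n * g w" "\<And>w. w \<in> ball a r \<Longrightarrow> g w \<noteq> 0"
    by (rule holomorphic_factor_zero_nonconstant[OF h(1) open_ball connected_ball _ a(2) nconst]) (use a h in auto)
  define R' where "R' = (if a = 0 then R else min R (1 / norm a))"
  have R': "1 < R'" "R' \<le> R" using h a by (auto simp: R'_def)
  have nz: "1 - cnj a * x \<noteq> 0" if "norm x < R'" for x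
  proof
    assume "1 - cnj a * x = 0"
    then have eq: "cnj a * x = 1" by simp
    then have "norm a * norm x = 1" by (metis complex_mod_cnj norm_mult norm_one)
    moreover have "a \<noteq> 0" using eq by auto
    moreover have "norm x < 1 / norm a" using that \<open>a \<noteq> 0\<close> by (auto simp: R'_def)
    ultimately show False by (auto simp: field_simps)
  qed
  \<comment> \<open>The zero-free cofactor of x - a in the Blaschke factor; near a it identifies
    \<open>k\<close> with g / d^n, so the singularity at a is removable.\<close>
  define d where "d = (\<lambda>x. if a = 0 then 1 else - of_real (norm a) / a / (1 - cnj a * x))"
  have d: "d holomorphic_on ball 0 R'" "\<And>x. norm x < R' \<Longrightarrow> d x \<noteq> 0"
    "\<And>x. norm x < R' \<Longrightarrow> blaschke_factor a x = (x - a) * d x"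
    unfolding d_def blaschke_factor_def using nz
    by (cases "a = 0"; auto intro!: holomorphic_intros simp: field_simps)+
  define k where "k = (\<lambda>z. if z = a then g a / d a ^ n else h z / (blaschke_factor a z) ^ n)"
  have b0: "blaschke_factor a x = 0 \<longleftrightarrow> x = a" if "norm x < R'" for x
    using d(2,3)[OF that] by auto
  have keq: "k w = g w / d w ^ n" if "w \<in> ball a r" "norm w < R'" for w
  proof (cases "w = a")
    case False
    have "h w = (w - a) ^ n * g w" by (rule g(5)[OF that(1)])
    with False d(2)[OF that(2)] show ?thesis
      by (simp add: k_def d(3)[OF that(2)] power_mult_distrib)
  qed (simp add: k_def)
  have hk: "h z = (blaschke_factor a z) ^ n * k z" if "norm z < R'" for z
    using b0[OF that] a g(1) by (auto simp: k_def)
  have "k holomorphic_on ball 0 R'"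
  proof (rule no_isolated_singularity'[where K = "{a}"])
    fix z assume "z \<in> {a}"
    then have [simp]: "z = a" by simp
    have "open (ball a r \<inter> ball 0 R')" "a \<in> ball a r \<inter> ball 0 R'" using g a R' by auto
    moreover have "(\<lambda>w. g w / d w ^ n) holomorphic_on ball a r \<inter> ball 0 R'"
      using d by (intro holomorphic_intros holomorphic_on_subset[OF g(4)] holomorphic_on_subset[OF d(1)]) auto
    then have "k holomorphic_on ball a r \<inter> ball 0 R'"
      by (rule holomorphic_transform) (use keq in auto)
    ultimately have "isCont k a"
      using continuous_on_eq_continuous_at[of "ball a r \<inter> ball 0 R'" k] holomorphic_on_imp_continuous_on[of k]
      by auto
    then show "(k \<longlongrightarrow> k z) (at z within ball 0 R')"
      by (auto simp: isCont_def intro: tendsto_within_subset)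
  next
    have b: "blaschke_factor a holomorphic_on ball 0 R'"
      by (rule holomorphic_blaschke_factor) (use nz in force)
    have "(\<lambda>z. h z / (blaschke_factor a z) ^ n) holomorphic_on ball 0 R' - {a}"
    proof (intro holomorphic_intros)
      show "h holomorphic_on ball 0 R' - {a}" using R' by (intro holomorphic_on_subset[OF h(1)]) auto
      show "blaschke_factor a holomorphic_on ball 0 R' - {a}"
        by (rule holomorphic_on_subset[OF b]) auto
    qed (use b0 in auto)
    then show "k holomorphic_on ball 0 R' - {a}"
      by (rule holomorphic_transform) (auto simp: k_def)
  qed auto
  moreover have "k a \<noteq> 0" using g(2) g(6)[of a] d(2)[of a] a(1) R'(1) by (simp add: k_def)
  ultimately show ?thesis by (rule that[OF _ R' g(1)]) (rule hk)
qed

section \<open>Poisson-Jensen inequality\<close>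

lemma ln_inverse_norm_blaschke_nonneg:
  assumes "norm a < 1" "norm z < 1"
  shows "0 \<le> ln (inverse (norm (blaschke_factor a z)))"
proof (cases "norm (blaschke_factor a z) = 0")
  case False
  then have "0 < norm (blaschke_factor a z)" by simp
  then have "1 \<le> inverse (norm (blaschke_factor a z))"
    using norm_blaschke_factor_le_1[of a z] assms by (intro one_le_inverse) auto
  then show ?thesis by (rule ln_ge_zero)
next
  \<comment> \<open>At z = a the conventions inverse 0 = 0 and ln 0 = 0 give the value 0.\<close>
  case True
  show ?thesis unfolding True by simp
qed

text \<open>Induction on the number of zeros in the disc. A zero-free \<open>h\<close> has a
  holomorphic logarithm, and the Poisson formula gives equality; removing a Blaschke factor leaves
  the right side alone. It is an inequality because \<open>S\<close> may omit zeros and disregards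
  multiplicity, and the terms dropped are nonnegative.\<close>

lemma poisson_jensen:
  assumes "h holomorphic_on ball 0 R" "1 < R" "\<And>x. norm x = 1 \<Longrightarrow> h x \<noteq> 0"
    and "finite S" "\<And>a. a \<in> S \<Longrightarrow> norm a < 1 \<and> h a = 0" and z: "norm z < 1" "h z \<noteq> 0"
  shows "ln (norm (h z)) + (\<Sum>a\<in>S. ln (inverse (norm (blaschke_factor a z))))
           \<le> poisson_integral (\<lambda>x. ln (norm (h x))) z"
  using assms(1-5,7)
proof (induction "card {x. norm x < 1 \<and> h x = 0}" arbitrary: h R S rule: less_induct)
  case (less h R S)
  have fin: "finite {x. norm x < 1 \<and> h x = 0}"
  proof -
    have "\<not> h constant_on ball 0 R" if "norm a < 1" "h a = 0" for a
    proof
      assume "h constant_on ball 0 R"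
      then obtain c where c: "\<And>x. x \<in> ball 0 R \<Longrightarrow> h x = c" unfolding constant_on_def by blast
      from c[of a] c[of z] that z(1) less.prems(2,6) show False by simp
    qed
    then have "finite {x \<in> cball 0 1. h x = 0}" if "norm a < 1" "h a = 0" for a
      using that less.prems(1,2)
      by (intro holomorphic_compact_finite_zeros[of h "ball 0 R"]) auto
    moreover have "{x. norm x < 1 \<and> h x = 0} \<subseteq> {x \<in> cball 0 1. h x = 0}" by auto
    ultimately have "finite {x. norm x < 1 \<and> h x = 0}" if "norm a < 1" "h a = 0" for a
      using that by (meson finite_subset)
    then show ?thesis
      by (metis (mono_tags, lifting) finite.emptyI empty_Collect_eq)
  qed
  show ?case
  proof (cases "{x. norm x < 1 \<and> h x = 0} = {}")
    case True
    then have nz: "h x \<noteq> 0" if "norm x \<le> 1" for x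
      using that less.prems(3)[of x] by (cases "norm x = 1") auto
    have "S = {}" using True less.prems(5) by auto
    obtain R' where R': "1 < R'" "R' \<le> R" "\<And>z. norm z < R' \<Longrightarrow> h z \<noteq> 0"
      using zero_free_neighbourhood[OF less.prems(1,2) nz] by metis
    have "h holomorphic_on ball 0 R'" using R' by (auto intro: holomorphic_on_subset[OF less.prems(1)])
    then obtain g where g: "g holomorphic_on ball 0 R'" "\<And>x. x \<in> ball 0 R' \<Longrightarrow> exp (g x) = h x"
      using holomorphic_logarithm_exists[of "ball 0 R'" h 0] R' by auto
    have lnh: "ln (norm (h x)) = Re (g x)" if "norm x < R'" for x
    proof -
      have "norm (h x) = exp (Re (g x))" using g(2)[of x] that by (metis dist_0_norm mem_ball norm_exp_eq_Re)
      then show ?thesis by simp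
    qed
    have "poisson_integral (\<lambda>x. ln (norm (h x))) z = poisson_integral (\<lambda>x. Re (g x)) z"
      by (rule poisson_integral_cong) (use lnh R' in auto)
    also have "\<dots> = Re (g z)" using poisson_integral_Re[OF g(1) R'(1) z(1)] .
    finally have "poisson_integral (\<lambda>x. ln (norm (h x))) z = Re (g z)" .
    moreover have "ln (norm (h z)) = Re (g z)" using z(1) R'(1) by (intro lnh) linarith
    ultimately show ?thesis using \<open>S = {}\<close> by simp
  next
    case False
    then obtain a where a: "norm a < 1" "h a = 0" by blast
    obtain k R' n where k: "k holomorphic_on ball 0 R'" "1 < R'" "R' \<le> R" "0 < n" "k a \<noteq> 0"
      "\<And>z. norm z < R' \<Longrightarrow> h z = (blaschke_factor a z) ^ n * k z"
      by (rule divide_out_zero[OF less.prems(1,2) a less.prems(6)]) (use z in auto)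
    have normk: "norm (k x) = norm (h x)" if "norm x = 1" for x
      using k(6)[of x] that k(2) norm_blaschke_factor_circle[OF a(1) that] by (simp add: norm_mult norm_power)
    have "h x = 0" if "norm x < 1" "k x = 0" for x
      using k(6)[of x] that k(2) by simp
    then have zeros: "{x. norm x < 1 \<and> k x = 0} \<subset> {x. norm x < 1 \<and> h x = 0}"
      using a k(5) by blast
    have za: "z \<noteq> a" using a(2) less.prems(6) by metis
    then have bz: "blaschke_factor a z \<noteq> 0" using blaschke_factor_eq_0_iff[of a z] a z by auto
    have hz: "h z = (blaschke_factor a z) ^ n * k z" using k(6)[of z] k(2) z by simp
    then have kz: "k z \<noteq> 0" using less.prems(6) by (metis mult_zero_right)
    have "ln (norm (k z)) + (\<Sum>a\<in>S-{a}. ln (inverse (norm (blaschke_factor a z))))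
           \<le> poisson_integral (\<lambda>x. ln (norm (k x))) z"
    proof (rule less.hyps[of k R' "S - {a}"])
      show "card {x. norm x < 1 \<and> k x = 0} < card {x. norm x < 1 \<and> h x = 0}"
        using zeros fin by (rule psubset_card_mono[rotated])
      show "norm b < 1 \<and> k b = 0" if "b \<in> S - {a}" for b
        using less.prems(5)[of b] that k(6)[of b] k(2) blaschke_factor_eq_0_iff[of a b] a by auto
      show "k x \<noteq> 0" if "norm x = 1" for x using normk[OF that] less.prems(3)[OF that] by auto
      show "finite (S - {a})" using less.prems(4) by simp
    qed (fact k(1) k(2) kz)+
    moreover have "poisson_integral (\<lambda>x. ln (norm (k x))) z = poisson_integral (\<lambda>x. ln (norm (h x))) z"
      by (rule poisson_integral_cong) (use normk in auto)
    moreover have "ln (norm (h z)) = real n * ln (norm (blaschke_factor a z)) + ln (norm (k z))"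
      using bz kz by (simp add: hz norm_mult norm_power ln_mult ln_realpow)
    \<comment> \<open>The multiplicity \<open>n\<close> is at least 1, so it pays for the one term
      that \<open>S\<close> may contain for \<open>a\<close>; if \<open>a\<close> is not in
      \<open>S\<close>, the surplus is nonnegative.\<close>
    moreover have "(\<Sum>a\<in>S. ln (inverse (norm (blaschke_factor a z))))
        \<le> (\<Sum>a\<in>S-{a}. ln (inverse (norm (blaschke_factor a z)))) - real n * ln (norm (blaschke_factor a z))"
    proof -
      have ge: "0 \<le> - ln (norm (blaschke_factor a z))"
        using ln_inverse_norm_blaschke_nonneg[of a z] a z bz by (simp add: ln_inverse)
      have "- ln (norm (blaschke_factor a z)) \<le> real n * (- ln (norm (blaschke_factor a z)))"
        using mult_right_mono[OF _ ge, of 1 "real n"] k(4) by simp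
      moreover have "(\<Sum>b\<in>S. ln (inverse (norm (blaschke_factor b z))))
          \<le> (\<Sum>b\<in>S-{a}. ln (inverse (norm (blaschke_factor b z)))) - ln (norm (blaschke_factor a z))"
      proof (cases "a \<in> S")
        case True
        then show ?thesis using less.prems(4) bz by (subst sum.remove[of S a]) (simp_all add: ln_inverse)
      qed (use ge in simp)
      ultimately show ?thesis by linarith
    qed
    ultimately show ?thesis by linarith
  qed
qed

section \<open>Means of \<open>log\<^sup>+ |f|\<close>\<close>

text \<open>\<open>ln\<close> is even on the reals, and the argument on the right never falls below
  1, so continuity of \<open>log_plus\<close> becomes immediate.\<close>

lemma log_plus_eq: "log_plus x = ln (max 1 \<bar>x\<bar>)"
proof (cases "\<bar>x\<bar> \<ge> 1")
  case True
  have "ln x = ln \<bar>x\<bar>" by (simp add: abs_if ln_minus)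
  moreover have "0 \<le> ln \<bar>x\<bar>" using True by (rule ln_ge_zero)
  ultimately show ?thesis using True by (simp add: log_plus_def max_def)
next
  case False
  then have "ln \<bar>x\<bar> \<le> 0" by (cases "x = 0") auto
  then have "ln x \<le> 0" by (simp add: abs_if ln_minus split: if_splits)
  then show ?thesis using False by (simp add: log_plus_def max_def)
qed

lemma continuous_on_log_plus [continuous_intros]:
  "continuous_on A f \<Longrightarrow> continuous_on A (\<lambda>x. log_plus (f x))"
  unfolding log_plus_eq by (intro continuous_intros) (auto simp: max_def)

lemma log_plus_nonneg [simp]: "0 \<le> log_plus x"
  by (simp add: log_plus_def)

lemma ln_le_log_plus: "ln x \<le> log_plus x"
  by (simp add: log_plus_def)

lemma log_plus_mono: "\<bar>x\<bar> \<le> \<bar>y\<bar> \<Longrightarrow> log_plus x \<le> log_plus y"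
  by (simp add: log_plus_eq max_def)

lemma log_plus_mult_le: "log_plus (x * y) \<le> log_plus x + log_plus y"
proof -
  have "max 1 \<bar>x * y\<bar> \<le> max 1 \<bar>x\<bar> * max 1 \<bar>y\<bar>"
    unfolding abs_mult by (intro max.boundedI mult_mono) (auto simp: mult_ge1_I)
  then have "ln (max 1 \<bar>x * y\<bar>) \<le> ln (max 1 \<bar>x\<bar> * max 1 \<bar>y\<bar>)" by simp
  also have "\<dots> = log_plus x + log_plus y" unfolding log_plus_eq by (intro ln_mult_pos) auto
  finally show ?thesis by (simp add: log_plus_eq)
qed

lemma log_plus_exp: "x \<ge> 0 \<Longrightarrow> log_plus (exp x) = x"
  by (simp add: log_plus_def)

section \<open>Circle means as Poisson integrals at the origin\<close>

lemma circle_mean_eq: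
  assumes "continuous_on (sphere 0 1) u" "\<And>x. norm x = 1 \<Longrightarrow> 0 \<le> u x"
  shows "circle_mean (\<lambda>t. u (cis t)) = ennreal (poisson_integral u 0)"
proof -
  have "(\<lambda>t. u (cis t)) integrable_on {0..2*pi}"
    using assms by (intro integrable_continuous_interval continuous_on_cis_compose)
  then have "((\<lambda>t. u (cis t)) has_integral integral {0..2*pi} (\<lambda>t. u (cis t))) {0..2*pi}"
    by (rule integrable_integral)
  then have "(\<integral>\<^sup>+t. ennreal (u (cis t)) * indicator {0..2*pi} t \<partial>lborel) = ennreal (integral {0..2*pi} (\<lambda>t. u (cis t)))"
    using assms by (intro nn_integral_has_integral_lebesgue') auto
  then have "circle_mean (\<lambda>t. u (cis t)) = ennreal (integral {0..2*pi} (\<lambda>t. u (cis t))) / ennreal (2*pi)"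
    by (simp add: circle_mean_def nn_integral_completion)
  also have "\<dots> = ennreal (poisson_integral u 0)"
    using assms unfolding poisson_integral_0
    by (intro divide_ennreal integral_nonneg integrable_continuous_interval continuous_on_cis_compose) auto
  finally show ?thesis .
qed

text \<open>For 0 < r < 1 the dilate of a holomorphic function on the open disc is holomorphic
  across the circle, so the formulas for functions on a larger disc apply to it.\<close>

definition dilate :: "(complex \<Rightarrow> complex) \<Rightarrow> real \<Rightarrow> complex \<Rightarrow> complex" where
  "dilate f r = (\<lambda>z. f (of_real r * z))"

lemma holomorphic_dilate:
  assumes "f holomorphic_on ball 0 R" "0 < r"
  shows "dilate f r holomorphic_on ball 0 (R / r)"
proof -
  have "(\<lambda>z. f (of_real r * z)) holomorphic_on ball 0 (R / r)"
    by (rule holomorphic_on_compose_gen[OF _ assms(1), unfolded o_def])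
       (use assms in \<open>auto intro!: holomorphic_intros simp: norm_mult field_simps\<close>)
  then show ?thesis by (simp add: dilate_def)
qed

lemma continuous_on_dilate:
  assumes "continuous_on (ball 0 1) f" "0 \<le> r" "r < 1"
  shows "continuous_on (cball 0 1) (dilate f r)"
  unfolding dilate_def
proof (rule continuous_on_compose2[OF assms(1)])
  show "(\<lambda>z. complex_of_real r * z) ` cball 0 1 \<subseteq> ball 0 1"
  proof clarsimp
    fix z :: complex assume "norm z \<le> 1"
    then have "r * norm z \<le> r" using assms(2) mult_left_le by blast
    then show "norm (complex_of_real r * z) < 1" using assms by (simp add: norm_mult)
  qed
qed (intro continuous_intros)

lemma continuous_on_log_plus_dilate:
  assumes "continuous_on (ball 0 1) f" "0 \<le> r" "r < 1"
  shows "continuous_on (sphere 0 1) (\<lambda>x. log_plus (norm (dilate f r x)))"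
  by (intro continuous_intros continuous_on_subset[OF continuous_on_dilate[OF assms]]) auto

lemma log_plus_mean_eq:
  assumes "continuous_on (ball 0 1) f" "0 \<le> r" "r < 1"
  shows "log_plus_mean f r = ennreal (poisson_integral (\<lambda>x. log_plus (norm (dilate f r x))) 0)"
  using circle_mean_eq[OF continuous_on_log_plus_dilate[OF assms]]
  by (simp add: log_plus_mean_def dilate_def)

text \<open>Stopping at an intermediate \<open>r1\<close> < 1 leaves a compact disc, in which a
  nonzero \<open>f\<close> has finitely many zeros; all but finitely many radii below
  \<open>r1\<close> therefore avoid them.\<close>

lemma generic_radius:
  assumes f: "f holomorphic_on ball 0 1" "norm c < 1" "f c \<noteq> 0" and r: "r < 1"
  obtains \<rho> where "r < \<rho>" "\<rho> < 1" "0 < \<rho>" "\<And>x. norm x = 1 \<Longrightarrow> dilate f \<rho> x \<noteq> 0"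
proof -
  define r0 where "r0 = max r 0"
  define r1 where "r1 = (r0 + 1) / 2"
  have r1: "r0 < r1" "r1 < 1" "0 \<le> r0" "r \<le> r0" using r by (auto simp: r1_def r0_def)
  have fin: "finite (norm ` {z \<in> cball 0 r1. f z = 0})"
  proof (cases "f constant_on ball 0 1")
    case True
    then obtain d where d: "\<And>x. x \<in> ball 0 1 \<Longrightarrow> f x = d" unfolding constant_on_def by blast
    with d[of c] f have "d \<noteq> 0" by simp
    then have "f z \<noteq> 0" if "z \<in> cball 0 r1" for z using d[of z] that r1 by simp
    then have "{z \<in> cball 0 r1. f z = 0} = {}" by blast
    then show ?thesis by (simp only: image_empty finite.emptyI)
  next
    case False
    then show ?thesis
      using f r1 by (intro finite_imageI holomorphic_compact_finite_zeros[of f "ball 0 1"]) auto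
  qed
  have "infinite ({r0<..<r1} - norm ` {z \<in> cball 0 r1. f z = 0})"
    by (rule Diff_infinite_finite[OF fin]) (use r1 in \<open>simp add: infinite_Ioo\<close>)
  then have "{r0<..<r1} - norm ` {z \<in> cball 0 r1. f z = 0} \<noteq> {}" by (rule infinite_imp_nonempty)
  then obtain \<rho> where \<rho>: "\<rho> \<in> {r0<..<r1}" "\<rho> \<notin> norm ` {z \<in> cball 0 r1. f z = 0}"
    unfolding ex_in_conv[symmetric] Diff_iff by (elim exE conjE)
  show ?thesis
  proof (rule that[of \<rho>])
    fix x :: complex assume x: "norm x = 1"
    have n: "norm (of_real \<rho> * x) = \<rho>" using \<rho> r1 x by (simp add: norm_mult)
    show "dilate f \<rho> x \<noteq> 0"
    proof
      assume "dilate f \<rho> x = 0"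
      then have "of_real \<rho> * x \<in> {z \<in> cball 0 r1. f z = 0}" using n \<rho> by (simp add: dilate_def)
      then have "norm (of_real \<rho> * x) \<in> norm ` {z \<in> cball 0 r1. f z = 0}" by (rule imageI)
      then show False using n \<rho> by simp
    qed
  qed (use \<rho> r1 in auto)
qed

text \<open>Where |h(z)| exceeds 1, Poisson-Jensen with an empty list of zeros bounds ln |h(z)|, and
  ln is below log^+ on the circle; elsewhere the left side is 0.\<close>

lemma log_plus_le_poisson_generic:
  assumes h: "h holomorphic_on ball 0 R" "1 < R" "\<And>x. norm x = 1 \<Longrightarrow> h x \<noteq> 0" and z: "norm z < 1"
  shows "log_plus (norm (h z)) \<le> poisson_integral (\<lambda>x. log_plus (norm (h x))) z"
proof -
  have ch: "continuous_on (sphere 0 1) h"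
    using h by (intro holomorphic_on_imp_continuous_on holomorphic_on_subset[OF h(1)]) auto
  then have c1: "continuous_on (sphere 0 1) (\<lambda>x. log_plus (norm (h x)))" by (intro continuous_intros)
  show ?thesis
  proof (cases "norm (h z) \<le> 1")
    case True
    then have "log_plus (norm (h z)) = 0" by (simp add: log_plus_eq max_def)
    then show ?thesis using poisson_integral_nonneg[OF c1 z] by simp
  next
    case False
    then have "log_plus (norm (h z)) = ln (norm (h z))" by (simp add: log_plus_eq max_def)
    also have "\<dots> \<le> poisson_integral (\<lambda>x. ln (norm (h x))) z"
    proof -
      have "h z \<noteq> 0" using False by (metis norm_zero zero_le_one)
      then show ?thesis using poisson_jensen[OF h finite.emptyI _ z] by simp
    qed
    also have "\<dots> \<le> poisson_integral (\<lambda>x. log_plus (norm (h x))) z"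
    proof (rule poisson_integral_mono[OF _ c1 z ln_le_log_plus])
      show "continuous_on (sphere 0 1) (\<lambda>x. ln (norm (h x)))"
        using ch h(3) by (intro continuous_intros) auto
    qed
    finally show ?thesis .
  qed
qed

text \<open>Zeros on the circle are circumvented by dilation: the defect \<open>F\<close> is
  continuous in the dilation parameter, nonpositive at zero-free radii, and these accumulate at
  1.\<close>

lemma log_plus_le_poisson:
  assumes h: "h holomorphic_on ball 0 R" "1 < R" and z: "norm z < 1"
  shows "log_plus (norm (h z)) \<le> poisson_integral (\<lambda>x. log_plus (norm (h x))) z"
proof (cases "\<exists>c. norm c < 1 \<and> h c \<noteq> 0")
  case False
  have ch: "continuous_on (sphere 0 1) h"
    using h by (intro holomorphic_on_imp_continuous_on holomorphic_on_subset[OF h(1)]) auto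
  have "h z = 0" using False z by blast
  then have "log_plus (norm (h z)) = 0" by (simp add: log_plus_def)
  then show ?thesis using ch z by (auto intro!: poisson_integral_nonneg continuous_intros)
next
  case True
  then obtain c where c: "norm c < 1" "h c \<noteq> 0" by blast
  have ch: "continuous_on (cball 0 1) h"
    using h by (intro holomorphic_on_imp_continuous_on holomorphic_on_subset[OF h(1)]) auto
  have h1: "h holomorphic_on ball 0 1" using h by (auto intro: holomorphic_on_subset)
  define G where "G = {s\<in>{0<..<1}. \<forall>x. norm x = 1 \<longrightarrow> dilate h s x \<noteq> 0}"
  define F where "F = (\<lambda>s. log_plus (norm (dilate h s z)) - poisson_integral (\<lambda>x. log_plus (norm (dilate h s x))) z)"
  have nle: "s * norm x \<le> 1" if "0 \<le> s" "s \<le> 1" "norm x \<le> 1" for s :: real and x :: complex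
    using that by (simp add: mult_le_one)
  have "continuous_on {0..1} (\<lambda>s. integral (cbox 0 (2*pi)) (\<lambda>t. poisson_kernel z (cis t) * log_plus (norm (dilate h s (cis t)))))"
  proof (rule integral_continuous_on_param)
    have "continuous_on ({0..1} \<times> cbox 0 (2*pi)) (\<lambda>p. h (of_real (fst p) * cis (snd p)))"
      by (rule continuous_on_compose2[OF ch]) (auto intro!: continuous_intros simp: norm_mult)
    moreover have "continuous_on ({0..1} \<times> cbox 0 (2*pi)) (\<lambda>p. poisson_kernel z (cis (snd p)))"
      by (rule continuous_on_compose2[OF continuous_on_poisson_kernel[OF z]]) (auto intro!: continuous_intros)
    ultimately show "continuous_on ({0..1} \<times> cbox 0 (2*pi)) (\<lambda>(s, t). poisson_kernel z (cis t) * log_plus (norm (dilate h s (cis t))))"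
      unfolding dilate_def case_prod_unfold by (intro continuous_intros)
  qed
  then have "continuous_on {0..1} (\<lambda>s. poisson_integral (\<lambda>x. log_plus (norm (dilate h s x))) z)"
    unfolding poisson_integral_def cbox_interval by (intro continuous_intros) auto
  moreover have "continuous_on {0..1} (\<lambda>s. log_plus (norm (dilate h s z)))"
    unfolding dilate_def
    by (intro continuous_intros continuous_on_compose2[OF ch]) (use z in \<open>auto simp: norm_mult intro!: nle\<close>)
  ultimately have cF: "continuous_on {0..1} F" unfolding F_def by (intro continuous_on_diff)
  have "closure G \<subseteq> closure {0..1}" by (rule closure_mono) (auto simp: G_def)
  then have "continuous_on (closure G) F" using continuous_on_subset[OF cF] by simp
  moreover have "1 \<in> closure G"
    unfolding closure_approachable
  proof safe
    fix e :: real assume "e > 0"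
    obtain \<rho> where \<rho>: "1 - e < \<rho>" "\<rho> < 1" "0 < \<rho>" "\<And>x. norm x = 1 \<Longrightarrow> dilate h \<rho> x \<noteq> 0"
      using generic_radius[OF h1 c, of "1 - e"] \<open>e > 0\<close> by auto
    then show "\<exists>y\<in>G. dist y 1 < e" by (intro bexI[of _ \<rho>]) (auto simp: G_def dist_real_def)
  qed
  moreover have "F s \<le> 0" if "s \<in> G" for s
  proof -
    have s: "0 < s" "s < 1" "\<And>x. norm x = 1 \<Longrightarrow> dilate h s x \<noteq> 0" using that by (auto simp: G_def)
    have "1 < 1 / s" using s by simp
    from log_plus_le_poisson_generic[OF holomorphic_dilate[OF h1 s(1)] this s(3) z]
    show ?thesis by (simp add: F_def)
  qed
  ultimately have "F 1 \<le> 0" by (rule continuous_le_on_closure)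
  then show ?thesis by (simp add: F_def dilate_def)
qed

lemma poisson_kernel_swap:
  assumes "norm x = 1" "norm y = 1" "0 \<le> s"
  shows "poisson_kernel (of_real s * x) y = poisson_kernel (of_real s * y) x"
proof -
  have "(norm (y - of_real s * x))\<^sup>2 = (norm (x - of_real s * y))\<^sup>2"
  proof -
    have "(norm x)\<^sup>2 = 1" "(norm y)\<^sup>2 = 1" using assms by auto
    then show ?thesis unfolding cmod_power2 by (simp add: power2_eq_square algebra_simps) algebra
  qed
  then show ?thesis using assms by (simp add: poisson_kernel_def norm_mult)
qed

text \<open>Fubini, followed by exchanging the two unimodular variables in the kernel, turns the
  inner integral into a Poisson integral of a constant.\<close>

lemma poisson_integral_mean:
  assumes u: "continuous_on (sphere 0 1) u" and s: "0 \<le> s" "s < 1"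
  shows "integral {0..2*pi} (\<lambda>t. poisson_integral u (of_real s * cis t)) = integral {0..2*pi} (\<lambda>t. u (cis t))"
proof -
  have ns: "norm (of_real s * cis t) < 1" for t using s by (simp add: norm_mult)
  have cont: "continuous_on (cbox (0, 0) (2*pi, 2*pi)) (\<lambda>(t, v). poisson_kernel (of_real s * cis t) (cis v) * u (cis v))"
  proof -
    have "continuous_on (cbox (0, 0) (2*pi, 2*pi)) (\<lambda>p. u (cis (snd p)))"
      by (rule continuous_on_compose2[OF u]) (auto intro!: continuous_intros)
    moreover have "cis v \<noteq> of_real s * cis t" for v t using ns[of t] by (metis less_irrefl norm_cis)
    ultimately show ?thesis
      unfolding case_prod_unfold poisson_kernel_def by (intro continuous_intros) auto
  qed
  have "integral {0..2*pi} (\<lambda>t. poisson_integral u (of_real s * cis t)) =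
      integral {0..2*pi} (\<lambda>t. integral {0..2*pi} (\<lambda>v. poisson_kernel (of_real s * cis t) (cis v) * u (cis v))) / (2*pi)"
    unfolding poisson_integral_def by simp
  also have "\<dots> = integral {0..2*pi} (\<lambda>v. integral {0..2*pi} (\<lambda>t. poisson_kernel (of_real s * cis t) (cis v) * u (cis v))) / (2*pi)"
    using integral_swap_continuous[OF cont] by (simp add: cbox_interval)
  also have "\<dots> = integral {0..2*pi} (\<lambda>v. u (cis v))"
  proof -
    have "integral {0..2*pi} (\<lambda>t. poisson_kernel (of_real s * cis t) (cis v) * u (cis v)) = 2 * pi * u (cis v)" for v
    proof -
      have "integral {0..2*pi} (\<lambda>t. poisson_kernel (of_real s * cis t) (cis v) * u (cis v))
         = 2 * pi * poisson_integral (\<lambda>x. u (cis v)) (of_real s * cis v)"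
        using s by (simp add: poisson_integral_def poisson_kernel_swap[of "cis v"])
      also have "\<dots> = 2 * pi * u (cis v)" by (simp only: poisson_integral_const[OF ns])
      finally show ?thesis .
    qed
    then have "(\<lambda>v. integral {0..2*pi} (\<lambda>t. poisson_kernel (of_real s * cis t) (cis v) * u (cis v)))
        = (\<lambda>v. 2 * pi * u (cis v))" by (rule ext)
    then show ?thesis by (simp only:) simp
  qed
  finally show ?thesis .
qed

text \<open>With s = r / \<open>\<rho>\<close>, the circle of radius r for \<open>f\<close> is the
  circle of radius s for the dilate by \<open>\<rho>\<close>; the Poisson majorant there is averaged
  with \<open>poisson_integral_mean\<close>.\<close>

lemma log_plus_mean_mono:
  assumes f: "f holomorphic_on ball 0 1" and r: "0 \<le> r" "r \<le> \<rho>" "\<rho> < 1"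
  shows "poisson_integral (\<lambda>x. log_plus (norm (dilate f r x))) 0
           \<le> poisson_integral (\<lambda>x. log_plus (norm (dilate f \<rho> x))) 0"
proof (cases "r = \<rho>")
  case False
  then have r: "0 \<le> r" "r < \<rho>" "\<rho> < 1" "0 < \<rho>" using r by auto
  define s where "s = r / \<rho>"
  have s: "0 \<le> s" "s < 1" using r by (auto simp: s_def)
  have cf: "continuous_on (ball 0 1) f" using f by (rule holomorphic_on_imp_continuous_on)
  have "1 < 1 / \<rho>" using r by simp
  note le = log_plus_le_poisson[OF holomorphic_dilate[OF f r(4)] this]
  define u where "u = (\<lambda>x. log_plus (norm (dilate f \<rho> x)))"
  have cu: "continuous_on (sphere 0 1) u" using r unfolding u_def by (intro continuous_on_log_plus_dilate cf) auto
  have int: "(\<lambda>t. log_plus (norm (dilate f r (cis t)))) integrable_on {0..2*pi}"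
    using r by (intro integrable_continuous_interval continuous_on_cis_compose continuous_on_log_plus_dilate cf) auto
  have ci: "continuous_on {0..2*pi} (\<lambda>t. poisson_integral u (of_real s * cis t))"
  proof -
    have "continuous_on {0..2*pi} (\<lambda>t. integral (cbox 0 (2*pi)) (\<lambda>v. poisson_kernel (of_real s * cis t) (cis v) * u (cis v)))"
    proof (rule integral_continuous_on_param)
      have "continuous_on ({0..2*pi} \<times> cbox 0 (2*pi)) (\<lambda>p. u (cis (snd p)))"
        by (rule continuous_on_compose2[OF cu]) (auto intro!: continuous_intros)
      moreover have "cis v \<noteq> of_real s * cis t" for v t
      proof
        assume "cis v = of_real s * cis t"
        then have "norm (cis v) = norm (of_real s * cis t)" by simp
        then show False using s by (simp add: norm_mult)
      qed
      ultimately show "continuous_on ({0..2*pi} \<times> cbox 0 (2*pi))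
          (\<lambda>(t, v). poisson_kernel (of_real s * cis t) (cis v) * u (cis v))"
        unfolding case_prod_unfold poisson_kernel_def by (intro continuous_intros) auto
    qed
    then show ?thesis unfolding poisson_integral_def cbox_interval by (intro continuous_intros) auto
  qed
  have "integral {0..2*pi} (\<lambda>t. log_plus (norm (dilate f r (cis t))))
     \<le> integral {0..2*pi} (\<lambda>t. poisson_integral u (of_real s * cis t))"
  proof (rule integral_le[OF int integrable_continuous_interval[OF ci]])
    fix t
    have "dilate f r (cis t) = dilate f \<rho> (of_real s * cis t)"
      using r by (simp add: dilate_def s_def)
    moreover have "norm (of_real s * cis t) < 1" using s by (simp add: norm_mult)
    ultimately show "log_plus (norm (dilate f r (cis t))) \<le> poisson_integral u (of_real s * cis t)"
      using le unfolding u_def by simp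
  qed
  also have "\<dots> = integral {0..2*pi} (\<lambda>t. u (cis t))" by (rule poisson_integral_mean[OF cu s])
  finally show ?thesis unfolding poisson_integral_0 u_def by (simp add: divide_right_mono)
qed simp

text \<open>The means increase with the radius, so the limit in the definition dominates all of
  them; together with \<open>nevanlinna_classI\<close>, membership amounts to one bound for all
  radii.\<close>

lemma nevanlinna_classD:
  assumes "f \<in> nevanlinna_class"
  obtains C where "0 \<le> C" "f holomorphic_on ball 0 1"
    "\<And>r. 0 < r \<Longrightarrow> r < 1 \<Longrightarrow> poisson_integral (\<lambda>x. log_plus (norm (dilate f r x))) 0 \<le> C"
proof -
  obtain L where f: "f holomorphic_on ball 0 1" and L: "L < \<infinity>" "(log_plus_mean f \<longlongrightarrow> L) (at_left 1)"
    using assms by (auto simp: nevanlinna_class_def)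
  have cf: "continuous_on (ball 0 1) f" using f by (rule holomorphic_on_imp_continuous_on)
  have "poisson_integral (\<lambda>x. log_plus (norm (dilate f r x))) 0 \<le> enn2real L" if r: "0 < r" "r < 1" for r
  proof -
    have "eventually (\<lambda>\<rho>. log_plus_mean f r \<le> log_plus_mean f \<rho>) (at_left 1)"
      unfolding eventually_at_left_field
    proof (intro exI[of _ r] conjI allI impI)
      fix \<rho> assume "r < \<rho>" "\<rho> < 1"
      then show "log_plus_mean f r \<le> log_plus_mean f \<rho>"
        using r log_plus_mean_mono[OF f, of r \<rho>] by (simp add: log_plus_mean_eq[OF cf] ennreal_leI)
    qed (use r in auto)
    then have "log_plus_mean f r \<le> L"
      by (rule tendsto_lowerbound[OF L(2)]) simp
    then have "ennreal (poisson_integral (\<lambda>x. log_plus (norm (dilate f r x))) 0) \<le> L"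
      using r by (simp add: log_plus_mean_eq[OF cf])
    then have "enn2real (ennreal (poisson_integral (\<lambda>x. log_plus (norm (dilate f r x))) 0)) \<le> enn2real L"
      using L(1) by (intro enn2real_mono) auto
    moreover have "0 \<le> poisson_integral (\<lambda>x. log_plus (norm (dilate f r x))) 0"
      using r by (intro poisson_integral_nonneg continuous_on_log_plus_dilate cf) auto
    ultimately show ?thesis by simp
  qed
  then show ?thesis using that[of "enn2real L"] f by auto
qed

lemma log_plus_mean_tendsto:
  assumes f: "f holomorphic_on ball 0 1"
  shows "(log_plus_mean f \<longlongrightarrow> (SUP r\<in>{0<..<1}. log_plus_mean f r)) (at_left 1)"
proof (rule order_tendstoI)
  have cf: "continuous_on (ball 0 1) f" using f by (rule holomorphic_on_imp_continuous_on)
  fix a assume "a < (SUP r\<in>{0<..<1}. log_plus_mean f r)"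
  then obtain r where r: "0 < r" "r < 1" "a < log_plus_mean f r" by (auto simp: less_SUP_iff)
  show "eventually (\<lambda>r. a < log_plus_mean f r) (at_left 1)"
    unfolding eventually_at_left_field
  proof (intro exI[of _ r] conjI allI impI)
    fix \<rho> assume "r < \<rho>" "\<rho> < 1"
    then have "log_plus_mean f r \<le> log_plus_mean f \<rho>"
      using r log_plus_mean_mono[OF f, of r \<rho>] by (simp add: log_plus_mean_eq[OF cf] ennreal_leI)
    then show "a < log_plus_mean f \<rho>" using r(3) by (rule less_le_trans[rotated])
  qed (use r in auto)
next
  fix a assume a: "(SUP r\<in>{0<..<1}. log_plus_mean f r) < a"
  show "eventually (\<lambda>r. log_plus_mean f r < a) (at_left 1)"
    unfolding eventually_at_left_field
  proof (intro exI[of _ 0] conjI allI impI)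
    fix r :: real assume "0 < r" "r < 1"
    then have "log_plus_mean f r \<le> (SUP r\<in>{0<..<1}. log_plus_mean f r)" by (intro SUP_upper) auto
    then show "log_plus_mean f r < a" using a by (rule le_less_trans)
  qed auto
qed

lemma nevanlinna_classI:
  assumes f: "f holomorphic_on ball 0 1"
    and C: "\<And>r. 0 < r \<Longrightarrow> r < 1 \<Longrightarrow> poisson_integral (\<lambda>x. log_plus (norm (dilate f r x))) 0 \<le> C"
  shows "f \<in> nevanlinna_class"
proof -
  have cf: "continuous_on (ball 0 1) f" using f by (rule holomorphic_on_imp_continuous_on)
  have "(SUP r\<in>{0<..<1}. log_plus_mean f r) \<le> ennreal C"
    using C by (intro SUP_least) (simp add: log_plus_mean_eq[OF cf] ennreal_leI)
  also have "\<dots> < \<infinity>" by simp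
  finally show ?thesis
    unfolding nevanlinna_class_def using f log_plus_mean_tendsto[OF f] by blast
qed

section \<open>Cuts and the balayage bound\<close>

text \<open>Each atom has mass at least 1 - |a|, and the simple function with value P_a at each a in
  \<open>T\<close> lies below the kernel integrated in the balayage. So the finite sum is at most
  the finite supremum, taken back to a real number.\<close>

lemma sum_poisson_le_of_bounded_balayage:
  assumes "bounded_balayage (point_measure_of \<Lambda>)" "\<Lambda> \<subseteq> ball 0 1"
  obtains K where "0 \<le> K" "\<And>T \<zeta>. finite T \<Longrightarrow> T \<subseteq> \<Lambda> \<Longrightarrow> norm \<zeta> = 1 \<Longrightarrow>
     (\<Sum>a\<in>T. (1 - norm a) * poisson_kernel a \<zeta>) \<le> K"
proof -
  define B where "B = (SUP \<zeta>\<in>sphere 0 1. balayage (point_measure_of \<Lambda>) \<zeta>)"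
  have B: "B < \<infinity>" using assms(1) by (simp add: bounded_balayage_def B_def)
  show ?thesis
  proof (rule that[of "enn2real B"])
    fix T and \<zeta> :: complex assume T: "finite T" "T \<subseteq> \<Lambda>" and \<zeta>: "norm \<zeta> = 1"
    let ?M = "point_measure_of \<Lambda>"
    have sing: "{a} \<in> sets disc_borel" if "a \<in> T" for a
      using that T assms(2) by (auto simp: disc_borel_def sets_restrict_space intro!: image_eqI[of _ _ "{a}"])
    have atom: "ennreal (1 - norm a) \<le> emeasure ?M {a}" if a: "a \<in> T" for a
    proof -
      have "a \<in> space disc_borel" using a T assms(2) by (auto simp: disc_borel_def space_restrict_space)
      then have "ennreal (1 - norm a) = (\<Sum>b\<in>{a}. ennreal (1 - norm b) * emeasure (return disc_borel b) {a})"
        using sing[OF a] by simp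
      also have "\<dots> \<le> (\<Sum>\<^sub>\<infinity>b\<in>\<Lambda>. ennreal (1 - norm b) * emeasure (return disc_borel b) {a})"
        unfolding nonneg_infsum_complete[of \<Lambda> "\<lambda>b. ennreal (1 - norm b) * emeasure (return disc_borel b) {a}", OF zero_le]
        using a T by (intro SUP_upper) auto
      also have "\<dots> = emeasure ?M {a}" by (rule emeasure_point_measure_of[OF sing[OF a], symmetric])
      finally show ?thesis .
    qed
    have pos: "0 \<le> (1 - norm a) * poisson_kernel a \<zeta>" if "a \<in> T" for a
      using that T assms(2) poisson_kernel_nonneg[of a \<zeta>] by (auto intro!: mult_nonneg_nonneg simp: less_imp_le)
    have "ennreal (\<Sum>a\<in>T. (1 - norm a) * poisson_kernel a \<zeta>) = (\<Sum>a\<in>T. ennreal ((1 - norm a) * poisson_kernel a \<zeta>))"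
      using pos by (simp add: sum_ennreal)
    also have "\<dots> = (\<Sum>a\<in>T. ennreal (poisson_kernel a \<zeta>) * ennreal (1 - norm a))"
    proof (rule sum.cong)
      fix a assume a: "a \<in> T"
      then have "norm a < 1" using T assms(2) by auto
      then show "ennreal ((1 - norm a) * poisson_kernel a \<zeta>) = ennreal (poisson_kernel a \<zeta>) * ennreal (1 - norm a)"
        using poisson_kernel_nonneg[of a \<zeta>] by (simp add: ennreal_mult mult.commute)
    qed simp
    also have "\<dots> \<le> (\<Sum>a\<in>T. ennreal (poisson_kernel a \<zeta>) * emeasure ?M {a})"
      by (intro sum_mono mult_left_mono atom) auto
    also have "\<dots> = (\<Sum>a\<in>T. \<integral>\<^sup>+z. ennreal (poisson_kernel a \<zeta>) * indicator {a} z \<partial>?M)"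
      using sing by (intro sum.cong refl nn_integral_cmult_indicator[symmetric]) simp
    also have "\<dots> = (\<integral>\<^sup>+z. (\<Sum>a\<in>T. ennreal (poisson_kernel a \<zeta>) * indicator {a} z) \<partial>?M)"
      using sing by (intro nn_integral_sum[symmetric] borel_measurable_times_ennreal borel_measurable_indicator) auto
    also have "\<dots> \<le> (\<integral>\<^sup>+z. ennreal (poisson_kernel z \<zeta>) \<partial>?M)"
    proof (rule nn_integral_mono)
      fix z
      have "(\<Sum>a\<in>T. ennreal (poisson_kernel a \<zeta>) * indicator {a} z) = (\<Sum>a\<in>T. if a = z then ennreal (poisson_kernel z \<zeta>) else 0)"
        by (intro sum.cong) (auto simp: indicator_def)
      also have "\<dots> \<le> ennreal (poisson_kernel z \<zeta>)" using T by (simp add: sum.delta)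
      finally show "(\<Sum>a\<in>T. ennreal (poisson_kernel a \<zeta>) * indicator {a} z) \<le> ennreal (poisson_kernel z \<zeta>)" .
    qed
    also have "\<dots> \<le> B"
      unfolding B_def balayage_def[symmetric] using \<zeta> by (intro SUP_upper) auto
    finally have "enn2real (ennreal (\<Sum>a\<in>T. (1 - norm a) * poisson_kernel a \<zeta>)) \<le> enn2real B"
      using B by (intro enn2real_mono) auto
    then show "(\<Sum>a\<in>T. (1 - norm a) * poisson_kernel a \<zeta>) \<le> enn2real B"
      using sum_nonneg[of T "\<lambda>a. (1 - norm a) * poisson_kernel a \<zeta>"] pos by simp
  qed simp
qed

text \<open>The shift from a to a / r has length at most (1 - |a|) / 2, hence at most half of |x -
  a|. The distance to x shrinks by at most a factor 2, which the square turns into 4, and the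
  numerator of the kernel does not grow.\<close>

lemma poisson_kernel_dilate_le:
  assumes a: "norm a < 1" and r: "0 < r" "r < 1" "1 / r - 1 \<le> (1 - norm a) / 2" and x: "norm x = 1"
  shows "norm (a / of_real r) < 1" "poisson_kernel (a / of_real r) x \<le> 4 * poisson_kernel a x"
proof -
  have eq: "norm a / r = norm a + norm a * (1 / r - 1)" by (simp add: algebra_simps)
  have le: "norm a * (1 / r - 1) \<le> (1 - norm a) / 2"
  proof -
    have "norm a * (1 / r - 1) \<le> 1 * (1 / r - 1)" using a r by (intro mult_right_mono) (auto simp: field_simps)
    also have "\<dots> \<le> (1 - norm a) / 2" using r(3) by simp
    finally show ?thesis .
  qed
  show n: "norm (a / of_real r) < 1"
    using eq le a r by (simp add: norm_divide)
  have d: "norm (x - a) \<ge> 1 - norm a" using norm_triangle_ineq2[of x a] x by simp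
  have "norm (a / of_real r - a) = norm a * (1 / r - 1)"
  proof -
    have "a / of_real r - a = a * of_real (1 / r - 1)" by (simp add: algebra_simps)
    then have "norm (a / of_real r - a) = norm a * \<bar>1 / r - 1\<bar>" by (metis norm_mult norm_of_real real_norm_def)
    moreover have "0 \<le> 1 / r - 1" using r by (simp add: field_simps)
    ultimately show ?thesis by simp
  qed
  note na = this
  have "norm (x - a / of_real r) \<ge> norm (x - a) - (1 - norm a) / 2"
  proof -
    have "norm (x - a) \<le> norm (x - a / of_real r) + norm (a / of_real r - a)"
      using norm_triangle_ineq[of "x - a / of_real r" "a / of_real r - a"] by simp
    also have "\<dots> \<le> norm (x - a / of_real r) + (1 - norm a) / 2" unfolding na using le by (rule add_left_mono)
    finally show ?thesis by (simp only: diff_le_eq)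
  qed
  then have "norm (x - a) \<le> 2 * norm (x - a / of_real r)"
  proof -
    have "u \<le> 2 * v" if "u - (1 - w) / 2 \<le> v" "1 - w \<le> u" for u v w :: real using that by argo
    from this[OF \<open>norm (x - a) - (1 - norm a) / 2 \<le> norm (x - a / of_real r)\<close> d] show ?thesis .
  qed
  then have sq: "(norm (x - a))\<^sup>2 \<le> 4 * (norm (x - a / of_real r))\<^sup>2"
    using power_mono[of "norm (x - a)" "2 * norm (x - a / of_real r)" 2] by (simp add: power_mult_distrib)
  have nz: "0 < (norm (x - a))\<^sup>2" "0 < (norm (x - a / of_real r))\<^sup>2"
    using n a x by auto
  have n1: "1 - (norm (a / of_real r))\<^sup>2 \<le> 1 - (norm a)\<^sup>2"
  proof -
    have "norm a \<le> norm (a / of_real r)" using r by (simp add: norm_divide pos_le_divide_eq mult_left_le)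
    then show ?thesis by (simp add: power_mono)
  qed
  have p: "0 \<le> 1 - (norm a)\<^sup>2" using a by (simp add: abs_square_le_1)
  have "poisson_kernel (a / of_real r) x \<le> (1 - (norm a)\<^sup>2) / (norm (x - a / of_real r))\<^sup>2"
    unfolding poisson_kernel_def using n1 nz by (intro divide_right_mono) auto
  also have "\<dots> \<le> (1 - (norm a)\<^sup>2) / ((norm (x - a))\<^sup>2 / 4)"
    using sq nz p by (intro divide_left_mono) auto
  also have "\<dots> = 4 * poisson_kernel a x" by (simp add: poisson_kernel_def)
  finally show "poisson_kernel (a / of_real r) x \<le> 4 * poisson_kernel a x" .
qed

text \<open>As |f(b)| = 1 on \<open>T\<close>, Poisson-Jensen at b bounds the sum over zeros by the
  Poisson integral of log^+ |f|. Summing with weights 1 - |b| under the integral puts the finite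
  balayage sum in front, and the mean of log^+ |f| remains.\<close>

lemma nevanlinna_cut_bound:
  assumes f: "f holomorphic_on ball 0 1" "0 \<le> C"
    and C: "\<And>r. 0 < r \<Longrightarrow> r < 1 \<Longrightarrow> poisson_integral (\<lambda>x. log_plus (norm (dilate f r x))) 0 \<le> C"
    and S: "finite S" "S \<subseteq> ball 0 1" "\<And>a. a \<in> S \<Longrightarrow> f a = 0"
    and T: "finite T" "T \<subseteq> ball 0 1" "\<And>a. a \<in> T \<Longrightarrow> norm (f a) = 1"
    and K: "0 \<le> K" "\<And>\<zeta>. norm \<zeta> = 1 \<Longrightarrow> (\<Sum>a\<in>T. (1 - norm a) * poisson_kernel a \<zeta>) \<le> K"
  shows "(\<Sum>b\<in>T. (1 - norm b) * (\<Sum>a\<in>S. ln (inverse (norm (blaschke_factor a b))))) \<le> 4 * K * C"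
proof (cases "T = {}")
  case True
  then show ?thesis using K f by simp
next
  case False
  then obtain c where c: "norm c < 1" "f c \<noteq> 0" using T by force
  \<comment> \<open>The left side for the dilate by r, whose marked points sit at a / r and b / r;
    it converges to the original sum as r tends to 1.\<close>
  define L where "L = (\<lambda>r. \<Sum>b\<in>T. (1 - norm b) *
      (\<Sum>a\<in>S. ln (inverse (norm (blaschke_factor (a / complex_of_real r) (b / complex_of_real r))))))"
  define good where "good = (\<lambda>r. 0 < r \<and> r < 1 \<and> (\<forall>a\<in>S\<union>T. 1 / r - 1 \<le> (1 - norm a) / 2))"
  have cf: "continuous_on (ball 0 1) f" using f by (intro holomorphic_on_imp_continuous_on)
  have key: "L r \<le> 4 * K * C" if r: "good r" and gen: "\<And>x. norm x = 1 \<Longrightarrow> dilate f r x \<noteq> 0" for r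
  proof -
    have r01: "0 < r" "r < 1" and rle: "\<And>a. a \<in> S \<union> T \<Longrightarrow> 1 / r - 1 \<le> (1 - norm a) / 2"
      using r unfolding good_def by blast+
    define h where "h = dilate f r"
    have hh: "h holomorphic_on ball 0 (1 / r)" "1 < 1 / r"
      using holomorphic_dilate[OF f(1) r01(1)] r01 by (auto simp: h_def)
    have n1: "norm (a / of_real r) < 1" if "a \<in> S \<union> T" for a
      using poisson_kernel_dilate_le(1)[OF _ r01 rle[OF that], of 1] that S T by auto
    have hr: "h (a / of_real r) = f a" for a using r01 by (simp add: h_def dilate_def)
    have inj: "inj_on (\<lambda>a. a / complex_of_real r) S" using r01 by (auto simp: inj_on_def)
    define u where "u = (\<lambda>x. log_plus (norm (h x)))"
    have cu: "continuous_on (sphere 0 1) u"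
      unfolding u_def h_def using r01 by (intro continuous_on_log_plus_dilate cf) auto
    have cl: "continuous_on (sphere 0 1) (\<lambda>x. ln (norm (h x)))"
    proof (intro continuous_intros)
      show "continuous_on (sphere 0 1) h"
        using hh by (intro holomorphic_on_imp_continuous_on holomorphic_on_subset[OF hh(1)]) auto
    qed (use gen in \<open>auto simp: h_def\<close>)
    have one: "(\<Sum>a\<in>S. ln (inverse (norm (blaschke_factor (a / of_real r) (b / of_real r)))))
        \<le> poisson_integral u (b / of_real r)" if b: "b \<in> T" for b
    proof -
      have nb: "norm (h (b / of_real r)) = 1" unfolding hr using T(3)[OF b] .
      have "ln (norm (h (b / of_real r))) + (\<Sum>a\<in>(\<lambda>a. a / of_real r) ` S. ln (inverse (norm (blaschke_factor a (b / of_real r)))))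
          \<le> poisson_integral (\<lambda>x. ln (norm (h x))) (b / of_real r)"
      proof (rule poisson_jensen[OF hh])
        show "h x \<noteq> 0" if "norm x = 1" for x using gen[OF that] by (simp add: h_def)
        show "finite ((\<lambda>a. a / complex_of_real r) ` S)" using S by simp
        show "norm a < 1 \<and> h a = 0" if "a \<in> (\<lambda>a. a / complex_of_real r) ` S" for a
          using that n1 S(3) hr by force
        show "norm (b / of_real r) < 1" using n1 b by blast
        show "h (b / of_real r) \<noteq> 0" using nb by force
      qed
      also have "(\<Sum>a\<in>(\<lambda>a. a / of_real r) ` S. ln (inverse (norm (blaschke_factor a (b / of_real r)))))
          = (\<Sum>a\<in>S. ln (inverse (norm (blaschke_factor (a / of_real r) (b / of_real r)))))"
        using inj by (simp add: sum.reindex)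
      also have "poisson_integral (\<lambda>x. ln (norm (h x))) (b / of_real r) \<le> poisson_integral u (b / of_real r)"
        unfolding u_def by (rule poisson_integral_mono[OF cl cu[unfolded u_def] _ ln_le_log_plus]) (use n1 b in blast)
      finally show ?thesis using nb by simp
    qed
    have int: "(\<lambda>t. (1 - norm b) * (poisson_kernel (b / of_real r) (cis t) * u (cis t))) integrable_on {0..2*pi}"
      if "b \<in> T" for b
      using poisson_integrable[OF cu, of "b / of_real r"] n1 that by (intro integrable_on_mult_right) auto
    have "L r \<le> (\<Sum>b\<in>T. (1 - norm b) * poisson_integral u (b / of_real r))"
      unfolding L_def using one T by (intro sum_mono mult_left_mono) (auto simp: subset_iff less_imp_le)
    also have "\<dots> = (\<Sum>b\<in>T. integral {0..2*pi} (\<lambda>t. (1 - norm b) * (poisson_kernel (b / of_real r) (cis t) * u (cis t)))) / (2*pi)"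
      by (simp add: poisson_integral_def sum_divide_distrib)
    also have "\<dots> = integral {0..2*pi} (\<lambda>t. \<Sum>b\<in>T. (1 - norm b) * (poisson_kernel (b / of_real r) (cis t) * u (cis t))) / (2*pi)"
      using T int by (simp only: Henstock_Kurzweil_Integration.integral_sum)
    also have "\<dots> \<le> integral {0..2*pi} (\<lambda>t. 4 * K * u (cis t)) / (2*pi)"
    proof (intro divide_right_mono integral_le)
      show "(\<lambda>t. \<Sum>b\<in>T. (1 - norm b) * (poisson_kernel (b / of_real r) (cis t) * u (cis t))) integrable_on {0..2*pi}"
        using T int by (intro Henstock_Kurzweil_Integration.integrable_sum) auto
      show "(\<lambda>t. 4 * K * u (cis t)) integrable_on {0..2*pi}"
        by (intro integrable_continuous_interval continuous_intros continuous_on_cis_compose cu)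
      fix t
      have "(\<Sum>b\<in>T. (1 - norm b) * (poisson_kernel (b / of_real r) (cis t) * u (cis t)))
          = (\<Sum>b\<in>T. (1 - norm b) * poisson_kernel (b / of_real r) (cis t)) * u (cis t)"
        by (simp add: sum_distrib_right mult.assoc)
      also have "\<dots> \<le> (\<Sum>b\<in>T. (1 - norm b) * (4 * poisson_kernel b (cis t))) * u (cis t)"
      proof (intro mult_right_mono sum_mono mult_left_mono)
        fix b assume b: "b \<in> T"
        then have nb: "norm b < 1" using T by auto
        show "poisson_kernel (b / of_real r) (cis t) \<le> 4 * poisson_kernel b (cis t)"
          by (rule poisson_kernel_dilate_le(2)[OF nb r01 rle]) (use b in auto)
        show "0 \<le> 1 - norm b" using nb by simp
      qed (simp add: u_def)
      also have "(\<Sum>b\<in>T. (1 - norm b) * (4 * poisson_kernel b (cis t))) = 4 * (\<Sum>b\<in>T. (1 - norm b) * poisson_kernel b (cis t))"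
        by (simp add: sum_distrib_left mult_ac)
      also have "4 * (\<Sum>b\<in>T. (1 - norm b) * poisson_kernel b (cis t)) * u (cis t) \<le> 4 * K * u (cis t)"
        using K(2)[of "cis t"] by (intro mult_right_mono) (auto simp: u_def)
      finally show "(\<Sum>b\<in>T. (1 - norm b) * (poisson_kernel (b / of_real r) (cis t) * u (cis t))) \<le> 4 * K * u (cis t)" .
    qed auto
    also have "\<dots> = 4 * K * poisson_integral u 0" by (simp add: poisson_integral_0)
    also have "\<dots> \<le> 4 * K * C"
      using C[OF r01] K(1) unfolding u_def h_def by (intro mult_left_mono) auto
    finally show ?thesis .
  qed
  have ne: "blaschke_factor a b \<noteq> 0" "1 - cnj a * b \<noteq> 0" if "a \<in> S" "b \<in> T" for a b
  proof -
    have ab: "norm a < 1" "norm b < 1" "b \<noteq> a" using that S T by force+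
    show "blaschke_factor a b \<noteq> 0" using blaschke_factor_eq_0_iff[of a b] ab by simp
    show "1 - cnj a * b \<noteq> 0" using one_minus_cnj_mult_nonzero[of a b] ab by simp
  qed
  have lim: "(L \<longlongrightarrow> (\<Sum>b\<in>T. (1 - norm b) * (\<Sum>a\<in>S. ln (inverse (norm (blaschke_factor a b)))))) (at_left 1)"
    unfolding L_def
  proof (intro tendsto_sum tendsto_mult_left tendsto_ln)
    fix a b assume ab: "b \<in> T" "a \<in> S"
    have r: "((\<lambda>r. complex_of_real r) \<longlongrightarrow> of_real 1) (at_left 1)"
      by (intro tendsto_of_real tendsto_ident_at)
    have "((\<lambda>r. norm (a / of_real r - b / of_real r) / norm (1 - cnj (a / of_real r) * (b / of_real r)))
        \<longlongrightarrow> norm (a / of_real 1 - b / of_real 1) / norm (1 - cnj (a / of_real 1) * (b / of_real 1))) (at_left 1)"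
      using ne[OF ab(2,1)] by (intro tendsto_intros r) auto
    then have t: "((\<lambda>r. norm (blaschke_factor (a / complex_of_real r) (b / complex_of_real r)))
        \<longlongrightarrow> norm (blaschke_factor a b)) (at_left 1)"
      by (simp add: norm_blaschke_factor)
    show "((\<lambda>r. inverse (norm (blaschke_factor (a / complex_of_real r) (b / complex_of_real r))))
        \<longlongrightarrow> inverse (norm (blaschke_factor a b))) (at_left 1)"
      using ne[OF ab(2,1)] by (intro tendsto_inverse t) auto
    show "inverse (norm (blaschke_factor a b)) \<noteq> 0" using ne[OF ab(2,1)] by auto
  qed
  have ev_good: "eventually good (at_left 1)"
  proof -
    have "eventually (\<lambda>r. 1 / r - 1 < (1 - norm a) / 2) (at_left (1::real))" if "a \<in> S \<union> T" for a
    proof (rule order_tendstoD(2))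
      show "((\<lambda>r::real. 1 / r - 1) \<longlongrightarrow> 1 / 1 - 1) (at_left 1)" by (intro tendsto_intros) auto
      show "1 / 1 - 1 < (1 - norm a) / 2" using that S T by auto
    qed
    then have "eventually (\<lambda>r. \<forall>a\<in>S\<union>T. 1 / r - 1 < (1 - norm a) / 2) (at_left (1::real))"
      using S T by (intro eventually_ball_finite) auto
    moreover have "eventually (\<lambda>r. 0 < r \<and> r < 1) (at_left (1::real))"
      unfolding eventually_at_left_field by (intro exI[of _ 0]) auto
    ultimately show ?thesis unfolding good_def by eventually_elim (auto simp: less_imp_le)
  qed
  show ?thesis
  \<comment> \<open>The estimate is available at zero-free radii. A strict excess in the limit would
    persist for every r near 1, and a zero-free radius lies among these.\<close>
  proof (rule ccontr)
    assume "\<not> ?thesis"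
    then have "eventually (\<lambda>r. 4 * K * C < L r) (at_left 1)"
      by (intro order_tendstoD(1)[OF lim]) simp
    with ev_good have "eventually (\<lambda>r. good r \<and> 4 * K * C < L r) (at_left 1)" by eventually_elim simp
    then obtain r0 where r0: "r0 < 1" "\<And>r. r0 < r \<Longrightarrow> r < 1 \<Longrightarrow> good r \<and> 4 * K * C < L r"
      unfolding eventually_at_left_field by blast
    obtain \<rho> where \<rho>: "r0 < \<rho>" "\<rho> < 1" "0 < \<rho>" "\<And>x. norm x = 1 \<Longrightarrow> dilate f \<rho> x \<noteq> 0"
      using generic_radius[OF f(1) c r0(1)] by metis
    from r0(2)[OF \<rho>(1,2)] key[of \<rho>] \<rho>(4) show False by fastforce
  qed
qed

text \<open>Points are added one at a time, each on the side where more of its weight to the earlier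
  points is cut, so at least half of every increment is cut.\<close>

lemma finite_max_cut:
  fixes w :: "'a \<Rightarrow> 'a \<Rightarrow> real"
  assumes "finite R" "\<And>x. w x x = 0"
  shows "\<exists>S\<subseteq>R. (\<Sum>x\<in>R. \<Sum>y\<in>R. w x y) \<le> 2 * ((\<Sum>x\<in>R-S. \<Sum>y\<in>S. w x y) + (\<Sum>x\<in>S. \<Sum>y\<in>R-S. w x y))"
  using assms(1)
proof (induction R)
  case (insert z R)
  then obtain S where S: "S \<subseteq> R"
    "(\<Sum>x\<in>R. \<Sum>y\<in>R. w x y) \<le> 2 * ((\<Sum>x\<in>R-S. \<Sum>y\<in>S. w x y) + (\<Sum>x\<in>S. \<Sum>y\<in>R-S. w x y))" by blast
  define v where "v = (\<lambda>y. w z y + w y z)"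
  have fin: "finite S" "finite (R - S)" using S insert finite_subset by auto
  have z: "z \<notin> S" "z \<notin> R - S" "z \<notin> R" using S insert by auto
  have tot: "(\<Sum>x\<in>insert z R. \<Sum>y\<in>insert z R. w x y) = (\<Sum>x\<in>R. \<Sum>y\<in>R. w x y) + (\<Sum>y\<in>R. v y)"
    using insert assms(2) by (simp add: v_def sum.distrib)
  have split: "(\<Sum>y\<in>R. v y) = (\<Sum>y\<in>R-S. v y) + (\<Sum>y\<in>S. v y)"
    by (rule sum.subset_diff) (use S insert in auto)
  show ?case
  proof (cases "(\<Sum>y\<in>R-S. v y) \<le> (\<Sum>y\<in>S. v y)")
    case True
    have "insert z R - S = insert z (R - S)" using z by auto
    then have "(\<Sum>x\<in>insert z R - S. \<Sum>y\<in>S. w x y) + (\<Sum>x\<in>S. \<Sum>y\<in>insert z R-S. w x y)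
      = ((\<Sum>x\<in>R-S. \<Sum>y\<in>S. w x y) + (\<Sum>x\<in>S. \<Sum>y\<in>R-S. w x y)) + (\<Sum>y\<in>S. v y)"
      using z fin by (simp add: v_def sum.distrib)
    then show ?thesis using tot split True S by (intro exI[of _ S]) auto
  next
    case False
    have "insert z R - insert z S = R - S" using z by auto
    then have "(\<Sum>x\<in>insert z R - insert z S. \<Sum>y\<in>insert z S. w x y) + (\<Sum>x\<in>insert z S. \<Sum>y\<in>insert z R-insert z S. w x y)
      = ((\<Sum>x\<in>R-S. \<Sum>y\<in>S. w x y) + (\<Sum>x\<in>S. \<Sum>y\<in>R-S. w x y)) + (\<Sum>y\<in>R-S. v y)"
      using z fin by (simp add: v_def sum.distrib)
    then show ?thesis using tot split False S by (intro exI[of _ "insert z S"]) auto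
  qed
qed auto

text \<open>Keeping the heavier of the two directions costs another factor 2.\<close>

lemma finite_directed_cut:
  fixes w :: "'a \<Rightarrow> 'a \<Rightarrow> real"
  assumes "finite R" "\<And>x. w x x = 0"
  obtains S T where "S \<subseteq> R" "T \<subseteq> R" "S \<inter> T = {}" "(\<Sum>x\<in>R. \<Sum>y\<in>R. w x y) \<le> 4 * (\<Sum>x\<in>T. \<Sum>y\<in>S. w x y)"
proof -
  obtain S where S: "S \<subseteq> R"
    "(\<Sum>x\<in>R. \<Sum>y\<in>R. w x y) \<le> 2 * ((\<Sum>x\<in>R-S. \<Sum>y\<in>S. w x y) + (\<Sum>x\<in>S. \<Sum>y\<in>R-S. w x y))"
    using finite_max_cut[of R w] assms by blast
  show ?thesis
  proof (cases "(\<Sum>x\<in>S. \<Sum>y\<in>R-S. w x y) \<le> (\<Sum>x\<in>R-S. \<Sum>y\<in>S. w x y)")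
    case True
    show ?thesis by (rule that[of S "R - S"]) (use S True in auto)
  next
    case False
    show ?thesis by (rule that[of "R - S" S]) (use S False in auto)
  qed
qed

text \<open>Disjoint finite blocks, each containing a directed cut of weight at least one, are chosen
  greedily: since rows and columns have finite sums, deleting finitely many points leaves an
  infinite total weight.\<close>

lemma infinite_cut:
  fixes w :: "'a \<Rightarrow> 'a \<Rightarrow> real"
  assumes pos: "\<And>x y. x \<in> V \<Longrightarrow> y \<in> V \<Longrightarrow> 0 \<le> w x y" and diag: "\<And>x. w x x = 0"
    and row: "\<And>x. x \<in> V \<Longrightarrow> \<exists>C. \<forall>F. finite F \<longrightarrow> F \<subseteq> V \<longrightarrow> (\<Sum>y\<in>F. w x y) \<le> C"
    and col: "\<And>y. y \<in> V \<Longrightarrow> \<exists>C. \<forall>F. finite F \<longrightarrow> F \<subseteq> V \<longrightarrow> (\<Sum>x\<in>F. w x y) \<le> C"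
    and inf: "\<And>C. \<exists>F. finite F \<and> F \<subseteq> V \<and> C < (\<Sum>x\<in>F. \<Sum>y\<in>F. w x y)"
  obtains A where "A \<subseteq> V"
    "\<And>n::nat. \<exists>S T. finite S \<and> finite T \<and> S \<subseteq> A \<and> T \<subseteq> V - A \<and> real n \<le> (\<Sum>x\<in>T. \<Sum>y\<in>S. w x y)"
proof -
  from row obtain Cr where Cr: "\<And>x F. x \<in> V \<Longrightarrow> finite F \<Longrightarrow> F \<subseteq> V \<Longrightarrow> (\<Sum>y\<in>F. w x y) \<le> Cr x" by metis
  from col obtain Cc where Cc: "\<And>y F. y \<in> V \<Longrightarrow> finite F \<Longrightarrow> F \<subseteq> V \<Longrightarrow> (\<Sum>x\<in>F. w x y) \<le> Cc y" by metis
  have step: "\<exists>S T. finite S \<and> finite T \<and> S \<subseteq> V - E \<and> T \<subseteq> V - E \<and> S \<inter> T = {} \<and> 1 \<le> (\<Sum>x\<in>T. \<Sum>y\<in>S. w x y)"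
    if E: "finite E" "E \<subseteq> V" for E
  proof -
    \<comment> \<open>Rows and columns indexed by \<open>E\<close> carry at most the two sums of
      bounds, so weight 4 survives off \<open>E\<close>, and the directed cut keeps a quarter of
      it.\<close>
    obtain F where F: "finite F" "F \<subseteq> V" "4 + (\<Sum>x\<in>E. Cr x) + (\<Sum>y\<in>E. Cc y) < (\<Sum>x\<in>F. \<Sum>y\<in>F. w x y)"
      using inf by blast
    define G where "G = F \<union> E"
    have G: "finite G" "G \<subseteq> V" "F \<subseteq> G" "E \<subseteq> G" using F E by (auto simp: G_def)
    have posG: "0 \<le> w x y" if "x \<in> G" "y \<in> G" for x y using pos that G by blast
    have "(\<Sum>x\<in>F. \<Sum>y\<in>F. w x y) \<le> (\<Sum>x\<in>F. \<Sum>y\<in>G. w x y)"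
      using G posG by (intro sum_mono sum_mono2) auto
    also have "\<dots> \<le> (\<Sum>x\<in>G. \<Sum>y\<in>G. w x y)"
      using G posG by (intro sum_mono2) (auto intro!: sum_nonneg)
    also have "\<dots> = (\<Sum>x\<in>G-E. \<Sum>y\<in>G. w x y) + (\<Sum>x\<in>E. \<Sum>y\<in>G. w x y)"
      by (rule sum.subset_diff) (use G in auto)
    also have "(\<Sum>x\<in>G-E. \<Sum>y\<in>G. w x y) = (\<Sum>x\<in>G-E. (\<Sum>y\<in>G-E. w x y) + (\<Sum>y\<in>E. w x y))"
      by (intro sum.cong refl sum.subset_diff) (use G in auto)
    also have "\<dots> = (\<Sum>x\<in>G-E. \<Sum>y\<in>G-E. w x y) + (\<Sum>y\<in>E. \<Sum>x\<in>G-E. w x y)"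
      unfolding sum.distrib by (subst (2) sum.swap) (rule refl)
    also have "(\<Sum>y\<in>E. \<Sum>x\<in>G-E. w x y) \<le> (\<Sum>y\<in>E. Cc y)"
      using G E by (intro sum_mono Cc) auto
    also have "(\<Sum>x\<in>E. \<Sum>y\<in>G. w x y) \<le> (\<Sum>x\<in>E. Cr x)"
      using G E by (intro sum_mono Cr) auto
    finally have ge: "4 \<le> (\<Sum>x\<in>G-E. \<Sum>y\<in>G-E. w x y)" using F(3) by linarith
    have "finite (G - E)" using G by simp
    then obtain S T where ST: "S \<subseteq> G - E" "T \<subseteq> G - E" "S \<inter> T = {}"
       "(\<Sum>x\<in>G-E. \<Sum>y\<in>G-E. w x y) \<le> 4 * (\<Sum>x\<in>T. \<Sum>y\<in>S. w x y)"
      using finite_directed_cut[of "G - E" w] diag by metis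
    have "finite S" by (rule finite_subset[OF ST(1)]) (use G in simp)
    moreover have "finite T" by (rule finite_subset[OF ST(2)]) (use G in simp)
    moreover have "S \<subseteq> V - E" "T \<subseteq> V - E" using ST(1,2) G(2) by blast+
    moreover have "1 \<le> (\<Sum>x\<in>T. \<Sum>y\<in>S. w x y)" using ge ST(4) by linarith
    ultimately show ?thesis using ST(3) by blast
  qed
  define P where "P = (\<lambda>E ST. finite (fst ST) \<and> finite (snd ST) \<and> fst ST \<subseteq> V - E \<and> snd ST \<subseteq> V - E
     \<and> fst ST \<inter> snd ST = {} \<and> 1 \<le> (\<Sum>x\<in>snd ST. \<Sum>y\<in>fst ST. w x y))"
  define nxt where "nxt = (\<lambda>E. SOME ST. P E ST)"
  have nxt: "P E (nxt E)" if "finite E" "E \<subseteq> V" for E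
  proof -
    have "\<exists>ST. P E ST" using step[OF that] unfolding P_def by auto
    then show ?thesis unfolding nxt_def by (rule someI_ex)
  qed
  \<comment> \<open>\<open>E n\<close> collects the points used by the first n blocks; the next
    block is chosen away from it.\<close>
  define E where "E = rec_nat {} (\<lambda>_ E. E \<union> fst (nxt E) \<union> snd (nxt E))"
  have ES: "E 0 = {}" "E (Suc n) = E n \<union> fst (nxt (E n)) \<union> snd (nxt (E n))" for n
    by (simp_all add: E_def)
  have Efin: "finite (E n) \<and> E n \<subseteq> V" for n
  proof (induction n)
    case (Suc n)
    then show ?case using nxt[of "E n"] unfolding ES P_def by auto
  qed (simp add: ES)
  define S T where "S = (\<lambda>n. fst (nxt (E n)))" and "T = (\<lambda>n. snd (nxt (E n)))"
  have ST: "finite (S n)" "finite (T n)" "S n \<subseteq> V - E n" "T n \<subseteq> V - E n" "S n \<inter> T n = {}"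
    "1 \<le> (\<Sum>x\<in>T n. \<Sum>y\<in>S n. w x y)" for n
    using nxt[of "E n"] Efin[of n] unfolding P_def S_def T_def by auto
  have Emono: "E m \<subseteq> E n" if "m \<le> n" for m n
    using that by (rule lift_Suc_mono_le[of E, rotated]) (auto simp: ES)
  have inE: "S m \<subseteq> E n" "T m \<subseteq> E n" if "m < n" for m n
    using Emono[of "Suc m" n] that by (auto simp: ES S_def T_def)
  have disj: "S m \<inter> T n = {}" for m n
  proof (cases m n rule: linorder_cases)
    case less then show ?thesis using inE(1)[of m n] ST(4)[of n] by blast
  next
    case equal then show ?thesis using ST(5) by simp
  next
    case greater then show ?thesis using inE(2)[of n m] ST(3)[of m] by blast
  qed
  have disjT: "T m \<inter> T n = {}" if "m \<noteq> n" for m n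
  proof (cases m n rule: linorder_cases)
    case less then show ?thesis using inE(2)[of m n] ST(4)[of n] by blast
  next
    case greater then show ?thesis using inE(2)[of n m] ST(4)[of m] by blast
  qed (use that in simp)
  show ?thesis
  proof (rule that[of "\<Union>n. S n"])
    show "(\<Union>n. S n) \<subseteq> V" using ST(3) by blast
    fix n :: nat
    define S' T' where "S' = (\<Union>i<n. S i)" and "T' = (\<Union>i<n. T i)"
    have fin: "finite S'" "finite T'" using ST by (auto simp: S'_def T'_def)
    have VS: "S i \<subseteq> V" "T i \<subseteq> V" for i using ST(3,4) by blast+
    have "real n = (\<Sum>i<n. 1)" by simp
    also have "\<dots> \<le> (\<Sum>i<n. \<Sum>x\<in>T i. \<Sum>y\<in>S i. w x y)" by (intro sum_mono ST)
    \<comment> \<open>Enlarging each \<open>S i\<close> to \<open>S'\<close> adds nonnegative terms;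
      the disjoint \<open>T i\<close> can then be merged, and n blocks give weight n.\<close>
    also have "\<dots> \<le> (\<Sum>i<n. \<Sum>x\<in>T i. \<Sum>y\<in>S'. w x y)"
    proof (intro sum_mono sum_mono2 fin)
      fix i assume i: "i \<in> {..<n}"
      show "S i \<subseteq> S'" using i by (auto simp: S'_def)
      fix x y assume "x \<in> T i" "y \<in> S' - S i"
      then have "x \<in> V" "y \<in> V" using VS by (auto simp: S'_def)
      then show "0 \<le> w x y" by (rule pos)
    qed
    also have "\<dots> = (\<Sum>x\<in>T'. \<Sum>y\<in>S'. w x y)"
      unfolding T'_def using ST(2) disjT by (intro sum.UNION_disjoint[symmetric]) auto
    finally have "real n \<le> (\<Sum>x\<in>T'. \<Sum>y\<in>S'. w x y)" .
    moreover have "S' \<subseteq> (\<Union>n. S n)" by (auto simp: S'_def)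
    moreover have "T' \<subseteq> V - (\<Union>n. S n)" using VS disj unfolding T'_def by blast
    ultimately show "\<exists>S'' T''. finite S'' \<and> finite T'' \<and> S'' \<subseteq> (\<Union>n. S n) \<and> T'' \<subseteq> V - (\<Union>n. S n)
        \<and> real n \<le> (\<Sum>x\<in>T''. \<Sum>y\<in>S''. w x y)"
      using fin by blast
  qed
qed

section \<open>Necessity of the summability condition\<close>

text \<open>The normalisation |a| / a pulls the factors towards 1: over the common denominator a (1
  - cnj a z) the difference has numerator (1 - |a|) (a + |a| z). The rate 1 - |a| is the one that
  the Blaschke condition sums.\<close>

lemma norm_one_minus_blaschke_factor_le:
  assumes "norm a < 1" "norm z < 1"
  shows "norm (1 - blaschke_factor a z) \<le> 2 / (1 - norm z) * (1 - norm a)"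
proof (cases "a = 0")
  case True
  have "norm (1 - z) \<le> 1 + norm z" using norm_triangle_ineq4[of 1 z] by simp
  also have "\<dots> \<le> 2 / (1 - norm z)" using assms by (simp add: pos_le_divide_eq algebra_simps)
  finally show ?thesis using True by (simp add: blaschke_factor_def)
next
  case False
  have nz: "1 - cnj a * z \<noteq> 0" using one_minus_cnj_mult_nonzero[of a z] assms by simp
  have sq: "a * cnj a = of_real (norm a) * of_real (norm a)"
    by (simp only: complex_norm_square[symmetric] power2_eq_square of_real_mult)
  have "1 - blaschke_factor a z = of_real (1 - norm a) * (a + of_real (norm a) * z) / (a * (1 - cnj a * z))"
  proof -
    have "1 - blaschke_factor a z = (a * (1 - cnj a * z) - of_real (norm a) * (a - z)) / (a * (1 - cnj a * z))"
    proof -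
      have "blaschke_factor a z = of_real (norm a) * (a - z) / (a * (1 - cnj a * z))"
        using False by (simp add: blaschke_factor_def)
      then show ?thesis using False nz by (simp only: diff_divide_distrib) (simp add: nz)
    qed
    also have "a * (1 - cnj a * z) - of_real (norm a) * (a - z) = a - (a * cnj a) * z - of_real (norm a) * (a - z)"
      by (simp add: algebra_simps)
    also have "\<dots> = of_real (1 - norm a) * (a + of_real (norm a) * z)"
      unfolding sq of_real_diff of_real_1 by algebra
    finally show ?thesis .
  qed
  have "norm (1 - blaschke_factor a z) = (1 - norm a) * norm (a + of_real (norm a) * z) / (norm a * norm (1 - cnj a * z))"
  proof -
    have "norm (complex_of_real (1 - norm a)) = 1 - norm a" using assms by (simp only: norm_of_real)
    then show ?thesis using \<open>1 - blaschke_factor a z = _\<close> by (simp only: norm_mult norm_divide)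
  qed
  also have "\<dots> \<le> (1 - norm a) * (2 * norm a) / (norm a * (1 - norm z))"
  proof (intro frac_le mult_left_mono mult_nonneg_nonneg mult_pos_pos)
    have "norm (a + of_real (norm a) * z) \<le> norm a + norm a * norm z"
      using norm_triangle_ineq[of a "of_real (norm a) * z"] by (simp add: norm_mult)
    also have "norm a * norm z \<le> norm a" using assms by (intro mult_left_le) auto
    finally show "norm (a + of_real (norm a) * z) \<le> 2 * norm a" by simp
    have "norm (cnj a * z) \<le> norm z" using assms by (simp add: norm_mult mult_left_le_one_le)
    then show "1 - norm z \<le> norm (1 - cnj a * z)" using norm_triangle_ineq2[of 1 "cnj a * z"] by simp
  qed (use assms False in auto)
  also have "\<dots> = 2 / (1 - norm z) * (1 - norm a)" using False by simp
  finally show ?thesis .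
qed

lemma finite_ge_of_summable:
  fixes f :: "'a \<Rightarrow> real"
  assumes "f summable_on A" "\<And>x. x \<in> A \<Longrightarrow> 0 \<le> f x" "0 < e"
  shows "finite {x\<in>A. e \<le> f x}"
proof -
  define C where "C = nat \<lceil>infsum f A / e\<rceil>"
  have "card G \<le> C" if G: "G \<subseteq> {x\<in>A. e \<le> f x}" "finite G" for G
  proof -
    have "real (card G) * e = (\<Sum>x\<in>G. e)" by simp
    also have "\<dots> \<le> sum f G" using G by (intro sum_mono) auto
    also have "\<dots> \<le> infsum f A"
      using assms G by (intro finite_sum_le_infsum) auto
    finally have "real (card G) \<le> infsum f A / e" using assms by (simp add: field_simps)
    then show ?thesis unfolding C_def by linarith
  qed
  then show ?thesis using finite_if_finite_subsets_card_bdd by blast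
qed

text \<open>All but finitely many factors lie within 1/2 of 1, where |Ln w| \<le> 2 |w - 1|, so the
  principal logarithms sum absolutely. Exponentiating finite sums recovers the finite products
  whatever the branches, and real parts give the series of log moduli.\<close>

lemma blaschke_product_has_sum:
  assumes L: "\<Lambda> \<subseteq> ball 0 1" "blaschke_condition \<Lambda>" and z: "norm z < 1" "z \<notin> \<Lambda>"
  shows "((\<lambda>a. ln (inverse (norm (blaschke_factor a z)))) has_sum
            ln (inverse (norm (blaschke_product \<Lambda> z)))) \<Lambda>"
    and "blaschke_product \<Lambda> z \<noteq> 0"
proof -
  let ?b = "\<lambda>a. blaschke_factor a z"
  have nz: "?b a \<noteq> 0" if "a \<in> \<Lambda>" for a
    using that L z blaschke_factor_eq_0_iff[of a z] by auto
  define K where "K = 2 / (1 - norm z)"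
  have K: "K > 0" using z by (simp add: K_def)
  \<comment> \<open>The finite exceptional set: off it K (1 - |a|) < 1 / 2.\<close>
  define F where "F = {a\<in>\<Lambda>. 1 / (2 * K) \<le> 1 - norm a}"
  have sm: "(\<lambda>a. 1 - norm a) summable_on \<Lambda>" using L(2) by (simp add: blaschke_condition_def)
  have finF: "finite F"
    unfolding F_def using L K by (intro finite_ge_of_summable sm) (auto simp: subset_iff less_imp_le)
  have "(\<lambda>a. norm (Ln (?b a))) summable_on (\<Lambda> - F)"
  proof (rule summable_on_comparison_test)
    show "(\<lambda>a. 2 * K * (1 - norm a)) summable_on (\<Lambda> - F)"
      by (intro summable_on_cmult_right summable_on_subset_banach[OF sm]) auto
    fix a assume a: "a \<in> \<Lambda> - F"
    then have "norm a < 1" "1 - norm a < 1 / (2 * K)" using L by (auto simp: F_def)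
    then have le: "norm (1 - ?b a) \<le> K * (1 - norm a)" and "K * (1 - norm a) < 1 / 2"
      using norm_one_minus_blaschke_factor_le[OF \<open>norm a < 1\<close> z(1)] K
      by (simp only: K_def, simp add: field_simps)
    then have "norm (?b a - 1) < 1 / 2" by (simp add: norm_minus_commute)
    then have "norm (Ln (1 + (?b a - 1))) \<le> 2 * norm (?b a - 1)" by (intro norm_Ln_le) auto
    also have "\<dots> \<le> 2 * (K * (1 - norm a))" using le by (simp add: norm_minus_commute)
    finally show "norm (Ln (?b a)) \<le> 2 * K * (1 - norm a)" by (simp add: mult.assoc)
  qed simp
  moreover have "(\<lambda>a. norm (Ln (?b a))) summable_on F" using finF by simp
  ultimately have "(\<lambda>a. norm (Ln (?b a))) summable_on ((\<Lambda> - F) \<union> F)"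
    by (rule summable_on_Un_disjoint) auto
  moreover have "(\<Lambda> - F) \<union> F = \<Lambda>" by (auto simp: F_def)
  ultimately have "(\<lambda>a. norm (Ln (?b a))) summable_on \<Lambda>" by (simp only:)
  then have "(\<lambda>a. Ln (?b a)) summable_on \<Lambda>" by (rule abs_summable_summable)
  then obtain s where s: "((\<lambda>a. Ln (?b a)) has_sum s) \<Lambda>" by (auto simp: summable_on_def)
  have "((\<lambda>F. exp (\<Sum>a\<in>F. Ln (?b a))) \<longlongrightarrow> exp s) (finite_subsets_at_top \<Lambda>)"
    using s unfolding has_sum_def by (rule tendsto_exp)
  moreover have "eventually (\<lambda>F. exp (\<Sum>a\<in>F. Ln (?b a)) = (\<Prod>a\<in>F. ?b a)) (finite_subsets_at_top \<Lambda>)"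
  proof (rule eventually_finite_subsets_at_top_weakI)
    fix X assume X: "finite X" "X \<subseteq> \<Lambda>"
    then show "exp (\<Sum>a\<in>X. Ln (?b a)) = (\<Prod>a\<in>X. ?b a)"
      unfolding exp_sum[OF X(1)] using nz by (intro prod.cong refl exp_Ln) auto
  qed
  ultimately have "((\<lambda>F. \<Prod>a\<in>F. ?b a) \<longlongrightarrow> exp s) (finite_subsets_at_top \<Lambda>)"
    by (rule Lim_transform_eventually)
  then have B: "blaschke_product \<Lambda> z = exp s"
    unfolding blaschke_product_def by (intro tendsto_Lim) auto
  then show "blaschke_product \<Lambda> z \<noteq> 0" by simp
  have "((\<lambda>a. - Re (Ln (?b a))) has_sum - Re s) \<Lambda>"
    unfolding has_sum_uminus using s by (simp add: has_sum_Re)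
  moreover have "- Re s = ln (inverse (norm (blaschke_product \<Lambda> z)))"
    unfolding B by (simp add: ln_inverse)
  moreover have "- Re (Ln (?b a)) = ln (inverse (norm (?b a)))" if "a \<in> \<Lambda>" for a
    using nz[OF that] by (simp add: ln_inverse)
  ultimately show "((\<lambda>a. ln (inverse (norm (?b a)))) has_sum ln (inverse (norm (blaschke_product \<Lambda> z)))) \<Lambda>"
    using has_sum_cong[of \<Lambda> "\<lambda>a. - Re (Ln (?b a))" "\<lambda>a. ln (inverse (norm (?b a)))"] by simp
qed

lemma blaschke_condition_subset: "blaschke_condition \<Lambda> \<Longrightarrow> A \<subseteq> \<Lambda> \<Longrightarrow> blaschke_condition A"
  unfolding blaschke_condition_def by (rule summable_on_subset_banach)

lemma has_sum_sum:
  fixes f :: "'b \<Rightarrow> 'a \<Rightarrow> 'c::topological_comm_monoid_add"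
  assumes "finite F" "\<And>x. x \<in> F \<Longrightarrow> (f x has_sum s x) A"
  shows "((\<lambda>y. \<Sum>x\<in>F. f x y) has_sum (\<Sum>x\<in>F. s x)) A"
  using assms by (induction F) (auto intro!: has_sum_add)

lemma blaschke_without_has_sum:
  assumes L: "\<Lambda> \<subseteq> ball 0 1" "blaschke_condition \<Lambda>" and "a \<in> \<Lambda>"
  shows "((\<lambda>b. ln (inverse (norm (blaschke_factor b a)))) has_sum
            ln (inverse (norm (blaschke_without \<Lambda> a a)))) (\<Lambda> - {a})"
    and "blaschke_without \<Lambda> a a \<noteq> 0"
proof -
  have "\<Lambda> - {a} \<subseteq> ball 0 1" "blaschke_condition (\<Lambda> - {a})" "norm a < 1" "a \<notin> \<Lambda> - {a}"
    using assms blaschke_condition_subset[OF L(2), of "\<Lambda> - {a}"] by auto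
  from blaschke_product_has_sum[OF this]
  show "((\<lambda>b. ln (inverse (norm (blaschke_factor b a)))) has_sum
            ln (inverse (norm (blaschke_without \<Lambda> a a)))) (\<Lambda> - {a})"
    "blaschke_without \<Lambda> a a \<noteq> 0"
    unfolding blaschke_without_def by auto
qed

lemma ln_inverse_blaschke_without_nonneg:
  assumes L: "\<Lambda> \<subseteq> ball 0 1" "blaschke_condition \<Lambda>" and "a \<in> \<Lambda>"
  shows "0 \<le> ln (inverse (norm (blaschke_without \<Lambda> a a)))"
proof (rule has_sum_nonneg[OF blaschke_without_has_sum(1)[OF assms]])
  fix b assume "b \<in> \<Lambda> - {a}"
  then have "norm b < 1" "norm a < 1" using assms by auto
  then show "0 \<le> ln (inverse (norm (blaschke_factor b a)))" by (rule ln_inverse_norm_blaschke_nonneg)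
qed

lemma summable_of_zero_one_interpolation:
  assumes L: "\<Lambda> \<subseteq> ball 0 1" "blaschke_condition \<Lambda>"
    and bal: "bounded_balayage (point_measure_of \<Lambda>)"
    and int: "\<And>A. A \<subseteq> \<Lambda> \<Longrightarrow> \<exists>f\<in>nevanlinna_class. (\<forall>a\<in>A. f a = 0) \<and> (\<forall>a\<in>\<Lambda> - A. f a = 1)"
  shows "(\<lambda>a. (1 - norm a) * ln (inverse (norm (blaschke_without \<Lambda> a a)))) summable_on \<Lambda>"
proof -
  have norm_less_1: "norm a < 1" if "a \<in> \<Lambda>" for a using that L by auto
  define d where "d = (\<lambda>b a. ln (inverse (norm (blaschke_factor b a))))"
  define \<phi> where "\<phi> = (\<lambda>a. ln (inverse (norm (blaschke_without \<Lambda> a a))))"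
  define w where "w = (\<lambda>x y. if x = y then 0 else (1 - norm x) * d y x)"
  have d: "0 \<le> d b a" "d b a = d a b" if "a \<in> \<Lambda>" "b \<in> \<Lambda>" for a b
    using norm_less_1[OF that(1)] norm_less_1[OF that(2)]
    by (simp_all add: d_def norm_blaschke_factor_commute[of b] ln_inverse_norm_blaschke_nonneg)
  have hs: "(d_a has_sum \<phi> a) (\<Lambda> - {a})" if "a \<in> \<Lambda>" "d_a = (\<lambda>b. d b a)" for a d_a
    using blaschke_without_has_sum(1)[OF L that(1)] that(2) by (simp add: d_def \<phi>_def)
  have wpos: "0 \<le> w x y" if "x \<in> \<Lambda>" "y \<in> \<Lambda>" for x y
    using d(1)[OF that] norm_less_1[OF that(1)] by (simp add: w_def)
  have whs: "(w x has_sum ((1 - norm x) * \<phi> x)) \<Lambda>" if x: "x \<in> \<Lambda>" for x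
  proof -
    have "((\<lambda>y. (1 - norm x) * d y x) has_sum ((1 - norm x) * \<phi> x)) (\<Lambda> - {x})"
      by (intro has_sum_cmult_right hs[OF x]) simp
    then show ?thesis
      by (rule has_sum_cong_neutral[THEN iffD1, rotated 3]) (auto simp: w_def)
  qed
  \<comment> \<open>Bounds on finite square sums of \<open>w\<close> control the weighted series:
    its terms are infinite row sums, but any finite part of finitely many rows fits into a finite
    square.\<close>
  have sum_le: "sum (\<lambda>x. (1 - norm x) * \<phi> x) F0 \<le> C"
    if C: "\<And>F. finite F \<Longrightarrow> F \<subseteq> \<Lambda> \<Longrightarrow> (\<Sum>x\<in>F. \<Sum>y\<in>F. w x y) \<le> C" and F0: "finite F0" "F0 \<subseteq> \<Lambda>" for C F0
  proof -
    have "((\<lambda>y. \<Sum>x\<in>F0. w x y) has_sum (\<Sum>x\<in>F0. (1 - norm x) * \<phi> x)) \<Lambda>"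
      using F0 whs by (intro has_sum_sum) auto
    then show ?thesis
    proof (rule has_sum_le_finite_sums)
      fix F assume F: "finite F" "F \<subseteq> \<Lambda>"
      have "(\<Sum>y\<in>F. \<Sum>x\<in>F0. w x y) = (\<Sum>x\<in>F0. \<Sum>y\<in>F. w x y)" by (rule sum.swap)
      also have "\<dots> \<le> (\<Sum>x\<in>F0. \<Sum>y\<in>F\<union>F0. w x y)"
        using F F0 by (intro sum_mono sum_mono2 wpos) auto
      also have "\<dots> \<le> (\<Sum>x\<in>F\<union>F0. \<Sum>y\<in>F\<union>F0. w x y)"
        using F F0 by (intro sum_mono2 sum_nonneg wpos) auto
      also have "\<dots> \<le> C" using F F0 by (intro C) auto
      finally show "(\<Sum>y\<in>F. \<Sum>x\<in>F0. w x y) \<le> C" .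
    qed
  qed
  show ?thesis
  proof (rule ccontr)
    assume ns: "\<not> ?thesis"
    have inf: "\<exists>F. finite F \<and> F \<subseteq> \<Lambda> \<and> C < (\<Sum>x\<in>F. \<Sum>y\<in>F. w x y)" for C
    proof (rule ccontr)
      assume n: "\<not> ?thesis"
      have C: "(\<Sum>x\<in>F. \<Sum>y\<in>F. w x y) \<le> C" if F: "finite F" "F \<subseteq> \<Lambda>" for F
      proof (rule ccontr)
        assume "\<not> ?thesis"
        then have "C < (\<Sum>x\<in>F. \<Sum>y\<in>F. w x y)" by (simp only: not_le)
        with F have "\<exists>F. finite F \<and> F \<subseteq> \<Lambda> \<and> C < (\<Sum>x\<in>F. \<Sum>y\<in>F. w x y)" by (intro exI[of _ F] conjI)
        with n show False by (rule notE)
      qed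
      have "(\<lambda>a. (1 - norm a) * \<phi> a) summable_on \<Lambda>"
      proof (rule nonneg_bdd_above_summable_on)
        show "bdd_above (sum (\<lambda>a. (1 - norm a) * \<phi> a) ` {F. F \<subseteq> \<Lambda> \<and> finite F})"
          using sum_le[OF C] by (intro bdd_aboveI2[of _ _ C]) auto
        show "0 \<le> (1 - norm a) * \<phi> a" if "a \<in> \<Lambda>" for a
          using that norm_less_1[of a] ln_inverse_blaschke_without_nonneg[OF L, of a] by (simp add: \<phi>_def less_imp_le)
      qed
      with ns show False by (simp add: \<phi>_def)
    qed
    have row: "\<exists>C. \<forall>F. finite F \<longrightarrow> F \<subseteq> \<Lambda> \<longrightarrow> (\<Sum>y\<in>F. w x y) \<le> C" if x: "x \<in> \<Lambda>" for x
      using finite_sum_le_has_sum[OF whs[OF x]] wpos x by (intro exI[of _ "(1 - norm x) * \<phi> x"]) auto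
    \<comment> \<open>In a column the weight 1 - |x| varies; it is at most 1, and |b_x(y)| is
      symmetric, so the column is dominated by the convergent series for
      \<open>\<phi> y\<close>.\<close>
    have col: "\<exists>C. \<forall>F. finite F \<longrightarrow> F \<subseteq> \<Lambda> \<longrightarrow> (\<Sum>x\<in>F. w x y) \<le> C" if y: "y \<in> \<Lambda>" for y
    proof (intro exI[of _ "\<phi> y"] allI impI)
      fix F assume F: "finite F" "F \<subseteq> \<Lambda>"
      have "(\<Sum>x\<in>F. w x y) = (\<Sum>x\<in>F-{y}. w x y)"
        using F by (intro sum.mono_neutral_right) (auto simp: w_def)
      also have "\<dots> \<le> (\<Sum>x\<in>F-{y}. d x y)"
      proof (rule sum_mono)
        fix x assume "x \<in> F - {y}"
        then have x: "x \<in> \<Lambda>" "x \<noteq> y" using F by auto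
        then have "w x y = (1 - norm x) * d x y" using d(2)[OF x(1) y] by (simp add: w_def)
        also have "\<dots> \<le> 1 * d x y" using d(1)[OF y x(1)] by (intro mult_right_mono) auto
        finally show "w x y \<le> d x y" by simp
      qed
      also have "\<dots> \<le> \<phi> y"
        by (rule finite_sum_le_has_sum[OF hs[OF y refl]]) (use F d y in auto)
      finally show "(\<Sum>x\<in>F. w x y) \<le> \<phi> y" .
    qed
    obtain A where A: "A \<subseteq> \<Lambda>"
      "\<And>n::nat. \<exists>S T. finite S \<and> finite T \<and> S \<subseteq> A \<and> T \<subseteq> \<Lambda> - A \<and> real n \<le> (\<Sum>x\<in>T. \<Sum>y\<in>S. w x y)"
      by (rule infinite_cut[of \<Lambda> w, OF wpos _ row col inf]) (auto simp: w_def)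
    obtain f where f: "f \<in> nevanlinna_class" "\<And>a. a \<in> A \<Longrightarrow> f a = 0" "\<And>a. a \<in> \<Lambda> - A \<Longrightarrow> f a = 1"
      using int[OF A(1)] by blast
    obtain C where C: "0 \<le> C" "f holomorphic_on ball 0 1"
      "\<And>r. 0 < r \<Longrightarrow> r < 1 \<Longrightarrow> poisson_integral (\<lambda>x. log_plus (norm (dilate f r x))) 0 \<le> C"
      using nevanlinna_classD[OF f(1)] by metis
    obtain K where K: "0 \<le> K" "\<And>T \<zeta>. finite T \<Longrightarrow> T \<subseteq> \<Lambda> \<Longrightarrow> norm \<zeta> = 1 \<Longrightarrow>
       (\<Sum>a\<in>T. (1 - norm a) * poisson_kernel a \<zeta>) \<le> K"
      using sum_poisson_le_of_bounded_balayage[OF bal L(1)] by metis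
    \<comment> \<open>Any cut weight above 4 K C contradicts the bound belonging to this particular
      \<open>f\<close>.\<close>
    obtain n :: nat where n: "4 * K * C < real n" using reals_Archimedean2 by blast
    obtain S T where ST: "finite S" "finite T" "S \<subseteq> A" "T \<subseteq> \<Lambda> - A" "real n \<le> (\<Sum>x\<in>T. \<Sum>y\<in>S. w x y)"
      using A(2)[of n] by (elim exE conjE)
    have "(\<Sum>x\<in>T. \<Sum>y\<in>S. w x y) = (\<Sum>x\<in>T. (1 - norm x) * (\<Sum>y\<in>S. d y x))"
    proof (rule sum.cong[OF refl])
      fix x assume x: "x \<in> T"
      have "(\<Sum>y\<in>S. w x y) = (\<Sum>y\<in>S. (1 - norm x) * d y x)"
        using x ST by (intro sum.cong refl) (auto simp: w_def)
      then show "(\<Sum>y\<in>S. w x y) = (1 - norm x) * (\<Sum>y\<in>S. d y x)" by (simp add: sum_distrib_left)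
    qed
    also have "\<dots> \<le> 4 * K * C"
      unfolding d_def
    proof (rule nevanlinna_cut_bound[OF C(2,1,3) ST(1) _ _ ST(2) _ _ K(1)])
      show "S \<subseteq> ball 0 1" "T \<subseteq> ball 0 1" using ST A L by blast+
      show "f a = 0" if "a \<in> S" for a using f(2) ST that by blast
      show "norm (f a) = 1" if "a \<in> T" for a using f(3) ST that by (metis norm_one subsetD)
      show "(\<Sum>a\<in>T. (1 - norm a) * poisson_kernel a \<zeta>) \<le> K" if "norm \<zeta> = 1" for \<zeta>
        by (rule K(2)[OF ST(2) _ that]) (use ST in blast)
    qed
    finally show False using ST(5) n by linarith
  qed
qed

section \<open>Interpolation by bounded functions\<close>

text \<open>For a in the disc and nonnegative coefficients the terms have nonnegative real part on
  the closed disc and no pole there, so finite subsums are holomorphic beyond the circle, although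
  the full sum need not be.\<close>

definition herglotz_sum :: "(complex \<Rightarrow> real) \<Rightarrow> complex set \<Rightarrow> complex \<Rightarrow> complex" where
  "herglotz_sum c \<Lambda> z = (\<Sum>\<^sub>\<infinity>a\<in>\<Lambda>. of_real (c a) / (1 - cnj a * z))"

lemma Re_one_minus_cnj_mult_pos:
  assumes "norm a < 1" "norm z \<le> 1"
  shows "0 < Re (1 - cnj a * z)"
proof -
  have "norm (cnj a * z) < 1"
    using assms mult_right_le_one_le[of "norm a" "norm z"] by (simp add: norm_mult)
  then have "Re (cnj a * z) < 1" using complex_Re_le_cmod[of "cnj a * z"] by linarith
  then show ?thesis by simp
qed

lemma Re_herglotz_term_nonneg:
  assumes "norm a < 1" "norm z \<le> 1" "0 \<le> c"
  shows "0 \<le> Re (of_real c / (1 - cnj a * z))"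
proof -
  have "Re (of_real c / (1 - cnj a * z)) = c * (Re (1 - cnj a * z) / (norm (1 - cnj a * z))\<^sup>2)"
    unfolding cmod_power2 Re_divide by simp
  also have "\<dots> \<ge> 0"
    using Re_one_minus_cnj_mult_pos[OF assms(1,2)] assms(3)
    by (intro mult_nonneg_nonneg divide_nonneg_nonneg) (auto simp: less_imp_le)
  finally show ?thesis .
qed

lemma norm_herglotz_term_le:
  assumes "norm a < 1" "norm z \<le> r" "r < 1" "0 \<le> c"
  shows "norm (of_real c / (1 - cnj a * z)) \<le> c / (1 - r)"
proof -
  have "norm (cnj a * z) \<le> norm z" using assms by (simp add: norm_mult mult_left_le_one_le)
  then have "1 - r \<le> norm (1 - cnj a * z)" using norm_triangle_ineq2[of 1 "cnj a * z"] assms by simp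
  then show ?thesis using assms by (simp add: norm_divide frac_le)
qed

lemma summable_herglotz:
  assumes "\<Lambda> \<subseteq> ball 0 1" "c summable_on \<Lambda>" "\<And>a. a \<in> \<Lambda> \<Longrightarrow> 0 \<le> c a" "norm z < 1"
  shows "(\<lambda>a. of_real (c a) / (1 - cnj a * z)) summable_on \<Lambda>"
proof (rule abs_summable_summable, rule summable_on_comparison_test)
  show "(\<lambda>a. c a * (1 / (1 - norm z))) summable_on \<Lambda>" by (rule summable_on_cmult_left[OF assms(2)])
  fix a assume a: "a \<in> \<Lambda>"
  then have "norm a < 1" using assms(1) by auto
  from norm_herglotz_term_le[OF this order_refl assms(4) assms(3)[OF a]]
  show "norm (of_real (c a) / (1 - cnj a * z)) \<le> c a * (1 / (1 - norm z))" by simp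
qed simp

lemma holomorphic_herglotz_sum:
  assumes L: "\<Lambda> \<subseteq> ball 0 1" and c: "c summable_on \<Lambda>" "\<And>a. a \<in> \<Lambda> \<Longrightarrow> 0 \<le> c a"
  shows "herglotz_sum c \<Lambda> holomorphic_on ball 0 1"
proof -
  have loc: "herglotz_sum c \<Lambda> holomorphic_on ball 0 r" if r: "r < 1" for r
  proof (rule holomorphic_uniform_limit)
    show "uniform_limit (cball 0 r) (\<lambda>F z. \<Sum>a\<in>F. of_real (c a) / (1 - cnj a * z)) (herglotz_sum c \<Lambda>) (finite_subsets_at_top \<Lambda>)"
      unfolding herglotz_sum_def
    proof (rule Weierstrass_m_test_general)
      show "(\<lambda>a. c a * (1 / (1 - r))) summable_on \<Lambda>" by (rule summable_on_cmult_left[OF c(1)])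
      fix a z assume a: "a \<in> \<Lambda>" and z: "z \<in> cball (0::complex) r"
      have "norm a < 1" using L a by auto
      from norm_herglotz_term_le[OF this _ r c(2)[OF a], of z] z
      show "norm (of_real (c a) / (1 - cnj a * z)) \<le> c a * (1 / (1 - r))" by simp
    qed
    have nz: "1 - cnj a * z \<noteq> 0" if "a \<in> \<Lambda>" "norm z \<le> r" for a z
      using one_minus_cnj_mult_nonzero[of a z] that L r by (auto simp: subset_iff)
    show "eventually (\<lambda>F. continuous_on (cball 0 r) (\<lambda>z. \<Sum>a\<in>F. of_real (c a) / (1 - cnj a * z)) \<and>
        (\<lambda>z. \<Sum>a\<in>F. of_real (c a) / (1 - cnj a * z)) holomorphic_on ball 0 r) (finite_subsets_at_top \<Lambda>)"
    proof (rule eventually_finite_subsets_at_top_weakI, rule conjI)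
      fix F assume F: "finite F" "F \<subseteq> \<Lambda>"
      show "continuous_on (cball 0 r) (\<lambda>z. \<Sum>a\<in>F. of_real (c a) / (1 - cnj a * z))"
        using F nz by (intro continuous_intros) auto
      show "(\<lambda>z. \<Sum>a\<in>F. of_real (c a) / (1 - cnj a * z)) holomorphic_on ball 0 r"
        using F nz by (intro holomorphic_intros) auto
    qed
  qed auto
  show ?thesis
  proof (rule holomorphic_on_subset)
    show "herglotz_sum c \<Lambda> holomorphic_on (\<Union>r\<in>{0<..<1}. ball 0 r)"
      by (rule holomorphic_on_UN_open) (use loc in auto)
    show "ball 0 1 \<subseteq> (\<Union>r\<in>{0<..<1}. ball (0::complex) r)"
    proof
      fix z :: complex assume "z \<in> ball 0 1"
      then show "z \<in> (\<Union>r\<in>{0<..<1}. ball (0::complex) r)"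
        by (intro UN_I[of "(norm z + 1) / 2"]) (auto intro: add_nonneg_pos)
    qed
  qed
qed

text \<open>Omitted terms have nonnegative real part. A singleton \<open>S\<close> later yields Re
  G(a) \<ge> \<open>\<phi> a\<close>; large finite \<open>S\<close> yield minorants that are
  continuous up to the circle.\<close>

lemma Re_herglotz_sum_ge:
  assumes L: "\<Lambda> \<subseteq> ball 0 1" and c: "c summable_on \<Lambda>" "\<And>a. a \<in> \<Lambda> \<Longrightarrow> 0 \<le> c a"
    and z: "norm z < 1" and S: "finite S" "S \<subseteq> \<Lambda>"
  shows "(\<Sum>a\<in>S. Re (of_real (c a) / (1 - cnj a * z))) \<le> Re (herglotz_sum c \<Lambda> z)"
proof -
  have "((\<lambda>a. of_real (c a) / (1 - cnj a * z)) has_sum herglotz_sum c \<Lambda> z) \<Lambda>"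
    unfolding herglotz_sum_def by (rule has_sum_infsum[OF summable_herglotz[OF L c z]])
  then have "((\<lambda>a. Re (of_real (c a) / (1 - cnj a * z))) has_sum Re (herglotz_sum c \<Lambda> z)) \<Lambda>"
    by (rule has_sum_Re)
  then show ?thesis
  proof (rule finite_sum_le_has_sum[OF _ S])
    fix a assume "a \<in> \<Lambda> - S"
    then have "norm a < 1" "0 \<le> c a" using L c(2) by auto
    then show "0 \<le> Re (of_real (c a) / (1 - cnj a * z))" using z by (intro Re_herglotz_term_nonneg) auto
  qed
qed

lemma Re_herglotz_sum_nonneg:
  assumes "\<Lambda> \<subseteq> ball 0 1" "c summable_on \<Lambda>" "\<And>a. a \<in> \<Lambda> \<Longrightarrow> 0 \<le> c a" "norm z < 1"
  shows "0 \<le> Re (herglotz_sum c \<Lambda> z)"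
  using Re_herglotz_sum_ge[OF assms finite.emptyI] by simp

lemma herglotz_sum_0:
  assumes "c summable_on \<Lambda>"
  shows "herglotz_sum c \<Lambda> 0 = of_real (infsum c \<Lambda>)"
proof -
  have "((\<lambda>a. complex_of_real (c a)) has_sum of_real (infsum c \<Lambda>)) \<Lambda>"
    using assms by (intro has_sum_bounded_linear[OF bounded_linear_of_real] has_sum_infsum)
  then show ?thesis by (simp add: herglotz_sum_def infsumI)
qed

text \<open>On the circle the squared factor has modulus \<open>(1 - |a|\<^sup>2) P\<^sub>a\<close>, so that bounded balayage
  bounds the interpolating sum, and the maximum principle carries the bound inside.\<close>

lemma finite_bounded_interpolation:
  assumes S: "finite S" "S \<subseteq> ball 0 1" and W: "0 \<le> W"
    and v: "\<And>a. a \<in> S \<Longrightarrow> norm (v a) \<le> W * (\<Prod>b\<in>S-{a}. norm (blaschke_factor b a))"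
    and K: "\<And>\<zeta>. norm \<zeta> = 1 \<Longrightarrow> (\<Sum>a\<in>S. (1 - norm a) * poisson_kernel a \<zeta>) \<le> K"
  obtains g where "g holomorphic_on ball 0 1" "\<And>z. norm z < 1 \<Longrightarrow> norm (g z) \<le> 2 * W * K"
    "\<And>a. a \<in> S \<Longrightarrow> g a = v a"
proof -
  define B where "B = (\<lambda>a z. \<Prod>b\<in>S-{a}. blaschke_factor b z)"
  \<comment> \<open>Lagrange form: \<open>B a\<close> vanishes at the other points of
    \<open>S\<close>, and the squared kernel equals 1 at a.\<close>
  define g where "g = (\<lambda>z. \<Sum>a\<in>S. v a / B a a * B a z * (of_real (1 - (norm a)\<^sup>2) / (1 - cnj a * z))\<^sup>2)"
  have n1: "norm a < 1" if "a \<in> S" for a using that S by auto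
  have nz: "1 - cnj a * z \<noteq> 0" if "a \<in> S" "norm z \<le> 1" for a z
    using one_minus_cnj_mult_nonzero[OF n1[OF that(1)] that(2)] .
  have nz': "cnj a * z \<noteq> 1" if "a \<in> S" "norm z \<le> 1" for a z
    using nz[OF that] by auto
  have Bnz: "B a a \<noteq> 0" if "a \<in> S" for a
    unfolding B_def prod_zero_iff[OF finite_Diff[OF S(1)]]
  proof
    assume "\<exists>b\<in>S - {a}. blaschke_factor b a = 0"
    then obtain b where b: "b \<in> S" "b \<noteq> a" "blaschke_factor b a = 0" by blast
    then show False using blaschke_factor_eq_0_iff[of b a] n1[OF b(1)] n1[OF that] by simp
  qed
  have hol: "g holomorphic_on ball 0 1"
    unfolding g_def B_def
  proof (intro holomorphic_intros)
    fix a assume a: "a \<in> S"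
    show "blaschke_factor b holomorphic_on ball 0 1" if "b \<in> S - {a}" for b
      by (rule holomorphic_blaschke_factor) (use nz' that in auto)
    show "1 - cnj a * z \<noteq> 0" if "z \<in> ball 0 1" for z using nz[OF a, of z] that by simp
  qed
  have cont: "continuous_on (cball 0 1) g"
    unfolding g_def B_def
  proof (intro continuous_intros)
    show "continuous_on (cball 0 1) (blaschke_factor b)" if "b \<in> S - {a}" for a b
      by (rule holomorphic_on_imp_continuous_on, rule holomorphic_blaschke_factor) (use nz' that in auto)
    show "\<forall>z\<in>cball 0 1. 1 - cnj a * z \<noteq> 0" if "a \<in> S" for a using nz[OF that] by simp
  qed
  have circ: "norm (g z) \<le> 2 * W * K" if z: "norm z = 1" for z
  proof -
    have "norm (g z) \<le> (\<Sum>a\<in>S. 2 * W * ((1 - norm a) * poisson_kernel a z))"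
      unfolding g_def
    proof (rule sum_norm_le)
      fix a assume a: "a \<in> S"
      have Ba: "norm (B a a) = (\<Prod>b\<in>S-{a}. norm (blaschke_factor b a))" by (simp add: B_def prod_norm)
      have 1: "norm (v a / B a a) \<le> W"
      proof -
        have "norm (v a) \<le> W * norm (B a a)" using v[OF a] by (simp only: Ba)
        then show ?thesis unfolding norm_divide using Bnz[OF a] by (simp add: pos_divide_le_eq)
      qed
      have 2: "norm (B a z) = 1"
      proof -
        have "norm (B a z) = (\<Prod>b\<in>S-{a}. norm (blaschke_factor b z))" by (simp add: B_def prod_norm)
        also have "\<dots> = 1" by (rule prod.neutral) (auto intro!: norm_blaschke_factor_circle n1 z)
        finally show ?thesis .
      qed
      have ge: "0 \<le> 1 - (norm a)\<^sup>2" using n1[OF a] by (simp add: abs_square_le_1)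
      have "(norm (1 - cnj a * z))\<^sup>2 = (norm (z - a))\<^sup>2"
        using norm_sq_one_minus_cnj_mult[of a z] z by (simp add: norm_minus_commute)
      then have "norm ((of_real (1 - (norm a)\<^sup>2) / (1 - cnj a * z))\<^sup>2) = (1 - (norm a)\<^sup>2) * poisson_kernel a z"
        using ge by (simp only: norm_power norm_divide norm_of_real power_divide poisson_kernel_def)
          (simp add: power2_eq_square)
      \<comment> \<open>The factor 2 bounds 1 + |a| in 1 - |a|^2 = (1 + |a|) (1 - |a|).\<close>
      also have "\<dots> \<le> 2 * (1 - norm a) * poisson_kernel a z"
      proof (rule mult_right_mono)
        have "1 - (norm a)\<^sup>2 = (1 + norm a) * (1 - norm a)" by (simp add: power2_eq_square algebra_simps)
        also have "\<dots> \<le> 2 * (1 - norm a)" using n1[OF a] by (intro mult_right_mono) auto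
        finally show "1 - (norm a)\<^sup>2 \<le> 2 * (1 - norm a)" .
        show "0 \<le> poisson_kernel a z" using n1[OF a] by (intro poisson_kernel_nonneg) simp
      qed
      finally have 3: "norm ((of_real (1 - (norm a)\<^sup>2) / (1 - cnj a * z))\<^sup>2) \<le> 2 * (1 - norm a) * poisson_kernel a z" .
      have "norm (v a / B a a * B a z * (of_real (1 - (norm a)\<^sup>2) / (1 - cnj a * z))\<^sup>2)
          = norm (v a / B a a) * norm ((of_real (1 - (norm a)\<^sup>2) / (1 - cnj a * z))\<^sup>2)"
        by (simp only: norm_mult 2 mult_1_right)
      also have "\<dots> \<le> W * (2 * (1 - norm a) * poisson_kernel a z)"
        using 1 3 W by (intro mult_mono) auto
      finally show "norm (v a / B a a * B a z * (of_real (1 - (norm a)\<^sup>2) / (1 - cnj a * z))\<^sup>2)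
          \<le> 2 * W * ((1 - norm a) * poisson_kernel a z)" by (simp add: mult_ac)
    qed
    also have "\<dots> = 2 * W * (\<Sum>a\<in>S. (1 - norm a) * poisson_kernel a z)" by (simp add: sum_distrib_left)
    also have "\<dots> \<le> 2 * W * K" using K[OF z] W by (intro mult_left_mono) auto
    finally show ?thesis .
  qed
  show ?thesis
  proof (rule that[OF hol])
    fix z :: complex assume z: "norm z < 1"
    show "norm (g z) \<le> 2 * W * K"
      by (rule maximum_modulus_frontier[of g "cball 0 1"]) (use z hol cont circ in \<open>auto simp: interior_cball\<close>)
  next
    fix a assume a: "a \<in> S"
    have B0: "B b a = 0" if "b \<in> S" "b \<noteq> a" for b
    proof -
      have "blaschke_factor a a = 0" using blaschke_factor_eq_0_iff[of a a] n1[OF a] by simp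
      then show ?thesis unfolding B_def prod_zero_iff[OF finite_Diff[OF S(1)]] using a that by blast
    qed
    have "1 - cnj a * a = of_real (1 - (norm a)\<^sup>2)"
      by (simp only: of_real_diff of_real_1 complex_norm_square mult.commute)
    moreover have "complex_of_real (1 - (norm a)\<^sup>2) \<noteq> 0"
      using nz[OF a, of a] n1[OF a] calculation by simp
    ultimately have sq: "(of_real (1 - (norm a)\<^sup>2) / (1 - cnj a * a))\<^sup>2 = 1"
      by (metis divide_self power_one)
    have "g a = (\<Sum>b\<in>{a}. v b / B b b * B b a * (of_real (1 - (norm b)\<^sup>2) / (1 - cnj b * a))\<^sup>2)"
      unfolding g_def using S a B0 by (intro sum.mono_neutral_right) auto
    also have "\<dots> = v a / B a a * B a a * (of_real (1 - (norm a)\<^sup>2) / (1 - cnj a * a))\<^sup>2" by simp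
    also have "\<dots> = v a" unfolding sq using Bnz[OF a] by simp
    finally show "g a = v a" .
  qed
qed

text \<open>Normal families: the interpolants for finite parts of \<open>\<Lambda>\<close> share the
  bound 2 W K, since a finite subproduct is at least as large in modulus as the full product and K
  serves all finite subsets. At each point of \<open>\<Lambda>\<close> the sequence is eventually
  constant, so the limit interpolates.\<close>

lemma bounded_interpolation:
  assumes L: "\<Lambda> \<subseteq> ball 0 1" "blaschke_condition \<Lambda>" and W: "0 \<le> W"
    and v: "\<And>a. a \<in> \<Lambda> \<Longrightarrow> norm (v a) \<le> W * norm (blaschke_without \<Lambda> a a)"
    and K: "\<And>T \<zeta>. finite T \<Longrightarrow> T \<subseteq> \<Lambda> \<Longrightarrow> norm \<zeta> = 1 \<Longrightarrow> (\<Sum>a\<in>T. (1 - norm a) * poisson_kernel a \<zeta>) \<le> K"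
  obtains g where "g holomorphic_on ball 0 1" "\<And>z. norm z < 1 \<Longrightarrow> norm (g z) \<le> 2 * W * K"
    "\<And>a. a \<in> \<Lambda> \<Longrightarrow> g a = v a"
proof -
  have n1: "norm a < 1" if "a \<in> \<Lambda>" for a using that L by auto
  \<comment> \<open>Countability, hence an exhaustion by finite sets \<open>T n\<close>, comes from
    the summability of the positive numbers 1 - |a|.\<close>
  have "countable {a\<in>\<Lambda>. 1 - norm a \<noteq> 0}"
    using L(2) unfolding blaschke_condition_def by (rule summable_countable_real)
  moreover have "{a\<in>\<Lambda>. 1 - norm a \<noteq> 0} = \<Lambda>" using n1 by force
  ultimately have cL: "countable \<Lambda>" by simp
  define T where "T = (\<lambda>n::nat. {a\<in>\<Lambda>. to_nat_on \<Lambda> a \<le> n})"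
  have fT: "finite (T n)" "T n \<subseteq> \<Lambda>" for n
  proof -
    have "inj_on (to_nat_on \<Lambda>) (T n)" using inj_on_to_nat_on[OF cL] by (rule inj_on_subset) (auto simp: T_def)
    moreover have "finite (to_nat_on \<Lambda> ` T n)" by (rule finite_subset[of _ "{..n}"]) (auto simp: T_def)
    ultimately show "finite (T n)" by (rule finite_imageD[rotated])
  qed (auto simp: T_def)
  have "\<exists>g. g holomorphic_on ball 0 1 \<and> (\<forall>z. norm z < 1 \<longrightarrow> norm (g z) \<le> 2 * W * K) \<and> (\<forall>a\<in>T n. g a = v a)" for n
  proof -
    have "norm (v a) \<le> W * (\<Prod>b\<in>T n-{a}. norm (blaschke_factor b a))" if a: "a \<in> T n" for a
    proof -
      have aL: "a \<in> \<Lambda>" using a fT by blast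
      note hs = blaschke_without_has_sum[OF L aL]
      have b0: "blaschke_factor b a \<noteq> 0" if "b \<in> \<Lambda>" "b \<noteq> a" for b
        using blaschke_factor_eq_0_iff[of b a] n1[OF that(1)] n1[OF aL] that by simp
      then have b0': "0 < norm (blaschke_factor b a)" if "b \<in> T n - {a}" for b using fT[of n] that by auto
      have "(\<Sum>b\<in>T n-{a}. ln (inverse (norm (blaschke_factor b a)))) \<le> ln (inverse (norm (blaschke_without \<Lambda> a a)))"
        by (rule finite_sum_le_has_sum[OF hs(1)])
          (use fT[of n] n1 aL in \<open>auto intro!: ln_inverse_norm_blaschke_nonneg\<close>)
      then have "ln (norm (blaschke_without \<Lambda> a a)) \<le> (\<Sum>b\<in>T n-{a}. ln (norm (blaschke_factor b a)))"
        using hs(2) by (simp add: ln_inverse sum_negf)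
      also have "\<dots> = ln (\<Prod>b\<in>T n-{a}. norm (blaschke_factor b a))"
        using b0' fT(1)[of n] by (intro ln_prod[symmetric]) auto
      finally have "norm (blaschke_without \<Lambda> a a) \<le> (\<Prod>b\<in>T n-{a}. norm (blaschke_factor b a))"
        using hs(2) by (subst (asm) ln_le_cancel_iff) (auto intro!: prod_pos b0')
      then have "W * norm (blaschke_without \<Lambda> a a) \<le> W * (\<Prod>b\<in>T n-{a}. norm (blaschke_factor b a))"
        using W by (rule mult_left_mono)
      then show ?thesis using v[OF aL] by (rule order_trans[rotated])
    qed
    moreover have "T n \<subseteq> ball 0 1" using fT L by blast
    ultimately show ?thesis
      using finite_bounded_interpolation[OF fT(1) _ W _ K[OF fT]] by metis
  qed
  then obtain G where G: "\<And>n. G n holomorphic_on ball 0 1" "\<And>n z. norm z < 1 \<Longrightarrow> norm (G n z) \<le> 2 * W * K"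
    "\<And>n a. a \<in> T n \<Longrightarrow> G n a = v a" by metis
  define H where "H = {h. h holomorphic_on ball 0 1 \<and> (\<forall>z\<in>ball 0 1. norm (h z) \<le> 2 * W * K)}"
  obtain g r where g: "g holomorphic_on ball 0 1" "strict_mono (r :: nat \<Rightarrow> nat)"
    "\<And>x. x \<in> ball 0 1 \<Longrightarrow> ((\<lambda>n. G (r n) x) \<longlongrightarrow> g x) sequentially"
  proof (rule Montel[of "ball 0 1" H G])
    show "range G \<subseteq> H" using G(1,2) by (auto simp: H_def)
    show "\<exists>B. \<forall>h\<in>H. \<forall>z\<in>K. norm (h z) \<le> B" if "compact K" "K \<subseteq> ball 0 1" for K
      using that by (auto simp: H_def)
  qed (auto simp: H_def)
  show ?thesis
  proof (rule that[OF g(1)])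
    fix z :: complex assume z: "norm z < 1"
    then have "(\<lambda>n. G (r n) z) \<longlonglongrightarrow> g z" by (intro g(3)) simp
    then show "norm (g z) \<le> 2 * W * K"
      by (rule tendsto_upperbound[OF tendsto_norm]) (use G(2)[OF z] in auto)
  next
    fix a assume a: "a \<in> \<Lambda>"
    have "eventually (\<lambda>n. G (r n) a = v a) sequentially"
      using eventually_ge_at_top[of "to_nat_on \<Lambda> a"]
    proof eventually_elim
      case (elim n)
      then have "to_nat_on \<Lambda> a \<le> r n" using seq_suble[OF g(2), of n] by linarith
      then show ?case using a by (intro G(3)) (simp add: T_def)
    qed
    then have "(\<lambda>n. G (r n) a) \<longlonglongrightarrow> v a" by (rule tendsto_eventually)
    moreover have "(\<lambda>n. G (r n) a) \<longlonglongrightarrow> g a" using n1[OF a] by (intro g(3)) simp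
    ultimately show "g a = v a" by (rule LIMSEQ_unique[rotated])
  qed
qed

section \<open>Lipschitz functions and a boundary maximum principle\<close>

text \<open>Both sides are measures agreeing on half-open intervals, a generating family stable
  under intersection. Each Stieltjes measure is thereby dominated by a multiple of Lebesgue measure,
  the route to absolute continuity.\<close>

lemma interval_measure_sum_eq_lborel:
  assumes F: "\<And>x y. x \<le> y \<Longrightarrow> F x \<le> F y" "\<And>a. continuous (at_right a) F"
    and G: "\<And>x y. x \<le> y \<Longrightarrow> G x \<le> G y" "\<And>a. continuous (at_right a) G"
    and sum: "\<And>x. F x + G x = c * x" and c: "0 \<le> c" and A: "A \<in> sets borel"
  shows "emeasure (interval_measure F) A + emeasure (interval_measure G) A = ennreal c * emeasure lborel A"
proof -
  define \<mu> where "\<mu> = (\<lambda>A. emeasure (interval_measure F) A + emeasure (interval_measure G) A)"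
  define M where "M = measure_of UNIV (sets (borel :: real measure)) \<mu>"
  have setsM: "sets M = sets borel" unfolding M_def by (metis sets.sets_measure_of_eq space_borel)
  have em: "emeasure M X = \<mu> X" if "X \<in> sets borel" for X
    unfolding M_def
  proof (rule emeasure_measure_of_sigma)
    show "sigma_algebra UNIV (sets (borel :: real measure))" by (metis sets.sigma_algebra_axioms space_borel)
    show "positive (sets borel) \<mu>" by (simp add: positive_def \<mu>_def)
    show "countably_additive (sets borel) \<mu>"
    proof (rule countably_additiveI)
      fix A :: "nat \<Rightarrow> real set" assume A: "range A \<subseteq> sets borel" "disjoint_family A"
      have "(\<Sum>i. \<mu> (A i)) = (\<Sum>i. emeasure (interval_measure F) (A i)) + (\<Sum>i. emeasure (interval_measure G) (A i))"
        unfolding \<mu>_def by (rule suminf_add[symmetric]) auto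
      also have "\<dots> = \<mu> (\<Union> (range A))"
        unfolding \<mu>_def using A by (intro arg_cong2[of _ _ _ _ "(+)"] suminf_emeasure) auto
      finally show "(\<Sum>i. \<mu> (A i)) = \<mu> (\<Union> (range A))" .
    qed
  qed fact
  let ?E = "range (\<lambda>(a, b). {a<..b :: real})"
  have Ioc: "\<mu> {a<..b} = ennreal c * emeasure lborel {a<..b}" for a b :: real
  proof (cases "a \<le> b")
    case True
    have "\<mu> {a<..b} = ennreal (F b - F a) + ennreal (G b - G a)"
      unfolding \<mu>_def using True F G by (simp add: emeasure_interval_measure_Ioc)
    also have "\<dots> = ennreal (F b - F a + (G b - G a))"
      using F(1)[OF True] G(1)[OF True] by (intro ennreal_plus[symmetric]) auto
    also have "F b - F a + (G b - G a) = c * (b - a)"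
      using sum[of a] sum[of b] by (simp add: algebra_simps)
    finally show ?thesis using True c by (simp add: ennreal_mult)
  qed (simp add: \<mu>_def)
  have sets_Ioc: "sets (borel :: real measure) = sigma_sets UNIV ?E"
    by (subst borel_sigma_sets_Ioc) (simp add: sets_measure_of)
  have "M = density lborel (\<lambda>_. ennreal c)"
  proof (rule measure_eqI_generator_eq[where E = ?E and \<Omega> = UNIV and A = "\<lambda>n::nat. {- real n<..real n}"])
    show "Int_stable ?E"
    proof (rule Int_stableI)
      fix a b assume "a \<in> ?E" "b \<in> ?E"
      then obtain p q r s where "a = {p<..q}" "b = {r<..s}" by auto
      then have "a \<inter> b = (\<lambda>(a, b). {a<..b}) (max p r, min q s)" by auto
      then show "a \<inter> b \<in> ?E" by blast
    qed
    show "sets M = sigma_sets UNIV ?E" unfolding setsM by (rule sets_Ioc)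
    show "sets (density lborel (\<lambda>_. ennreal c)) = sigma_sets UNIV ?E" unfolding sets_density sets_lborel by (rule sets_Ioc)
    show "emeasure M X = emeasure (density lborel (\<lambda>_. ennreal c)) X" if "X \<in> ?E" for X
      using that by (auto simp: em Ioc emeasure_density nn_integral_cmult_indicator)
    show "(\<Union>i::nat. {- real i<..real i}) = UNIV"
    proof -
      have "\<exists>n::nat. - real n < x \<and> x \<le> real n" for x
      proof -
        obtain n :: nat where "\<bar>x\<bar> < real n" using reals_Archimedean2 by blast
        then show ?thesis by (intro exI[of _ n]) auto
      qed
      then show ?thesis by auto
    qed
    show "emeasure M {- real i<..real i} \<noteq> \<infinity>" for i
      by (simp add: em Ioc ennreal_mult_eq_top_iff)
  qed auto
  then have "emeasure M A = emeasure (density lborel (\<lambda>_. ennreal c)) A" by simp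
  then show ?thesis using A by (simp add: em \<mu>_def emeasure_density nn_integral_cmult_indicator)
qed

text \<open>L x + \<open>\<phi> x\<close> and L x - \<open>\<phi> x\<close> both increase and sum to
  2 L x, so the Stieltjes measure of the first is absolutely continuous. Its Radon-Nikodym density,
  minus L, integrates to \<open>\<phi>\<close>.\<close>

lemma lipschitz_imp_indefinite_integral:
  fixes \<phi> :: "real \<Rightarrow> real"
  assumes lip: "\<And>x y. \<bar>\<phi> x - \<phi> y\<bar> \<le> L * \<bar>x - y\<bar>"
  obtains h where "\<And>a b. a \<le> b \<Longrightarrow> (h has_integral (\<phi> b - \<phi> a)) {a..b}"
proof -
  define F where "F = (\<lambda>x. L * x + \<phi> x)"
  define G where "G = (\<lambda>x. L * x - \<phi> x)"
  have L: "0 \<le> L" using lip[of 1 0] by simp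
  have mono: "F x \<le> F y" "G x \<le> G y" if "x \<le> y" for x y
    using lip[of x y] lip[of y x] that by (auto simp: F_def G_def algebra_simps abs_le_iff)
  have "L-lipschitz_on UNIV \<phi>"
    using lip L by (intro lipschitz_onI) (auto simp: dist_real_def)
  then have c\<phi>: "continuous_on UNIV \<phi>" by (rule lipschitz_on_continuous_on)
  have cont: "continuous (at_right a) F" "continuous (at_right a) G" for a
  proof -
    have "isCont \<phi> a" using c\<phi> by (simp add: continuous_on_eq_continuous_at)
    then have "isCont F a" "isCont G a" unfolding F_def G_def by (auto intro!: continuous_intros)
    then show "continuous (at_right a) F" "continuous (at_right a) G"
      by (auto intro: continuous_at_imp_continuous_within)
  qed
  let ?M = "interval_measure F"
  have ac: "absolutely_continuous lborel ?M"
    unfolding absolutely_continuous_def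
  proof
    fix A :: "real set" assume "A \<in> null_sets lborel"
    then have A: "A \<in> sets borel" "emeasure lborel A = 0" by auto
    have "emeasure ?M A + emeasure (interval_measure G) A = ennreal (2 * L) * emeasure lborel A"
      by (rule interval_measure_sum_eq_lborel[OF mono(1) cont(1) mono(2) cont(2)]) (use L A in \<open>auto simp: F_def G_def\<close>)
    then have "emeasure ?M A = 0" using A by simp
    then show "A \<in> null_sets ?M" using A by auto
  qed
  define f where "f = RN_deriv lborel ?M"
  have fm [measurable]: "f \<in> borel_measurable lborel" unfolding f_def by simp
  have dens: "density lborel f = ?M" unfolding f_def by (rule sigma_finite_measure.density_RN_deriv[OF lborel.sigma_finite_measure_axioms ac]) simp
  have fin: "AE x in lborel. f x \<noteq> \<infinity>"
    unfolding f_def by (rule sigma_finite_measure.RN_deriv_finite[OF lborel.sigma_finite_measure_axioms sigma_finite_interval_measure ac]) (auto intro: mono cont)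
  define h where "h = (\<lambda>x. enn2real (f x))"
  have hm [measurable]: "h \<in> borel_measurable lborel" unfolding h_def by measurable
  have hi: "(h has_integral (F b - F a)) {a..b}" if ab: "a \<le> b" for a b
  proof -
    have "(\<integral>\<^sup>+x. ennreal (h x * indicator {a..b} x) \<partial>lborel) = (\<integral>\<^sup>+x. f x * indicator {a<..b} x \<partial>lborel)"
    proof (rule nn_integral_cong_AE)
      have "AE x in lborel. x \<noteq> a" by (rule AE_lborel_singleton)
      with fin show "AE x in lborel. ennreal (h x * indicator {a..b} x) = f x * indicator {a<..b} x"
      proof eventually_elim
        case (elim x)
        then have "ennreal (h x) = f x" by (simp add: h_def less_top)
        then show ?case using elim(2) by (auto simp: indicator_def)
      qed
    qed
    also have "\<dots> = emeasure (density lborel f) {a<..b}" by (subst emeasure_density) auto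
    also have "\<dots> = ennreal (F b - F a)" unfolding dens using ab mono cont by (simp add: emeasure_interval_measure_Ioc)
    finally have "((\<lambda>x. h x * indicator {a..b} x) has_integral (F b - F a)) UNIV"
      using mono(1)[OF ab] by (intro nn_integral_has_integral) (auto simp: h_def)
    moreover have "(\<lambda>x. h x * indicator {a..b} x) = (\<lambda>x. if x \<in> {a..b} then h x else 0)" by (auto simp: indicator_def)
    ultimately show ?thesis by (simp only: has_integral_restrict_UNIV)
  qed
  show ?thesis
  proof (rule that[of "\<lambda>x. h x - L"])
    fix a b :: real assume ab: "a \<le> b"
    have "((\<lambda>x. L) has_integral (b - a) *\<^sub>R L) {a..b}" using has_integral_const_real[of L a b] ab by simp
    from has_integral_diff[OF hi[OF ab] this]
    show "((\<lambda>x. h x - L) has_integral (\<phi> b - \<phi> a)) {a..b}" by (simp add: F_def algebra_simps)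
  qed
qed

text \<open>Lebesgue differentiation over the cubes with corner x, which in dimension one are the
  intervals from x to x + k; hence one side only.\<close>

lemma indefinite_integral_right_derivative:
  fixes \<phi> h :: "real \<Rightarrow> real"
  assumes h: "\<And>a b. a \<le> b \<Longrightarrow> (h has_integral (\<phi> b - \<phi> a)) {a..b}"
  obtains N where "negligible N" "\<And>x. x \<notin> N \<Longrightarrow> ((\<lambda>k. (\<phi> (x + k) - \<phi> x) / k) \<longlongrightarrow> h x) (at_right 0)"
proof -
  have int: "h integrable_on cbox a b" for a b
    using h[of a b] by (cases "a \<le> b") auto
  obtain N where N: "negligible N" "\<And>x e. \<lbrakk>x \<notin> N; 0 < e\<rbrakk> \<Longrightarrow>
      \<exists>d>0. \<forall>k. 0 < k \<and> k < d \<longrightarrow> norm (integral (cbox x (x + k *\<^sub>R One)) h /\<^sub>R k ^ DIM(real) - h x) < e"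
    using integrable_ccontinuous_explicit[OF int] by metis
  show ?thesis
  proof (rule that[OF N(1)])
    fix x assume x: "x \<notin> N"
    show "((\<lambda>k. (\<phi> (x + k) - \<phi> x) / k) \<longlongrightarrow> h x) (at_right 0)"
    proof (rule tendstoI)
      fix e :: real assume "0 < e"
      then obtain d where d: "d > 0" "\<And>k. 0 < k \<Longrightarrow> k < d \<Longrightarrow> norm (integral (cbox x (x + k *\<^sub>R One)) h /\<^sub>R k ^ DIM(real) - h x) < e"
        using N(2)[OF x] by blast
      have "dist ((\<phi> (x + k) - \<phi> x) / k) (h x) < e" if "0 < k" "k < d" for k
      proof -
        have "integral (cbox x (x + k *\<^sub>R One)) h = \<phi> (x + k) - \<phi> x"
          using h[of x "x + k"] that by (intro integral_unique) simp
        then show ?thesis using d(2)[OF that] by (simp add: dist_norm divide_inverse mult.commute)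
      qed
      then show "eventually (\<lambda>k. dist ((\<phi> (x + k) - \<phi> x) / k) (h x) < e) (at_right 0)"
        unfolding eventually_at_right_field using d(1) by blast
    qed
  qed
qed

text \<open>Reflecting x to -x turns the right derivative into the left one with the same density
  \<open>h\<close>, so the two one-sided derivatives agree off a null set.\<close>

lemma lipschitz_ae_differentiable:
  fixes \<phi> :: "real \<Rightarrow> real"
  assumes lip: "\<And>x y. \<bar>\<phi> x - \<phi> y\<bar> \<le> L * \<bar>x - y\<bar>"
  obtains N where "negligible N" "\<And>x. x \<notin> N \<Longrightarrow> \<exists>D. (\<phi> has_real_derivative D) (at x)"
proof -
  obtain h where h: "\<And>a b. a \<le> b \<Longrightarrow> (h has_integral (\<phi> b - \<phi> a)) {a..b}"
    using lipschitz_imp_indefinite_integral[OF lip] by metis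
  obtain N1 where N1: "negligible N1" "\<And>x. x \<notin> N1 \<Longrightarrow> ((\<lambda>k. (\<phi> (x + k) - \<phi> x) / k) \<longlongrightarrow> h x) (at_right 0)"
    using indefinite_integral_right_derivative[OF h] by metis
  define \<psi> where "\<psi> = (\<lambda>x. - \<phi> (- x))"
  have h': "((\<lambda>x. h (- x)) has_integral (\<psi> b - \<psi> a)) {a..b}" if "a \<le> b" for a b
    using h[of "- b" "- a"] that by (simp add: \<psi>_def has_integral_reflect_real[of h, symmetric] algebra_simps)
  obtain N2 where N2: "negligible N2" "\<And>x. x \<notin> N2 \<Longrightarrow> ((\<lambda>k. (\<psi> (x + k) - \<psi> x) / k) \<longlongrightarrow> h (- x)) (at_right 0)"
    using indefinite_integral_right_derivative[OF h'] by metis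
  have "negligible (uminus ` N2)"
    by (rule negligible_differentiable_image_negligible[OF _ N2(1)]) (auto intro!: differentiable_on_minus differentiable_on_ident)
  then have neg: "negligible (N1 \<union> uminus ` N2)" using N1 by (intro negligible_Un)
  show ?thesis
  proof (rule that[OF neg])
    fix x assume x: "x \<notin> N1 \<union> uminus ` N2"
    then have "- x \<notin> N2" by force
    from N2(2)[OF this] have "((\<lambda>k. (\<phi> (x + - k) - \<phi> x) / - k) \<longlongrightarrow> h x) (at_right 0)"
      by (simp add: \<psi>_def minus_divide_left[symmetric] minus_diff_eq diff_divide_distrib)
    then have "((\<lambda>k. (\<phi> (x + k) - \<phi> x) / k) \<longlongrightarrow> h x) (at_left 0)"
      by (subst (asm) filterlim_at_left_to_right[of _ _ 0, simplified, symmetric])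
    moreover have "((\<lambda>k. (\<phi> (x + k) - \<phi> x) / k) \<longlongrightarrow> h x) (at_right 0)" using x by (intro N1) auto
    ultimately have "((\<lambda>k. (\<phi> (x + k) - \<phi> x) / k) \<longlongrightarrow> h x) (at 0)" by (rule filterlim_split_at)
    then show "\<exists>D. (\<phi> has_real_derivative D) (at x)" unfolding DERIV_def by blast
  qed
qed

text \<open>Multiplying q^n by z - z0 repairs the one boundary point where continuity is not
  assumed, since \<open>q\<close> is bounded by A. The maximum principle then gives |q(z)|^n |z -
  z0| \<le> 2 B^n, and large n forces |q(z)| \<le> B.\<close>

lemma boundary_point_max_principle:
  assumes z0: "norm z0 = 1" and q: "q holomorphic_on ball 0 1" "continuous_on (cball 0 1 - {z0}) q"
    and A: "\<And>z. z \<in> cball 0 1 - {z0} \<Longrightarrow> norm (q z) \<le> A"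
    and B: "\<And>z. norm z = 1 \<Longrightarrow> z \<noteq> z0 \<Longrightarrow> norm (q z) \<le> B" "0 < B" and z: "norm z < 1"
  shows "norm (q z) \<le> B"
proof -
  have zz0: "z \<noteq> z0" using z z0 by auto
  have le: "norm (q z) ^ n * norm (z - z0) \<le> B ^ n * 2" for n
  proof -
    define T where "T = (\<lambda>x. if x = z0 then 0 else q x ^ n * (x - z0))"
    have "norm (T z) \<le> B ^ n * 2"
    proof (rule maximum_modulus_frontier[of T "cball 0 1"])
      have "(\<lambda>x. q x ^ n * (x - z0)) holomorphic_on ball 0 1" by (intro holomorphic_intros q)
      then have "T holomorphic_on ball 0 1"
        by (rule holomorphic_transform) (use z0 in \<open>auto simp: T_def\<close>)
      then show "T holomorphic_on interior (cball 0 1)" by (simp add: interior_cball)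
      have "continuous_on (cball 0 1) T"
        unfolding continuous_on_eq_continuous_within
      proof
        fix x :: complex assume x: "x \<in> cball 0 1"
        show "continuous (at x within cball 0 1) T"
        proof (cases "x = z0")
          case True
          have "(T \<longlongrightarrow> 0) (at z0 within cball 0 1)"
          proof (rule Lim_null_comparison)
            show "eventually (\<lambda>x. norm (T x) \<le> A ^ n * norm (x - z0)) (at z0 within cball 0 1)"
              unfolding eventually_at_filter
            proof (intro always_eventually allI impI)
              fix x assume "x \<noteq> z0" "x \<in> cball 0 1"
              then show "norm (T x) \<le> A ^ n * norm (x - z0)"
                using A[of x] by (auto simp: T_def norm_mult norm_power intro!: mult_right_mono power_mono)
            qed
            have "((\<lambda>x. A ^ n * norm (x - z0)) \<longlongrightarrow> A ^ n * norm (z0 - z0)) (at z0 within cball 0 1)"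
              by (intro tendsto_intros)
            then show "((\<lambda>x. A ^ n * norm (x - z0)) \<longlongrightarrow> 0) (at z0 within cball 0 1)" by simp
          qed
          then show ?thesis using True by (simp add: continuous_within T_def)
        next
          case False
          have "continuous_on (cball 0 1 - {z0}) (\<lambda>x. q x ^ n * (x - z0))" by (intro continuous_intros q)
          then have "continuous_on (cball 0 1 - {z0}) T"
            by (rule continuous_on_cong[THEN iffD1, rotated 2]) (auto simp: T_def)
          then have "continuous (at x within (cball 0 1 - {z0})) T"
            using x False by (auto simp: continuous_on_eq_continuous_within)
          moreover have "at x within (cball 0 1 - {z0}) = at x within cball 0 1"
            by (rule at_within_nhd[of x "- {z0}"]) (use False in auto)
          ultimately show ?thesis by (simp add: continuous_within)
        qed
      qed
      then show "continuous_on (closure (cball 0 1)) T" by simp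
      fix x :: complex assume "x \<in> frontier (cball 0 1)"
      then have x: "norm x = 1" by (simp add: frontier_cball)
      show "norm (T x) \<le> B ^ n * 2"
      proof (cases "x = z0")
        case False
        have "norm (x - z0) \<le> 2" using norm_triangle_ineq4[of x z0] x z0 by simp
        then show ?thesis using B(1)[OF x False] B(2) False
          by (auto simp: T_def norm_mult norm_power intro!: mult_mono power_mono)
      qed (use B in \<open>simp add: T_def\<close>)
    qed (use z in auto)
    then show ?thesis using zz0 by (simp add: T_def norm_mult norm_power)
  qed
  show ?thesis
  proof (rule ccontr)
    assume "\<not> ?thesis"
    then have "1 < norm (q z) / B" using B by simp
    then obtain n where n: "2 / norm (z - z0) < (norm (q z) / B) ^ n" using real_arch_pow by blast
    have "(norm (q z) / B) ^ n * norm (z - z0) \<le> 2"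
      using le[of n] B(2) by (simp add: power_divide field_simps)
    moreover have "0 < norm (z - z0)" using zz0 by simp
    ultimately show False using n by (simp add: field_simps)
  qed
qed

lemma norm_cis_diff_le: "norm (cis s - cis t) \<le> \<bar>s - t\<bar>"
proof -
  have "norm (cis s - cis t) \<le> 1 * norm (s - t)"
  proof (rule differentiable_bound[of UNIV cis "\<lambda>x h. h *\<^sub>R (\<i> * cis x)"])
    fix x :: real
    show "(cis has_derivative (\<lambda>h. h *\<^sub>R (\<i> * cis x))) (at x within UNIV)"
      using has_derivative_cis[OF has_derivative_ident] by simp
    show "onorm (\<lambda>h::real. h *\<^sub>R (\<i> * cis x)) \<le> 1"
      by (rule onorm_bound) (auto simp: norm_mult)
  qed auto
  then show ?thesis by simp
qed

text \<open>The difference quotient \<open>s(z)/(z - z0)\<close> is small on the circle near \<open>z0\<close>; dividing by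
  \<open>\<epsilon> + C (1 - cnj z0 * z)\<close>, whose modulus is comparable to \<open>\<epsilon> + C |z - z0|\<close> because the second
  summand has nonnegative real part, turns this into a uniform bound on the whole circle.\<close>

lemma little_o_on_circle_imp_disc:
  assumes z0: "norm z0 = 1" and s: "continuous_on (cball 0 1) s" "s holomorphic_on ball 0 1"
    and M: "\<And>z. norm z \<le> 1 \<Longrightarrow> norm (s z) \<le> M * norm (z - z0)"
    and e: "0 < e" and d: "0 < d" "\<And>z. norm z = 1 \<Longrightarrow> norm (z - z0) < d \<Longrightarrow> norm (s z) \<le> e * norm (z - z0)"
    and z: "norm z < 1"
  shows "norm (s z) \<le> 2 * norm (z - z0) * (e + M / d * norm (z - z0))"
proof -
  have M0: "0 \<le> M" using M[of 0] norm_ge_zero[of "s 0"] z0 by (simp add: order_trans[OF norm_ge_zero])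
  \<comment> \<open>At circle points at distance at least d from \<open>z0\<close> one has M \<le> C
    |z - z0|, so the crude Lipschitz bound is absorbed by the second summand of
    \<open>D\<close>.\<close>
  define C where "C = M / d"
  have C0: "0 \<le> C" using M0 d by (simp add: C_def)
  define u where "u = (\<lambda>x. 1 - cnj z0 * x)"
  define D where "D = (\<lambda>x. of_real e + of_real C * u x)"
  have nu: "norm (u x) = norm (x - z0)" for x
  proof -
    have "u x = cnj z0 * (z0 - x)"
      using z0 complex_norm_square[of z0] by (simp add: u_def algebra_simps)
    then show ?thesis using z0 by (simp add: norm_mult norm_minus_commute)
  qed
  have Reu: "0 \<le> Re (u x)" if "norm x \<le> 1" for x
    using complex_Re_le_cmod[of "cnj z0 * x"] that z0 by (simp add: u_def norm_mult)
  have De: "e \<le> norm (D x)" "C * norm (u x) \<le> norm (D x)" "norm (D x) \<le> e + C * norm (u x)" if "norm x \<le> 1" for x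
  proof -
    have "e \<le> Re (D x)" using Reu[OF that] C0 by (simp add: D_def)
    then show "e \<le> norm (D x)" using complex_Re_le_cmod[of "D x"] by linarith
    have "(C * norm (u x))\<^sup>2 \<le> (norm (D x))\<^sup>2"
    proof -
      have "(C * norm (u x))\<^sup>2 = (C * Re (u x))\<^sup>2 + (C * Im (u x))\<^sup>2"
        unfolding power_mult_distrib cmod_power2 by (simp add: algebra_simps)
      also have "\<dots> \<le> (e + C * Re (u x))\<^sup>2 + (C * Im (u x))\<^sup>2"
        using e C0 Reu[OF that] by (intro add_right_mono power_mono) auto
      also have "\<dots> = (norm (D x))\<^sup>2" unfolding cmod_power2 D_def by simp
      finally show ?thesis .
    qed
    then show "C * norm (u x) \<le> norm (D x)" by (rule power2_le_imp_le) simp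
    show "norm (D x) \<le> e + C * norm (u x)"
      unfolding D_def using norm_triangle_ineq[of "complex_of_real e" "of_real C * u x"] e C0 by (simp add: norm_mult)
  qed
  have Dnz: "D x \<noteq> 0" if "norm x \<le> 1" for x using De(1)[OF that] e by auto
  have unz: "u x \<noteq> 0" if "x \<noteq> z0" for x
  proof -
    have "norm (u x) \<noteq> 0" unfolding nu using that by simp
    then show ?thesis by simp
  qed
  define q where "q = (\<lambda>x. s x / (u x * D x))"
  have "norm (q z) \<le> 2"
  proof (rule boundary_point_max_principle[OF z0 _ _ _ _ _ z, where q = q and A = "M / e" and B = 2])
    show "q holomorphic_on ball 0 1"
      unfolding q_def
    proof (intro holomorphic_intros s)
      show "u holomorphic_on ball 0 1" unfolding u_def by (intro holomorphic_intros)
      show "D holomorphic_on ball 0 1" unfolding D_def u_def by (intro holomorphic_intros)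
      show "u x * D x \<noteq> 0" if "x \<in> ball 0 1" for x
      proof -
        have "x \<noteq> z0" using that z0 by auto
        then show ?thesis using unz[of x] Dnz[of x] that by simp
      qed
    qed
    show "continuous_on (cball 0 1 - {z0}) q"
      unfolding q_def
    proof (intro continuous_intros continuous_on_subset[OF s(1)])
      show "continuous_on (cball 0 1 - {z0}) u" unfolding u_def by (intro continuous_intros)
      show "continuous_on (cball 0 1 - {z0}) D" unfolding D_def u_def by (intro continuous_intros)
      show "\<forall>x\<in>cball 0 1 - {z0}. u x * D x \<noteq> 0" using unz Dnz by simp
    qed auto
    show "norm (q x) \<le> M / e" if "x \<in> cball 0 1 - {z0}" for x
    proof -
      have x: "norm x \<le> 1" "x \<noteq> z0" using that by auto
      have "norm (q x) = norm (s x) / (norm (x - z0) * norm (D x))" by (simp add: q_def norm_divide norm_mult nu)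
      also have "\<dots> \<le> (M * norm (x - z0)) / (norm (x - z0) * e)"
        using M[OF x(1)] De(1)[OF x(1)] x(2) e M0 by (intro frac_le mult_left_mono mult_pos_pos mult_nonneg_nonneg) auto
      also have "\<dots> = M / e" using x(2) by simp
      finally show ?thesis .
    qed
    show "norm (q x) \<le> 2" if x: "norm x = 1" "x \<noteq> z0" for x
    proof -
      have "norm (s x) \<le> norm (u x) * (e + C * norm (u x))"
      proof (cases "norm (x - z0) < d")
        case True
        have "norm (s x) \<le> norm (u x) * e" using d(2)[OF x(1) True] by (simp add: nu mult.commute)
        also have "\<dots> \<le> norm (u x) * (e + C * norm (u x))" using C0 by (intro mult_left_mono) auto
        finally show ?thesis .
      next
        case False
        have "M \<le> C * norm (u x)"
          using False d(1) M0 mult_left_mono[of d "norm (x - z0)" M] by (simp add: C_def nu field_simps)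
        then have "M \<le> e + C * norm (u x)" using e by linarith
        then have "norm (u x) * M \<le> norm (u x) * (e + C * norm (u x))" by (rule mult_left_mono) simp
        moreover have "norm (s x) \<le> norm (u x) * M" using M[of x] x by (simp add: nu mult.commute)
        ultimately show ?thesis by (rule order_trans[rotated])
      qed
      \<comment> \<open>Adding e \<le> |D| and C |u| \<le> |D| produces the 2.\<close>
      also have "\<dots> \<le> norm (u x) * (2 * norm (D x))"
        using De(1,2)[of x] x by (intro mult_left_mono) auto
      finally have "norm (s x) \<le> 2 * (norm (u x) * norm (D x))" by simp
      moreover have "0 < norm (u x) * norm (D x)" using unz[OF x(2)] Dnz[of x] x by simp
      ultimately show ?thesis by (simp add: q_def norm_divide norm_mult pos_divide_le_eq)
    qed
  qed simp
  moreover have "0 < norm (u z) * norm (D z)"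
  proof -
    have "z \<noteq> z0" using z z0 by auto
    then show ?thesis using unz[of z] Dnz[of z] z by simp
  qed
  ultimately have "norm (s z) \<le> 2 * (norm (u z) * norm (D z))"
    by (simp add: q_def norm_divide norm_mult pos_divide_le_eq)
  also have "\<dots> \<le> 2 * (norm (u z) * (e + C * norm (u z)))"
    using De(3)[of z] z by (intro mult_left_mono) auto
  finally show ?thesis by (simp add: nu C_def mult_ac)
qed

section \<open>Fatou's theorem for bounded functions\<close>

text \<open>A primitive of a bounded function is Lipschitz on the convex disc and so extends to the
  circle; boundary behaviour of \<open>g\<close> can then be read off the boundary values of its
  primitive, which exist everywhere.\<close>

lemma lipschitz_extension_ball:
  fixes G g :: "complex \<Rightarrow> complex"
  assumes G: "\<And>z. z \<in> ball 0 1 \<Longrightarrow> (G has_field_derivative g z) (at z within ball 0 1)"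
    and M: "\<And>z. norm z < 1 \<Longrightarrow> norm (g z) \<le> M" and "0 \<le> M"
  obtains \<Gamma> where "M-lipschitz_on (cball 0 1) \<Gamma>" "\<And>z. z \<in> ball 0 1 \<Longrightarrow> \<Gamma> z = G z"
proof -
  have "M-lipschitz_on (ball 0 1) G"
    by (intro lipschitz_onI) (use assms in \<open>auto simp: dist_norm intro!: field_differentiable_bound[where f' = g and S = "ball 0 1"]\<close>)
  from lipschitz_extend_closure[OF this] show ?thesis using that by auto
qed

text \<open>The quotient \<open>\<zeta> / cis t\<close> is unimodular, so its logarithm is purely
  imaginary and gives the angle s; near 1 the logarithm is at most 2 |w - 1|.\<close>

lemma circle_chart:
  assumes "norm \<zeta> = 1" "norm (\<zeta> - cis t) < 1 / 2"
  obtains s where "\<zeta> = cis (t + s)" "\<bar>s\<bar> \<le> 2 * norm (\<zeta> - cis t)"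
proof -
  define w where "w = \<zeta> / cis t"
  have w: "norm w = 1" "w \<noteq> 0" using assms(1) by (auto simp: w_def norm_divide)
  have "w - 1 = (\<zeta> - cis t) / cis t" by (simp add: w_def diff_divide_distrib)
  then have nw: "norm (w - 1) = norm (\<zeta> - cis t)" by (simp add: norm_divide)
  have "norm (Ln (1 + (w - 1))) \<le> 2 * norm (w - 1)" using assms nw by (intro norm_Ln_le) simp
  then have le: "norm (Ln w) \<le> 2 * norm (\<zeta> - cis t)" using nw by simp
  have "Re (Ln w) = 0" using w by simp
  then have "Ln w = \<i> * of_real (Im (Ln w))" by (simp add: complex_eq_iff)
  then have "w = cis (Im (Ln w))" using w(2) by (metis cis_conv_exp exp_Ln)
  then have "\<zeta> = cis (t + Im (Ln w))" by (simp add: w_def cis_mult[symmetric] field_simps)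
  then show ?thesis using that abs_Im_le_cmod[of "Ln w"] le by fastforce
qed

text \<open>Dividing by the derivative i cis t of the parametrisation converts the angular
  derivative into a complex slope w; the remainder has derivative 0 at t, and
  \<open>circle_chart\<close> translates angle into chord length.\<close>

lemma circle_derivative:
  assumes t: "((\<lambda>x. \<Gamma> (cis x)) has_vector_derivative D) (at t)"
  shows "\<exists>w. \<forall>e>0. \<exists>d>0. \<forall>\<zeta>. norm \<zeta> = 1 \<longrightarrow> norm (\<zeta> - cis t) < d \<longrightarrow>
    norm (\<Gamma> \<zeta> - \<Gamma> (cis t) - w * (\<zeta> - cis t)) \<le> e * norm (\<zeta> - cis t)"
proof -
  define w where "w = D / (\<i> * cis t)"
  define \<rho> where "\<rho> = (\<lambda>x. \<Gamma> (cis x) - \<Gamma> (cis t) - w * (cis x - cis t))"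
  have "(cis has_vector_derivative (\<i> * cis t)) (at t)"
    using has_derivative_cis[OF has_derivative_ident, of t UNIV] by (simp add: has_vector_derivative_def)
  then have "((\<lambda>x. w * (cis x - cis t)) has_vector_derivative (w * (\<i> * cis t - 0))) (at t)"
    by (intro has_vector_derivative_mult_right has_vector_derivative_diff has_vector_derivative_const)
  moreover have "w * (\<i> * cis t - 0) = D" by (simp add: w_def)
  moreover have "((\<lambda>x. \<Gamma> (cis x) - \<Gamma> (cis t)) has_vector_derivative (D - 0)) (at t)"
    by (intro has_vector_derivative_diff t has_vector_derivative_const)
  ultimately have "(\<rho> has_vector_derivative (D - 0 - D)) (at t)"
    unfolding \<rho>_def by (metis has_vector_derivative_diff)
  then have der: "(\<rho> has_derivative (\<lambda>x. 0)) (at t)" by (simp add: has_vector_derivative_def)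
  have \<rho>t: "\<rho> t = 0" by (simp add: \<rho>_def)
  show ?thesis
  proof (intro exI[of _ w] allI impI)
    fix e :: real assume e: "0 < e"
    \<comment> \<open>e / 2 offsets the factor 2 between arc and chord in
      \<open>circle_chart\<close>.\<close>
    obtain d where d: "d > 0" "\<And>y. norm (y - t) < d \<Longrightarrow> norm (\<rho> y - \<rho> t - 0) \<le> e / 2 * norm (y - t)"
      using der e unfolding has_derivative_at_alt by (metis half_gt_zero)
    show "\<exists>d>0. \<forall>\<zeta>. norm \<zeta> = 1 \<longrightarrow> norm (\<zeta> - cis t) < d \<longrightarrow>
        norm (\<Gamma> \<zeta> - \<Gamma> (cis t) - w * (\<zeta> - cis t)) \<le> e * norm (\<zeta> - cis t)"
    proof (intro exI[of _ "min (1/2) (d / 2)"] conjI allI impI)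
      fix \<zeta> assume \<zeta>: "norm \<zeta> = 1" "norm (\<zeta> - cis t) < min (1/2) (d / 2)"
      obtain s where s: "\<zeta> = cis (t + s)" "\<bar>s\<bar> \<le> 2 * norm (\<zeta> - cis t)"
        using circle_chart[OF \<zeta>(1), of t] \<zeta>(2) by auto
      have "norm (\<rho> (t + s)) \<le> e / 2 * \<bar>s\<bar>" using d(2)[of "t + s"] s(2) \<zeta>(2) \<rho>t by simp
      also have "\<dots> \<le> e / 2 * (2 * norm (\<zeta> - cis t))" using s(2) e by (intro mult_left_mono) auto
      finally show "norm (\<Gamma> \<zeta> - \<Gamma> (cis t) - w * (\<zeta> - cis t)) \<le> e * norm (\<zeta> - cis t)"
        by (simp add: \<rho>_def s(1)[symmetric])
    qed (use d in auto)
  qed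
qed

text \<open>The remainder s is o(|z - z0|) on the circle, hence in the disc, and s' = g - w.
  Cauchy's inequality on a disc of radius (1 - |z|) / 2 divides by a quantity comparable to |z - z0|
  in a Stolz region, so g - w tends to 0.\<close>

lemma nontangential_limit_of_primitive:
  assumes z0: "norm z0 = 1" and \<Gamma>: "M-lipschitz_on (cball 0 1) \<Gamma>"
    and der: "\<And>z. z \<in> ball 0 1 \<Longrightarrow> (\<Gamma> has_field_derivative g z) (at z)"
    and w: "\<And>e. 0 < e \<Longrightarrow> \<exists>d>0. \<forall>\<zeta>. norm \<zeta> = 1 \<longrightarrow> norm (\<zeta> - z0) < d \<longrightarrow>
      norm (\<Gamma> \<zeta> - \<Gamma> z0 - w * (\<zeta> - z0)) \<le> e * norm (\<zeta> - z0)"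
  shows "has_nontangential_limit g w z0"
  unfolding has_nontangential_limit_def
proof (intro allI impI)
  fix \<alpha> :: real assume \<alpha>: "1 < \<alpha>"
  define s where "s = (\<lambda>z. \<Gamma> z - \<Gamma> z0 - w * (z - z0))"
  define M' where "M' = M + norm w"
  have M0: "0 \<le> M" using \<Gamma> by (rule lipschitz_on_nonneg)
  have cs: "continuous_on (cball 0 1) s"
    unfolding s_def by (intro continuous_intros lipschitz_on_continuous_on[OF \<Gamma>])
  have ds: "(s has_field_derivative (g z - w)) (at z)" if "z \<in> ball 0 1" for z
    unfolding s_def by (rule derivative_eq_intros der[OF that] refl | simp)+
  have hs: "s holomorphic_on ball 0 1"
    unfolding holomorphic_on_open[OF open_ball] using ds by blast
  have M': "norm (s z) \<le> M' * norm (z - z0)" if "norm z \<le> 1" for z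
  proof -
    have "norm (\<Gamma> z - \<Gamma> z0) \<le> M * norm (z - z0)"
      using lipschitz_onD[OF \<Gamma>, of z z0] that z0 by (simp add: dist_norm)
    moreover have "norm (s z) \<le> norm (\<Gamma> z - \<Gamma> z0) + norm (w * (z - z0))"
      unfolding s_def by (rule norm_triangle_ineq4)
    ultimately show ?thesis unfolding M'_def distrib_right norm_mult by linarith
  qed
  show "(g \<longlongrightarrow> w) (at z0 within stolz_region \<alpha> z0)"
  proof (rule tendstoI)
    fix \<eta> :: real assume \<eta>: "0 < \<eta>"
    \<comment> \<open>Chosen so that the final estimate 8 (2 \<open>\<alpha>\<close> r) e / r = 16
      \<open>\<alpha>\<close> e equals \<open>\<eta>\<close> / 2.\<close>
    define e where "e = \<eta> / (32 * \<alpha>)"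
    have e: "0 < e" using \<eta> \<alpha> by (simp add: e_def)
    obtain d where d: "0 < d" "\<And>\<zeta>. norm \<zeta> = 1 \<Longrightarrow> norm (\<zeta> - z0) < d \<Longrightarrow> norm (s \<zeta>) \<le> e * norm (\<zeta> - z0)"
      using w[OF e] unfolding s_def by blast
    define C where "C = M' / d"
    have C: "0 \<le> C" using M0 d by (simp add: C_def M'_def)
    have le: "norm (s z) \<le> 2 * norm (z - z0) * (e + C * norm (z - z0))" if "norm z < 1" for z
      unfolding C_def by (rule little_o_on_circle_imp_disc[OF z0 cs hs M' e d that])
    \<comment> \<open>Keeps C |x - z0| \<le> 2 C \<open>\<delta>\<close> \<le> e on the Cauchy
      circle; the + 1 covers C = 0.\<close>
    define \<delta> where "\<delta> = e / (2 * C + 1)"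
    have \<delta>: "0 < \<delta>" using e C by (simp add: \<delta>_def)
    have "dist (g z) w < \<eta>" if z: "z \<in> stolz_region \<alpha> z0" "norm (z - z0) < \<delta>" for z
    proof -
      have z1: "norm z < 1" "norm (z - z0) < \<alpha> * (1 - norm z)"
        using z(1) by (auto simp: stolz_region_def norm_minus_commute)
      define r where "r = (1 - norm z) / 2"
      have r: "0 < r" using z1 by (simp add: r_def)
      have rz: "2 * r \<le> norm (z - z0)"
        using norm_triangle_ineq2[of z0 z] z0 by (simp add: r_def norm_minus_commute)
      have sub: "cball z r \<subseteq> ball 0 1"
      proof
        fix x assume "x \<in> cball z r"
        then have "norm x \<le> norm z + r" using norm_triangle_ineq2[of x z] by (simp add: dist_norm norm_minus_commute)
        then show "x \<in> ball 0 1" using z1 by (simp add: r_def field_simps)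
      qed
      have bd: "norm (s x) \<le> 8 * norm (z - z0) * e" if "norm (z - x) = r" for x
      proof -
        have "x \<in> cball z r" using that by (simp add: dist_norm)
        then have x: "norm x < 1" using sub by auto
        have "norm (x - z0) \<le> norm (x - z) + norm (z - z0)" using norm_triangle_ineq[of "x - z" "z - z0"] by simp
        then have x2: "norm (x - z0) \<le> 2 * norm (z - z0)" using that rz r by (simp add: norm_minus_commute)
        have "C * norm (x - z0) \<le> C * (2 * \<delta>)" using x2 z(2) C by (intro mult_left_mono) auto
        also have "\<dots> \<le> e"
        proof -
          have "(2 * C) * \<delta> \<le> (2 * C + 1) * \<delta>" using \<delta> by (intro mult_right_mono) auto
          also have "\<dots> = e" using C by (simp add: \<delta>_def)
          finally show ?thesis by (simp add: mult_ac)
        qed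
        finally have Ce: "e + C * norm (x - z0) \<le> 2 * e" by simp
        have "norm (s x) \<le> 2 * norm (x - z0) * (e + C * norm (x - z0))" by (rule le[OF x])
        also have "\<dots> \<le> 2 * (2 * norm (z - z0)) * (2 * e)"
          using x2 Ce e C by (intro mult_mono) auto
        finally show ?thesis by simp
      qed
      have "norm ((deriv ^^ 1) s z) \<le> fact 1 * (8 * norm (z - z0) * e) / r ^ 1"
      proof (rule Cauchy_inequality[OF _ _ r bd])
        show "s holomorphic_on ball z r" using sub by (intro holomorphic_on_subset[OF hs]) (auto simp: subset_iff)
        show "continuous_on (cball z r) s" using sub by (intro continuous_on_subset[OF cs]) (auto simp: subset_iff)
      qed
      moreover have "deriv s z = g z - w" using ds[of z] z1 by (intro DERIV_imp_deriv) auto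
      ultimately have "norm (g z - w) \<le> 8 * norm (z - z0) * e / r" by simp
      also have "\<dots> \<le> 8 * (\<alpha> * (2 * r)) * e / r"
      proof -
        have "2 * r = 1 - norm z" by (simp add: r_def)
        then have "norm (z - z0) \<le> \<alpha> * (2 * r)" using z1(2) by simp
        then show ?thesis using e r by (intro divide_right_mono mult_right_mono mult_left_mono) auto
      qed
      also have "\<dots> = \<eta> / 2" using r \<alpha> by (simp add: e_def)
      also have "\<dots> < \<eta>" using \<eta> by simp
      finally show ?thesis by (simp add: dist_norm)
    qed
    then show "eventually (\<lambda>z. dist (g z) w < \<eta>) (at z0 within stolz_region \<alpha> z0)"
      unfolding eventually_at using \<delta> by (auto simp: dist_norm)
  qed
qed

text \<open>The primitive restricted to the circle is a Lipschitz function of the angle; where its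
  real and imaginary parts are both differentiable, \<open>nontangential_limit_of_primitive\<close>
  applies.\<close>

theorem fatou_bounded:
  assumes g: "g holomorphic_on ball 0 1" and M: "\<And>z. norm z < 1 \<Longrightarrow> norm (g z) \<le> M"
  obtains N where "negligible N" "\<And>t. t \<notin> N \<Longrightarrow> \<exists>w. has_nontangential_limit g w (cis t)"
proof -
  have M0: "0 \<le> M" by (rule order_trans[OF norm_ge_zero M[of 0]]) simp
  obtain G where G: "\<And>z. z \<in> ball 0 1 \<Longrightarrow> (G has_field_derivative g z) (at z within ball 0 1)"
    using holomorphic_convex_primitive'[OF convex_ball open_ball g] by metis
  obtain \<Gamma> where \<Gamma>: "M-lipschitz_on (cball 0 1) \<Gamma>" "\<And>z. z \<in> ball 0 1 \<Longrightarrow> \<Gamma> z = G z"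
    using lipschitz_extension_ball[OF G M M0] by metis
  have der: "(\<Gamma> has_field_derivative g z) (at z)" if z: "z \<in> ball 0 1" for z
  proof -
    have "(G has_field_derivative g z) (at z)" using G[OF z] z by (simp add: at_within_open[of z "ball 0 1"])
    then show ?thesis
      by (rule has_field_derivative_transform_within_open[OF _ open_ball z]) (use \<Gamma>(2) in simp)
  qed
  have lip: "norm (\<Gamma> (cis x) - \<Gamma> (cis y)) \<le> M * \<bar>x - y\<bar>" for x y
  proof -
    have "norm (\<Gamma> (cis x) - \<Gamma> (cis y)) \<le> M * norm (cis x - cis y)"
      using lipschitz_onD[OF \<Gamma>(1), of "cis x" "cis y"] by (simp add: dist_norm)
    also have "\<dots> \<le> M * \<bar>x - y\<bar>" using M0 norm_cis_diff_le by (intro mult_left_mono)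
    finally show ?thesis .
  qed
  have lipR: "\<bar>Re (\<Gamma> (cis x)) - Re (\<Gamma> (cis y))\<bar> \<le> M * \<bar>x - y\<bar>" for x y
    using abs_Re_le_cmod[of "\<Gamma> (cis x) - \<Gamma> (cis y)"] lip[of x y] by simp
  have lipI: "\<bar>Im (\<Gamma> (cis x)) - Im (\<Gamma> (cis y))\<bar> \<le> M * \<bar>x - y\<bar>" for x y
    using abs_Im_le_cmod[of "\<Gamma> (cis x) - \<Gamma> (cis y)"] lip[of x y] by simp
  obtain N1 where N1: "negligible N1" "\<And>x. x \<notin> N1 \<Longrightarrow> \<exists>D. ((\<lambda>x. Re (\<Gamma> (cis x))) has_real_derivative D) (at x)"
    using lipschitz_ae_differentiable[of "\<lambda>x. Re (\<Gamma> (cis x))" M, OF lipR] by metis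
  obtain N2 where N2: "negligible N2" "\<And>x. x \<notin> N2 \<Longrightarrow> \<exists>D. ((\<lambda>x. Im (\<Gamma> (cis x))) has_real_derivative D) (at x)"
    using lipschitz_ae_differentiable[of "\<lambda>x. Im (\<Gamma> (cis x))" M, OF lipI] by metis
  have N: "negligible (N1 \<union> N2)" using N1 N2 by (intro negligible_Un)
  show ?thesis
  proof (rule that[OF N])
    fix t assume t: "t \<notin> N1 \<union> N2"
    then obtain D1 D2 where D: "((\<lambda>x. Re (\<Gamma> (cis x))) has_real_derivative D1) (at t)"
      "((\<lambda>x. Im (\<Gamma> (cis x))) has_real_derivative D2) (at t)" using N1(2)[of t] N2(2)[of t] by auto
    have "((\<lambda>x. \<Gamma> (cis x)) has_vector_derivative (Complex D1 D2)) (at t)"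
      unfolding has_vector_derivative_complex_iff using D
      by (simp add: has_real_derivative_iff_has_vector_derivative)
    from circle_derivative[OF this] obtain w where "\<forall>e>0. \<exists>d>0. \<forall>\<zeta>. norm \<zeta> = 1 \<longrightarrow> norm (\<zeta> - cis t) < d \<longrightarrow>
      norm (\<Gamma> \<zeta> - \<Gamma> (cis t) - w * (\<zeta> - cis t)) \<le> e * norm (\<zeta> - cis t)" ..
    then have "has_nontangential_limit g w (cis t)"
      by (intro nontangential_limit_of_primitive[OF _ \<Gamma>(1) der]) auto
    then show "\<exists>w. has_nontangential_limit g w (cis t)" ..
  qed
qed

section \<open>Boundary values in the Nevanlinna class\<close>

text \<open>Realises Poisson integrals as real parts of holomorphic functions, to which Montel's
  theorem applies when harmonic majorants are passed to a limit.\<close>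

definition schwarz_integral :: "(complex \<Rightarrow> real) \<Rightarrow> complex \<Rightarrow> complex" where
  "schwarz_integral u z = integral {0..2*pi} (\<lambda>t. (cis t + z) / (cis t - z) * of_real (u (cis t))) / of_real (2*pi)"

lemma cis_neq_of_norm_less_1: "norm z < 1 \<Longrightarrow> cis t \<noteq> z"
  by auto

lemma schwarz_integrand_continuous:
  assumes "continuous_on (sphere 0 1) u" "norm z < 1"
  shows "continuous_on A (\<lambda>t. (cis t + z) / (cis t - z) * of_real (u (cis t)))"
  using assms cis_neq_of_norm_less_1[of z]
  by (intro continuous_intros continuous_on_of_real continuous_on_cis_compose) auto

lemma holomorphic_schwarz_integral:
  assumes u: "continuous_on (sphere 0 1) u"
  shows "schwarz_integral u holomorphic_on ball 0 1"
proof -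
  have "(\<lambda>z. integral (cbox 0 (2*pi)) (\<lambda>t. (cis t + z) / (cis t - z) * of_real (u (cis t)))) holomorphic_on ball 0 1"
  proof (rule leibniz_rule_holomorphic)
    fix z t assume z: "z \<in> ball (0::complex) 1"
    have ne: "cis t - z \<noteq> 0" using z cis_neq_of_norm_less_1[of z t] by auto
    have "((\<lambda>z. (cis t + z) / (cis t - z)) has_field_derivative
        ((0 + 1) * (cis t - z) - (cis t + z) * (0 - 1)) / ((cis t - z) * (cis t - z))) (at z within ball 0 1)"
      by (intro DERIV_divide DERIV_add DERIV_diff DERIV_const DERIV_ident ne)
    from DERIV_cmult_right[OF this, of "of_real (u (cis t))"]
    show "((\<lambda>z. (cis t + z) / (cis t - z) * of_real (u (cis t))) has_field_derivative
        2 * cis t / (cis t - z)^2 * of_real (u (cis t))) (at z within ball 0 1)"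
      by (simp add: power2_eq_square algebra_simps)
  next
    fix z assume "z \<in> ball (0::complex) 1"
    then show "(\<lambda>t. (cis t + z) / (cis t - z) * of_real (u (cis t))) integrable_on cbox 0 (2*pi)"
      unfolding cbox_interval by (intro integrable_continuous_interval schwarz_integrand_continuous u) auto
  next
    have "continuous_on (ball 0 1 \<times> cbox 0 (2*pi)) (\<lambda>p. u (cis (snd p)))"
      by (rule continuous_on_compose2[OF u]) (auto intro!: continuous_intros)
    then show "continuous_on (ball 0 1 \<times> cbox 0 (2*pi)) (\<lambda>(z, t). 2 * cis t / (cis t - z)^2 * complex_of_real (u (cis t)))"
      unfolding case_prod_unfold using cis_neq_of_norm_less_1
      by (intro continuous_intros continuous_on_of_real) auto
  qed simp
  then show ?thesis unfolding schwarz_integral_def cbox_interval by (intro holomorphic_intros) auto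
qed

lemma Re_schwarz_kernel:
  assumes "norm c = 1" "c \<noteq> z"
  shows "Re ((c + z) / (c - z)) = poisson_kernel z c"
proof -
  have "(Re c)\<^sup>2 + (Im c)\<^sup>2 = 1" using assms(1) by (metis cmod_power2 one_power2)
  then have "(Re c + Re z) * (Re c - Re z) + (Im c + Im z) * (Im c - Im z) = 1 - (norm z)\<^sup>2"
    unfolding cmod_power2 by (simp add: power2_eq_square algebra_simps)
  then show ?thesis unfolding poisson_kernel_def Re_divide cmod_power2 by simp
qed

lemma Re_schwarz_integral:
  assumes u: "continuous_on (sphere 0 1) u" and z: "norm z < 1"
  shows "Re (schwarz_integral u z) = poisson_integral u z"
proof -
  let ?k = "\<lambda>t. (cis t + z) / (cis t - z) * of_real (u (cis t))"
  have "?k integrable_on {0..2*pi}"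
    by (intro integrable_continuous_interval schwarz_integrand_continuous assms)
  then have "((\<lambda>t. Re (?k t)) has_integral Re (integral {0..2*pi} ?k)) {0..2*pi}"
    by (intro has_integral_Re integrable_integral)
  moreover have "Re (?k t) = poisson_kernel z (cis t) * u (cis t)" for t
  proof -
    have "Re (?k t) = Re ((cis t + z) / (cis t - z)) * u (cis t)"
      by (simp only: times_complex.sel Re_complex_of_real Im_complex_of_real mult_zero_right diff_zero)
    then show ?thesis using Re_schwarz_kernel[of "cis t" z] cis_neq_of_norm_less_1[OF z, of t] by simp
  qed
  ultimately have "integral {0..2*pi} (\<lambda>t. poisson_kernel z (cis t) * u (cis t)) = Re (integral {0..2*pi} ?k)"
    by (intro integral_unique) simp
  then show ?thesis by (simp add: schwarz_integral_def poisson_integral_def Re_divide_of_real del: of_real_mult)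
qed

text \<open>Apart from z the bound involves the mean of \<open>u\<close> alone, which makes the
  family in \<open>nevanlinna_class_majorant\<close> locally bounded.\<close>

lemma norm_schwarz_integral_le:
  assumes u: "continuous_on (sphere 0 1) u" "\<And>x. norm x = 1 \<Longrightarrow> 0 \<le> u x" and z: "norm z < 1"
  shows "norm (schwarz_integral u z) \<le> 2 / (1 - norm z) * poisson_integral u 0"
proof -
  let ?k = "\<lambda>t. (cis t + z) / (cis t - z) * of_real (u (cis t))"
  have "norm (integral {0..2*pi} ?k) \<le> integral {0..2*pi} (\<lambda>t. 2 / (1 - norm z) * u (cis t))"
  proof (rule integral_norm_bound_integral)
    show "?k integrable_on {0..2*pi}"
      by (intro integrable_continuous_interval schwarz_integrand_continuous assms)
    show "(\<lambda>t. 2 / (1 - norm z) * u (cis t)) integrable_on {0..2*pi}"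
      by (intro integrable_continuous_interval continuous_intros continuous_on_cis_compose u) (use z in auto)
    fix t
    have "norm (cis t + z) \<le> 2" using norm_triangle_ineq[of "cis t" z] z by simp
    moreover have "1 - norm z \<le> norm (cis t - z)" using norm_triangle_ineq2[of "cis t" z] by simp
    ultimately have "norm ((cis t + z) / (cis t - z)) \<le> 2 / (1 - norm z)"
      unfolding norm_divide using z by (intro frac_le) auto
    then show "norm (?k t) \<le> 2 / (1 - norm z) * u (cis t)"
      unfolding norm_mult using u(2)[of "cis t"] z by (intro mult_mono) auto
  qed
  then have "norm (integral {0..2*pi} ?k) / (2*pi) \<le> (2 / (1 - norm z) * integral {0..2*pi} (\<lambda>t. u (cis t))) / (2*pi)"
    by (intro divide_right_mono) auto
  then show ?thesis by (simp add: schwarz_integral_def poisson_integral_0 norm_divide)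
qed

text \<open>One fixed sequence, so that Fatou's lemma applies to radial limits; the shift by 2 keeps
  the first radius positive.\<close>

definition radius :: "nat \<Rightarrow> real" where
  "radius n = 1 - 1 / real (n + 2)"

lemma radius_bounds: "0 < radius n" "radius n < 1"
  by (auto simp: radius_def field_simps)

lemma radius_tendsto: "radius \<longlonglongrightarrow> 1"
proof -
  have "(\<lambda>n. 1 - 1 / real (n + 2)) \<longlonglongrightarrow> 1 - 0"
    by (intro tendsto_diff tendsto_const LIMSEQ_ignore_initial_segment lim_1_over_n)
  then show ?thesis by (simp add: radius_def[abs_def])
qed

lemma radius_mult_tendsto:
  fixes f :: "complex \<Rightarrow> 'a::topological_space"
  assumes "isCont f z"
  shows "(\<lambda>n. f (of_real (radius n) * z)) \<longlonglongrightarrow> f z"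
proof (rule isCont_tendsto_compose[OF assms])
  have "(\<lambda>n. of_real (radius n) * z) \<longlonglongrightarrow> of_real 1 * z"
    by (intro tendsto_mult tendsto_of_real radius_tendsto tendsto_const)
  then show "(\<lambda>n. of_real (radius n) * z) \<longlonglongrightarrow> z" by simp
qed

lemma tendsto_log_plus: "(f \<longlongrightarrow> a) F \<Longrightarrow> ((\<lambda>x. log_plus (f x)) \<longlongrightarrow> log_plus a) F"
  unfolding log_plus_eq by (intro tendsto_ln tendsto_intros) auto

text \<open>Poisson integrals of log^+ |f| over growing circles majorise log^+ of the dilates and
  have bounded means; Montel gives a limit, and the pointwise inequality survives.\<close>

lemma nevanlinna_class_majorant:
  assumes "f \<in> nevanlinna_class"
  obtains U where "U holomorphic_on ball 0 1" "\<And>z. norm z < 1 \<Longrightarrow> log_plus (norm (f z)) \<le> Re (U z)"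
proof -
  obtain C where C: "0 \<le> C" "f holomorphic_on ball 0 1"
    "\<And>r. 0 < r \<Longrightarrow> r < 1 \<Longrightarrow> poisson_integral (\<lambda>x. log_plus (norm (dilate f r x))) 0 \<le> C"
    using nevanlinna_classD[OF assms] by metis
  have cf: "continuous_on (ball 0 1) f" using C by (intro holomorphic_on_imp_continuous_on)
  define u where "u = (\<lambda>n x. log_plus (norm (dilate f (radius n) x)))"
  have cu: "continuous_on (sphere 0 1) (u n)" for n
    unfolding u_def using radius_bounds[of n] by (intro continuous_on_log_plus_dilate cf) auto
  define H where "H = {h. h holomorphic_on ball 0 1 \<and> (\<forall>z\<in>ball 0 1. norm (h z) \<le> 2 / (1 - norm z) * C)}"
  have inH: "schwarz_integral (u n) \<in> H" for n
  proof -
    have "norm (schwarz_integral (u n) z) \<le> 2 / (1 - norm z) * C" if "norm z < 1" for z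
    proof -
      have "norm (schwarz_integral (u n) z) \<le> 2 / (1 - norm z) * poisson_integral (u n) 0"
        by (rule norm_schwarz_integral_le[OF cu _ that]) (simp add: u_def)
      also have "\<dots> \<le> 2 / (1 - norm z) * C"
        using C(3)[of "radius n"] radius_bounds[of n] that unfolding u_def by (intro mult_left_mono) auto
      finally show ?thesis .
    qed
    then show ?thesis using holomorphic_schwarz_integral[OF cu] by (simp add: H_def)
  qed
  obtain U r where U: "U holomorphic_on ball 0 1" "strict_mono (r :: nat \<Rightarrow> nat)"
    "\<And>x. x \<in> ball 0 1 \<Longrightarrow> ((\<lambda>n. schwarz_integral (u (r n)) x) \<longlongrightarrow> U x) sequentially"
  proof (rule Montel[of "ball 0 1" H "\<lambda>n. schwarz_integral (u n)"])
    show "range (\<lambda>n. schwarz_integral (u n)) \<subseteq> H" using inH by blast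
    show "\<exists>B. \<forall>h\<in>H. \<forall>z\<in>K. norm (h z) \<le> B" if K: "compact K" "K \<subseteq> ball 0 1" for K
    proof (cases "K = {}")
      case False
      then obtain x where x: "x \<in> K" "\<And>y. y \<in> K \<Longrightarrow> norm y \<le> norm x"
        using continuous_attains_sup[OF K(1) False, of norm] continuous_on_norm_id by blast
      have "norm (h z) \<le> 2 / (1 - norm x) * C" if "h \<in> H" "z \<in> K" for h z
      proof -
        have "norm (h z) \<le> 2 / (1 - norm z) * C" using that K(2) by (auto simp: H_def)
        also have "\<dots> \<le> 2 / (1 - norm x) * C"
          using x(2)[OF that(2)] x(1) K(2) C(1) by (intro mult_right_mono divide_left_mono mult_pos_pos) (auto simp: subset_iff)
        finally show ?thesis .
      qed
      then show ?thesis by blast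
    qed simp
  qed (auto simp: H_def)
  show ?thesis
  proof (rule that[OF U(1)])
    fix z :: complex assume z: "norm z < 1"
    have rr: "filterlim r at_top sequentially" by (rule filterlim_subseq[OF U(2)])
    have "isCont f z" using cf z by (simp add: continuous_on_eq_continuous_at)
    then have "(\<lambda>n. f (of_real (radius n) * z)) \<longlonglongrightarrow> f z" by (rule radius_mult_tendsto)
    then have "(\<lambda>n. log_plus (norm (f (of_real (radius n) * z)))) \<longlonglongrightarrow> log_plus (norm (f z))"
      by (intro tendsto_log_plus tendsto_norm)
    then have 1: "(\<lambda>n. log_plus (norm (f (of_real (radius (r n)) * z)))) \<longlonglongrightarrow> log_plus (norm (f z))"
      by (rule filterlim_compose[OF _ rr])
    have 2: "(\<lambda>n. Re (schwarz_integral (u (r n)) z)) \<longlonglongrightarrow> Re (U z)"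
      using z by (intro tendsto_Re U(3)) simp
    show "log_plus (norm (f z)) \<le> Re (U z)"
    proof (rule LIMSEQ_le[OF 1 2], intro exI allI impI)
      fix n
      have "1 < 1 / radius (r n)" using radius_bounds[of "r n"] by simp
      from log_plus_le_poisson[OF holomorphic_dilate[OF C(2) radius_bounds(1)] this z]
      show "log_plus (norm (f (of_real (radius (r n)) * z))) \<le> Re (schwarz_integral (u (r n)) z)"
        unfolding Re_schwarz_integral[OF cu z] by (simp add: u_def dilate_def)
    qed
  qed
qed

lemma radius_in_stolz:
  assumes "norm \<zeta> = 1"
  shows "filterlim (\<lambda>n. of_real (radius n) * \<zeta>) (at \<zeta> within stolz_region 2 \<zeta>) sequentially"
  unfolding filterlim_at
proof
  show "\<forall>\<^sub>F n in sequentially. of_real (radius n) * \<zeta> \<in> stolz_region 2 \<zeta> \<and> of_real (radius n) * \<zeta> \<noteq> \<zeta>"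
  proof (intro always_eventually allI)
    fix n
    have r: "0 < radius n" "radius n < 1" by (rule radius_bounds)+
    have "\<zeta> - of_real (radius n) * \<zeta> = of_real (1 - radius n) * \<zeta>" by (simp add: algebra_simps)
    then have "norm (\<zeta> - of_real (radius n) * \<zeta>) = 1 - radius n"
      using r assms by (simp only: norm_mult norm_of_real) simp
    moreover have "norm (of_real (radius n) * \<zeta>) = radius n" using r assms by (simp add: norm_mult)
    ultimately show "of_real (radius n) * \<zeta> \<in> stolz_region 2 \<zeta> \<and> of_real (radius n) * \<zeta> \<noteq> \<zeta>"
      using r unfolding stolz_region_def by auto
  qed
  show "(\<lambda>n. of_real (radius n) * \<zeta>) \<longlonglongrightarrow> \<zeta>"
    using radius_mult_tendsto[where f = "\<lambda>z. z" and z = \<zeta>] by simp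
qed

lemma nontangential_limit_radial:
  assumes "has_nontangential_limit f w \<zeta>" "norm \<zeta> = 1"
  shows "(\<lambda>n. f (of_real (radius n) * \<zeta>)) \<longlonglongrightarrow> w"
proof -
  have "(f \<longlongrightarrow> w) (at \<zeta> within stolz_region 2 \<zeta>)" using assms by (simp add: has_nontangential_limit_def)
  then show ?thesis by (rule filterlim_compose[OF _ radius_in_stolz[OF assms(2)]])
qed

text \<open>Two nontangential limits coincide along the radius, which stays in a Stolz region; so
  the description \<open>THE w\<close> is determined.\<close>

lemma boundary_value_eq:
  assumes "has_nontangential_limit f w \<zeta>" "norm \<zeta> = 1"
  shows "boundary_value f \<zeta> = w"
  unfolding boundary_value_def
proof (rule the_equality)
  show "has_nontangential_limit f w \<zeta>" by fact
  fix v assume "has_nontangential_limit f v \<zeta>"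
  from nontangential_limit_radial[OF this assms(2)] nontangential_limit_radial[OF assms]
  show "v = w" by (rule LIMSEQ_unique)
qed

lemma nn_integral_circle:
  assumes "continuous_on (sphere 0 1) u" "\<And>x. norm x = 1 \<Longrightarrow> 0 \<le> u x"
  shows "(\<integral>\<^sup>+t. ennreal (u (cis t)) \<partial>restrict_space lebesgue {0..2*pi}) = ennreal (2 * pi * poisson_integral u 0)"
proof -
  have "((\<lambda>t. u (cis t)) has_integral integral {0..2*pi} (\<lambda>t. u (cis t))) {0..2*pi}"
    using assms by (intro integrable_integral integrable_continuous_interval continuous_on_cis_compose)
  then have "(\<integral>\<^sup>+t. ennreal (u (cis t)) * indicator {0..2*pi} t \<partial>lborel) = ennreal (integral {0..2*pi} (\<lambda>t. u (cis t)))"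
    using assms by (intro nn_integral_has_integral_lebesgue') auto
  then show ?thesis
    by (simp add: nn_integral_restrict_space nn_integral_completion poisson_integral_0)
qed

lemma measurable_circle:
  assumes "continuous_on (sphere 0 1) u"
  shows "(\<lambda>t. u (cis t)) \<in> borel_measurable (restrict_space lebesgue {0..2*pi})"
proof -
  have "(\<lambda>t. u (cis t)) \<in> borel_measurable borel"
    by (intro borel_measurable_continuous_onI continuous_on_cis_compose assms)
  then have "(\<lambda>t. u (cis t)) \<in> borel_measurable lebesgue" by (simp add: measurable_completion)
  then show ?thesis by (rule measurable_restrict_space1)
qed

lemma continuous_on_Re_dilate:
  assumes "U holomorphic_on ball 0 1" "0 \<le> r" "r < 1"
  shows "continuous_on (sphere 0 1) (\<lambda>x. Re (dilate U r x))"
  by (intro continuous_intros continuous_on_subset[OF continuous_on_dilate[OF holomorphic_on_imp_continuous_on[OF assms(1)] assms(2,3)]]) auto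

lemma mean_Re_dilate:
  assumes "U holomorphic_on ball 0 1" "0 < r" "r < 1"
  shows "poisson_integral (\<lambda>x. Re (dilate U r x)) 0 = Re (U 0)"
  using poisson_integral_Re[OF holomorphic_dilate[OF assms(1,2)], of 0] assms by (simp add: dilate_def)

text \<open>The means of Re U over all circles equal Re U(0), so by Fatou's lemma the lower radial
  limit has finite integral, hence is finite almost everywhere.\<close>

lemma AE_liminf_Re_finite:
  assumes U: "U holomorphic_on ball 0 1" "\<And>z. norm z < 1 \<Longrightarrow> 0 \<le> Re (U z)"
  shows "AE t in restrict_space lebesgue {0..2*pi}. liminf (\<lambda>n. ennreal (Re (U (of_real (radius n) * cis t)))) \<noteq> \<infinity>"
proof (rule nn_integral_PInf_AE)
  let ?M = "restrict_space lebesgue {0..2*pi}"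
  define v where "v = (\<lambda>n t. ennreal (Re (U (of_real (radius n) * cis t))))"
  have vm: "v n \<in> borel_measurable ?M" for n
    using measurable_circle[OF continuous_on_Re_dilate[OF U(1), of "radius n"]] radius_bounds[of n]
    unfolding v_def dilate_def by auto
  then show "(\<lambda>t. liminf (\<lambda>n. ennreal (Re (U (of_real (radius n) * cis t))))) \<in> borel_measurable ?M"
    unfolding v_def by measurable
  have "(\<integral>\<^sup>+t. liminf (\<lambda>n. v n t) \<partial>?M) \<le> liminf (\<lambda>n. \<integral>\<^sup>+t. v n t \<partial>?M)"
    by (rule nn_integral_liminf[OF vm])
  also have "(\<lambda>n. \<integral>\<^sup>+t. v n t \<partial>?M) = (\<lambda>n. ennreal (2 * pi * Re (U 0)))"
  proof
    fix n
    have "0 \<le> Re (dilate U (radius n) x)" if "norm x = 1" for x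
      unfolding dilate_def using U(2) radius_bounds[of n] that by (simp add: norm_mult)
    then have "(\<integral>\<^sup>+t. ennreal (Re (dilate U (radius n) (cis t))) \<partial>?M) = ennreal (2 * pi * Re (U 0))"
      using nn_integral_circle[OF continuous_on_Re_dilate[OF U(1), of "radius n"]] radius_bounds[of n]
        mean_Re_dilate[OF U(1), of "radius n"] by simp
    then show "(\<integral>\<^sup>+t. v n t \<partial>?M) = ennreal (2 * pi * Re (U 0))" by (simp add: v_def dilate_def)
  qed
  also have "liminf (\<lambda>n. ennreal (2 * pi * Re (U 0))) < \<infinity>" by (simp add: Liminf_const)
  finally show "(\<integral>\<^sup>+t. liminf (\<lambda>n. ennreal (Re (U (of_real (radius n) * cis t)))) \<partial>?M) \<noteq> \<infinity>"
    by (simp add: v_def)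
qed

lemma AE_restrict_of_negligible:
  assumes "negligible N" "\<And>t. t \<notin> N \<Longrightarrow> P t"
  shows "AE t in restrict_space lebesgue {0..2*pi}. P t"
proof -
  have "AE t in lebesgue. t \<notin> N" using assms(1) by (intro AE_not_in) (simp add: negligible_iff_null_sets)
  then have "AE t in lebesgue. t \<in> {0..2*pi} \<longrightarrow> P t" by eventually_elim (use assms(2) in auto)
  then show ?thesis by (simp add: AE_restrict_space_iff)
qed

text \<open>If \<open>U\<close> is holomorphic with \<open>log\<^sup>+ |f| \<le> Re U\<close>, then \<open>f\<close> is the quotient of the bounded
  functions \<open>f exp (-U)\<close> and \<open>exp (-U)\<close>; the boundary values of the latter are nonzero almost
  everywhere because the means of \<open>Re U\<close> are constant.\<close>

theorem fatou_nevanlinna: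
  assumes "f \<in> nevanlinna_class"
  shows "AE t in restrict_space lebesgue {0..2*pi}. has_nontangential_limit f (boundary_value f (cis t)) (cis t)"
proof -
  obtain U where U: "U holomorphic_on ball 0 1" "\<And>z. norm z < 1 \<Longrightarrow> log_plus (norm (f z)) \<le> Re (U z)"
    using nevanlinna_class_majorant[OF assms] by metis
  have f: "f holomorphic_on ball 0 1" using assms by (simp add: nevanlinna_class_def)
  have U0: "0 \<le> Re (U z)" if "norm z < 1" for z using U(2)[OF that] log_plus_nonneg[of "norm (f z)"] by linarith
  define k1 where "k1 = (\<lambda>z. f z * exp (- U z))"
  define k2 where "k2 = (\<lambda>z. exp (- U z))"
  have k1: "k1 holomorphic_on ball 0 1" and k2: "k2 holomorphic_on ball 0 1"
    unfolding k1_def k2_def by (intro holomorphic_intros f U)+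
  have b1: "norm (k1 z) \<le> 1" if "norm z < 1" for z
  proof (cases "f z = 0")
    case False
    have "ln (norm (f z)) \<le> Re (U z)" using U(2)[OF that] ln_le_log_plus order_trans by blast
    then have "norm (f z) \<le> exp (Re (U z))" using False by (metis exp_le_cancel_iff exp_ln zero_less_norm_iff)
    then have "norm (f z) * exp (- Re (U z)) \<le> exp (Re (U z)) * exp (- Re (U z))" by (intro mult_right_mono) auto
    also have "\<dots> = 1" by (simp add: exp_minus)
    also have "norm (f z) * exp (- Re (U z)) = norm (k1 z)"
      by (simp only: k1_def norm_mult norm_exp_eq_Re uminus_complex.sel)
    finally show ?thesis .
  qed (simp add: k1_def)
  have b2: "norm (k2 z) \<le> 1" if "norm z < 1" for z using U0[OF that] by (simp add: k2_def)
  obtain N1 where N1: "negligible N1" "\<And>t. t \<notin> N1 \<Longrightarrow> \<exists>w. has_nontangential_limit k1 w (cis t)"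
    using fatou_bounded[OF k1 b1] by metis
  obtain N2 where N2: "negligible N2" "\<And>t. t \<notin> N2 \<Longrightarrow> \<exists>w. has_nontangential_limit k2 w (cis t)"
    using fatou_bounded[OF k2 b2] by metis
  have "AE t in restrict_space lebesgue {0..2*pi}. \<exists>w. has_nontangential_limit k1 w (cis t)"
    by (rule AE_restrict_of_negligible[OF N1(1)]) (rule N1(2))
  moreover have "AE t in restrict_space lebesgue {0..2*pi}. \<exists>w. has_nontangential_limit k2 w (cis t)"
    by (rule AE_restrict_of_negligible[OF N2(1)]) (rule N2(2))
  moreover have "AE t in restrict_space lebesgue {0..2*pi}.
      liminf (\<lambda>n. ennreal (Re (U (of_real (radius n) * cis t)))) \<noteq> \<infinity>"
    by (rule AE_liminf_Re_finite[OF U(1) U0])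
  ultimately show ?thesis
  proof eventually_elim
    case (elim t)
    then obtain w1 w2 where w: "has_nontangential_limit k1 w1 (cis t)" "has_nontangential_limit k2 w2 (cis t)" by blast
    \<comment> \<open>Otherwise Re U would tend to infinity along the radius, contrary to the finite
      lower limit.\<close>
    have "w2 \<noteq> 0"
    proof
      assume "w2 = 0"
      then have "(\<lambda>n. k2 (of_real (radius n) * cis t)) \<longlonglongrightarrow> 0"
        using nontangential_limit_radial[OF w(2)] by simp
      then have "(\<lambda>n. norm (k2 (of_real (radius n) * cis t))) \<longlonglongrightarrow> 0" by (rule tendsto_norm_zero)
      then have "(\<lambda>n. exp (- Re (U (of_real (radius n) * cis t)))) \<longlonglongrightarrow> 0" by (simp add: k2_def)
      then have lim: "filterlim (\<lambda>n. Re (U (of_real (radius n) * cis t))) at_top sequentially"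
        unfolding filterlim_at_top_dense
      proof (intro allI)
        fix Z assume "(\<lambda>n. exp (- Re (U (of_real (radius n) * cis t)))) \<longlonglongrightarrow> 0"
        then have "\<forall>\<^sub>F n in sequentially. exp (- Re (U (of_real (radius n) * cis t))) < exp (- Z)"
          by (rule order_tendstoD(2)) simp
        then show "\<forall>\<^sub>F n in sequentially. Z < Re (U (of_real (radius n) * cis t))" by eventually_elim simp
      qed
      have "(\<lambda>n. ennreal (Re (U (of_real (radius n) * cis t)))) \<longlonglongrightarrow> \<infinity>"
        using lim by (simp add: ennreal_tendsto_top_eq_at_top)
      then have "liminf (\<lambda>n. ennreal (Re (U (of_real (radius n) * cis t)))) = \<infinity>"
        by (intro lim_imp_Liminf) auto
      then show False using elim(3) by simp
    qed
    have "has_nontangential_limit f (w1 / w2) (cis t)"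
      unfolding has_nontangential_limit_def
    proof (intro allI impI)
      fix \<alpha> :: real assume "1 < \<alpha>"
      then have "((\<lambda>z. k1 z / k2 z) \<longlongrightarrow> w1 / w2) (at (cis t) within stolz_region \<alpha> (cis t))"
        using w \<open>w2 \<noteq> 0\<close> unfolding has_nontangential_limit_def by (intro tendsto_divide) auto
      moreover have "(\<lambda>z. k1 z / k2 z) = f" by (auto simp: k1_def k2_def)
      ultimately show "(f \<longlongrightarrow> w1 / w2) (at (cis t) within stolz_region \<alpha> (cis t))" by simp
    qed
    then show ?case using boundary_value_eq[of f "w1 / w2" "cis t"] by simp
  qed
qed

lemma AE_log_plus_radial:
  assumes "f \<in> nevanlinna_class"
  shows "AE t in restrict_space lebesgue {0..2*pi}.
    (\<lambda>n. log_plus (norm (dilate f (radius n) (cis t)))) \<longlonglongrightarrow> log_plus (norm (boundary_value f (cis t)))"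
  using fatou_nevanlinna[OF assms]
proof eventually_elim
  case (elim t)
  then have "(\<lambda>n. f (of_real (radius n) * cis t)) \<longlonglongrightarrow> boundary_value f (cis t)"
    by (rule nontangential_limit_radial) simp
  then show ?case unfolding dilate_def by (intro tendsto_log_plus tendsto_norm)
qed

lemma poisson_integral_add:
  assumes "continuous_on (sphere 0 1) u" "continuous_on (sphere 0 1) v" "norm z < 1"
  shows "poisson_integral (\<lambda>x. u x + v x) z = poisson_integral u z + poisson_integral v z"
proof -
  have "integral {0..2*pi} (\<lambda>t. poisson_kernel z (cis t) * u (cis t) + poisson_kernel z (cis t) * v (cis t))
      = integral {0..2*pi} (\<lambda>t. poisson_kernel z (cis t) * u (cis t)) + integral {0..2*pi} (\<lambda>t. poisson_kernel z (cis t) * v (cis t))"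
    by (rule Henstock_Kurzweil_Integration.integral_add) (intro poisson_integrable assms)+
  then show ?thesis by (simp add: poisson_integral_def distrib_left add_divide_distrib)
qed

section \<open>The Smirnov class\<close>

lemma smirnov_subset_nevanlinna: "smirnov_class \<subseteq> nevanlinna_class"
  by (auto simp: smirnov_class_def)

text \<open>The starting function whose trace is multiplied by 0-1 patterns; by inclusion it serves
  both classes.\<close>

lemma one_in_smirnov: "(\<lambda>_. 1) \<in> smirnov_class"
proof -
  have l1: "log_plus 1 = 0" by (simp add: log_plus_def)
  have "(\<lambda>_. 1) \<in> nevanlinna_class"
    by (rule nevanlinna_classI[where C = 0]) (auto simp: dilate_def l1 poisson_integral_def)
  moreover have "boundary_value (\<lambda>_. 1) (cis t) = 1" for t
    by (rule boundary_value_eq) (auto simp: has_nontangential_limit_def)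
  moreover have "log_plus_mean (\<lambda>_. 1) = (\<lambda>r. circle_mean (\<lambda>\<theta>. 0))"
    by (rule ext) (simp add: log_plus_mean_def l1)
  ultimately show ?thesis
    by (simp add: smirnov_class_def l1)
qed

lemma circle_mean_eq_restrict:
  "circle_mean u = (\<integral>\<^sup>+t. ennreal (u t) \<partial>restrict_space lebesgue {0..2*pi}) / ennreal (2*pi)"
  by (simp add: circle_mean_def nn_integral_restrict_space)

lemma ennreal_mult_divide_cancel: "0 < c \<Longrightarrow> ennreal c * (x / ennreal c) = x"
  by (subst ennreal_times_divide, subst mult.commute, rule mult_divide_eq_ennreal) auto

lemma log_plus_mean_radius_tendsto:
  assumes "(log_plus_mean f \<longlongrightarrow> L) (at_left 1)"
  shows "(\<lambda>n. log_plus_mean f (radius n)) \<longlonglongrightarrow> L"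
proof (rule filterlim_compose[OF assms])
  show "filterlim radius (at_left 1) sequentially"
    unfolding filterlim_at using radius_tendsto radius_bounds by (auto intro!: always_eventually simp: less_imp_neq)
qed

text \<open>For a function of the Nevanlinna class with \<open>log\<^sup>+ |F|\<close> at most \<open>log\<^sup>+ |f| + Re G + C\<close>,
  the differences \<open>D\<^sub>n\<close> of the two sides on the circles of radius \<open>radius n\<close> are nonnegative, and
  Fatou's lemma applied to them bounds the limit of the means of \<open>log\<^sup>+ |F|\<close> from above by the
  boundary integral. Since only a lower bound of \<open>Re G\<close> by a function \<open>h\<close> continuous up to the
  circle is needed, boundary values of \<open>G\<close> do not enter.\<close>

lemma smirnov_majorant_gap:
  assumes f: "f \<in> smirnov_class" and F: "F \<in> nevanlinna_class"
    and G: "G holomorphic_on ball 0 1" and C: "0 \<le> C"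
    and le: "\<And>z. norm z < 1 \<Longrightarrow> log_plus (norm (F z)) \<le> log_plus (norm (f z)) + Re (G z) + C"
    and h: "h holomorphic_on ball 0 R" "1 < R" "\<And>z. norm z \<le> 1 \<Longrightarrow> 0 \<le> Re (h z)"
    and hG: "\<And>z. norm z < 1 \<Longrightarrow> Re (h z) \<le> Re (G z)"
    and L: "(\<lambda>n. poisson_integral (\<lambda>x. log_plus (norm (dilate F (radius n) x))) 0) \<longlonglongrightarrow> L"
    and B: "(\<integral>\<^sup>+t. ennreal (log_plus (norm (boundary_value F (cis t)))) \<partial>restrict_space lebesgue {0..2*pi}) = ennreal (2 * pi * B)" "0 \<le> B"
  shows "L \<le> B + (Re (G 0) - Re (h 0))"
proof -
  let ?M = "restrict_space lebesgue {0..2*pi}"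
  have fN: "f \<in> nevanlinna_class" using f smirnov_subset_nevanlinna by blast
  have fh: "f holomorphic_on ball 0 1" "F holomorphic_on ball 0 1" using fN F by (auto simp: nevanlinna_class_def)
  have fc: "continuous_on (ball 0 1) f" "continuous_on (ball 0 1) F" using fh by (auto intro: holomorphic_on_imp_continuous_on)
  define a where "a = (\<lambda>n x. log_plus (norm (dilate f (radius n) x)))"
  define b where "b = (\<lambda>n x. log_plus (norm (dilate F (radius n) x)))"
  define g where "g = (\<lambda>n x. Re (dilate G (radius n) x))"
  define D where "D = (\<lambda>n x. a n x + g n x + C - b n x)"
  have ca: "continuous_on (sphere 0 1) (a n)" and cb: "continuous_on (sphere 0 1) (b n)" for n
    unfolding a_def b_def using radius_bounds[of n] by (intro continuous_on_log_plus_dilate fc; simp)+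
  have cg: "continuous_on (sphere 0 1) (g n)" for n
    unfolding g_def using radius_bounds[of n] by (intro continuous_on_Re_dilate G) auto
  have cD: "continuous_on (sphere 0 1) (D n)" for n
    unfolding D_def by (intro continuous_intros ca cb cg)
  have ch: "continuous_on (sphere 0 1) (\<lambda>x. Re (h x))"
    using h(2) by (intro continuous_intros holomorphic_on_imp_continuous_on holomorphic_on_subset[OF h(1)]) auto
  have rn: "norm (of_real (radius n) * x) < 1" if "norm x = 1" for n and x :: complex
    using that radius_bounds[of n] by (simp add: norm_mult)
  have D0: "0 \<le> D n x" if "norm x = 1" for n x
    using le[OF rn[OF that], of n] by (simp add: D_def a_def b_def g_def dilate_def)
  obtain A where A: "(\<lambda>n. poisson_integral (a n) 0) \<longlonglongrightarrow> A" "0 \<le> A"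
    "(\<integral>\<^sup>+t. ennreal (log_plus (norm (boundary_value f (cis t)))) \<partial>?M) = ennreal (2 * pi * A)"
  proof -
    let ?c = "circle_mean (\<lambda>\<theta>. log_plus (norm (boundary_value f (cis \<theta>))))"
    obtain L' where L': "L' < \<infinity>" "(log_plus_mean f \<longlongrightarrow> L') (at_left 1)" using fN by (auto simp: nevanlinna_class_def)
    have lim: "(log_plus_mean f \<longlongrightarrow> ?c) (at_left 1)" using f by (simp add: smirnov_class_def)
    \<comment> \<open>Uniqueness of limits makes the boundary mean of log^+ |f| finite, so it can be
      handled as a real number A.\<close>
    have "?c = L'" by (rule tendsto_unique[OF _ lim L'(2)]) simp
    then obtain A where A: "?c = ennreal A" "0 \<le> A" using L'(1) by (cases ?c rule: ennreal_cases) auto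
    have "(\<lambda>n. ennreal (poisson_integral (a n) 0)) \<longlonglongrightarrow> ennreal A"
      using log_plus_mean_radius_tendsto[OF lim] radius_bounds log_plus_mean_eq[OF fc(1)]
      unfolding A(1) a_def by (simp add: less_imp_le)
    moreover have "0 \<le> poisson_integral (a n) 0" for n
      using ca by (intro poisson_integral_nonneg) (auto simp: a_def)
    ultimately have "(\<lambda>n. poisson_integral (a n) 0) \<longlonglongrightarrow> A"
      using A(2) by (simp add: tendsto_ennreal_iff)
    moreover have "(\<integral>\<^sup>+t. ennreal (log_plus (norm (boundary_value f (cis t)))) \<partial>?M) = ennreal (2*pi) * ?c"
      unfolding circle_mean_eq_restrict by (rule ennreal_mult_divide_cancel[symmetric]) simp
    ultimately show ?thesis using that A by (simp add: ennreal_mult)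
  qed
  have PD: "poisson_integral (D n) 0 = poisson_integral (a n) 0 + Re (G 0) + C - poisson_integral (b n) 0" for n
  proof -
    have "poisson_integral (\<lambda>x. D n x + b n x) 0 = poisson_integral (\<lambda>x. (a n x + g n x) + C) 0"
      by (rule poisson_integral_cong) (simp add: D_def)
    then have "poisson_integral (D n) 0 + poisson_integral (b n) 0
        = poisson_integral (a n) 0 + poisson_integral (g n) 0 + C"
      using ca cb cg cD by (simp add: poisson_integral_add continuous_on_add poisson_integral_const)
    moreover have "poisson_integral (g n) 0 = Re (G 0)"
      unfolding g_def using radius_bounds[of n] by (intro mean_Re_dilate G) auto
    ultimately show ?thesis by linarith
  qed
  have intD: "(\<integral>\<^sup>+t. ennreal (D n (cis t)) \<partial>?M)
      = ennreal (2 * pi * (poisson_integral (a n) 0 + Re (G 0) + C - poisson_integral (b n) 0))" for n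
    using nn_integral_circle[OF cD D0] by (simp only: PD)
  define av where "av = (\<lambda>t. liminf (\<lambda>n. ennreal (a n (cis t))))"
  define bv where "bv = (\<lambda>t. liminf (\<lambda>n. ennreal (b n (cis t))))"
  define Dv where "Dv = (\<lambda>t. liminf (\<lambda>n. ennreal (D n (cis t))))"
  have mn: "(\<lambda>t. ennreal (a n (cis t))) \<in> borel_measurable ?M" "(\<lambda>t. ennreal (b n (cis t))) \<in> borel_measurable ?M"
    "(\<lambda>t. ennreal (D n (cis t))) \<in> borel_measurable ?M" for n
    using measurable_circle[OF ca] measurable_circle[OF cb] measurable_circle[OF cD] by measurable
  have mh: "(\<lambda>t. ennreal (Re (h (cis t)))) \<in> borel_measurable ?M"
    using measurable_circle[OF ch] by measurable
  have mv: "av \<in> borel_measurable ?M" "bv \<in> borel_measurable ?M" "Dv \<in> borel_measurable ?M"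
    unfolding av_def bv_def Dv_def by (intro borel_measurable_liminf mn)+
  have AEf: "AE t in ?M. (\<lambda>n. a n (cis t)) \<longlonglongrightarrow> log_plus (norm (boundary_value f (cis t)))"
    using AE_log_plus_radial[OF fN] by (simp add: a_def)
  have AEF: "AE t in ?M. (\<lambda>n. b n (cis t)) \<longlonglongrightarrow> log_plus (norm (boundary_value F (cis t)))"
    using AE_log_plus_radial[OF F] by (simp add: b_def)
  have av: "AE t in ?M. ennreal (log_plus (norm (boundary_value f (cis t)))) = av t"
    using AEf by eventually_elim (auto simp: av_def intro!: lim_imp_Liminf[symmetric] tendsto_ennrealI)
  have bv: "AE t in ?M. ennreal (log_plus (norm (boundary_value F (cis t)))) = bv t"
    using AEF by eventually_elim (auto simp: bv_def intro!: lim_imp_Liminf[symmetric] tendsto_ennrealI)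
  have Iav: "(\<integral>\<^sup>+t. av t \<partial>?M) = ennreal (2 * pi * A)" using nn_integral_cong_AE[OF av] A(3) by simp
  have Ibv: "(\<integral>\<^sup>+t. bv t \<partial>?M) = ennreal (2 * pi * B)" using nn_integral_cong_AE[OF bv] B(1) by simp
  have Ih: "(\<integral>\<^sup>+t. ennreal (Re (h (cis t))) \<partial>?M) = ennreal (2 * pi * Re (h 0))"
    using nn_integral_circle[OF ch] h(3) poisson_integral_Re[OF h(1,2), of 0] by simp
  have IC: "(\<integral>\<^sup>+t. ennreal C \<partial>?M) = ennreal (2 * pi * C)"
    using nn_integral_circle[of "\<lambda>_. C"] C by (simp add: poisson_integral_const)
  have IDv: "(\<integral>\<^sup>+t. Dv t \<partial>?M) \<le> ennreal (2 * pi * (A + Re (G 0) + C - L))"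
  proof -
    have "(\<integral>\<^sup>+t. Dv t \<partial>?M) \<le> liminf (\<lambda>n. \<integral>\<^sup>+t. ennreal (D n (cis t)) \<partial>?M)"
      unfolding Dv_def by (rule nn_integral_liminf[OF mn(3)])
    also have "\<dots> = ennreal (2 * pi * (A + Re (G 0) + C - L))"
    proof (rule lim_imp_Liminf)
      show "(\<lambda>n. \<integral>\<^sup>+t. ennreal (D n (cis t)) \<partial>?M) \<longlonglongrightarrow> ennreal (2 * pi * (A + Re (G 0) + C - L))"
        unfolding intD by (intro tendsto_ennrealI tendsto_intros A(1)) (use L in \<open>simp add: b_def\<close>)
    qed simp
    finally show ?thesis .
  qed
  have "AE t in ?M. (av t + ennreal (Re (h (cis t)))) + ennreal C \<le> bv t + Dv t"
    using AEf AEF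
  proof eventually_elim
    case (elim t)
    let ?\<alpha> = "log_plus (norm (boundary_value f (cis t)))" and ?\<beta> = "log_plus (norm (boundary_value F (cis t)))"
    have 1: "av t = ennreal ?\<alpha>" unfolding av_def by (intro lim_imp_Liminf tendsto_ennrealI elim) simp
    have 2: "bv t = ennreal ?\<beta>" unfolding bv_def by (intro lim_imp_Liminf tendsto_ennrealI elim) simp
    have "isCont h (cis t)"
      using holomorphic_on_imp_continuous_on[OF h(1)] h(2) by (simp add: continuous_on_eq_continuous_at)
    then have hl: "(\<lambda>n. Re (h (of_real (radius n) * cis t))) \<longlonglongrightarrow> Re (h (cis t))"
      by (intro tendsto_Re radius_mult_tendsto)
    have "(\<lambda>n. ennreal (a n (cis t) + Re (h (of_real (radius n) * cis t)) + C - b n (cis t)))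
        \<longlonglongrightarrow> ennreal (?\<alpha> + Re (h (cis t)) + C - ?\<beta>)"
      by (intro tendsto_ennrealI tendsto_intros elim hl)
    then have "ennreal (?\<alpha> + Re (h (cis t)) + C - ?\<beta>)
        = liminf (\<lambda>n. ennreal (a n (cis t) + Re (h (of_real (radius n) * cis t)) + C - b n (cis t)))"
      by (intro lim_imp_Liminf[symmetric]) auto
    also have "\<dots> \<le> Dv t"
      unfolding Dv_def
    proof (rule Liminf_mono, intro always_eventually allI ennreal_leI)
      fix n
      show "a n (cis t) + Re (h (of_real (radius n) * cis t)) + C - b n (cis t) \<le> D n (cis t)"
        using hG[OF rn, of "cis t" n] by (simp add: D_def g_def dilate_def)
    qed
    finally have 3: "ennreal (?\<alpha> + Re (h (cis t)) + C - ?\<beta>) \<le> Dv t" .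
    have h0: "0 \<le> Re (h (cis t))" by (rule h(3)) simp
    have "(av t + ennreal (Re (h (cis t)))) + ennreal C = ennreal (?\<alpha> + Re (h (cis t)) + C)"
      unfolding 1 using h0 C by (simp add: ennreal_plus[symmetric] del: ennreal_plus)
    \<comment> \<open>\<open>ennreal\<close> sends negative reals to 0, so the difference is
      truncated at 0 before it is split off.\<close>
    also have "\<dots> \<le> ennreal (?\<beta> + max 0 (?\<alpha> + Re (h (cis t)) + C - ?\<beta>))" by (intro ennreal_leI) simp
    also have "\<dots> = ennreal ?\<beta> + ennreal (max 0 (?\<alpha> + Re (h (cis t)) + C - ?\<beta>))" by (simp add: ennreal_plus)
    also have "ennreal (max 0 (?\<alpha> + Re (h (cis t)) + C - ?\<beta>)) = ennreal (?\<alpha> + Re (h (cis t)) + C - ?\<beta>)"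
      by (simp add: max_def ennreal_neg)
    also have "ennreal ?\<beta> + \<dots> \<le> bv t + Dv t" unfolding 2 using 3 by (rule add_left_mono)
    finally show ?case .
  qed
  then have "(\<integral>\<^sup>+t. (av t + ennreal (Re (h (cis t)))) + ennreal C \<partial>?M) \<le> (\<integral>\<^sup>+t. bv t + Dv t \<partial>?M)"
    by (rule nn_integral_mono_AE)
  also have "(\<integral>\<^sup>+t. (av t + ennreal (Re (h (cis t)))) + ennreal C \<partial>?M)
      = (ennreal (2 * pi * A) + ennreal (2 * pi * Re (h 0))) + ennreal (2 * pi * C)"
    using mv mh by (simp add: nn_integral_add Iav Ih IC del: nn_integral_const)
  also have "(\<integral>\<^sup>+t. bv t + Dv t \<partial>?M) = ennreal (2 * pi * B) + (\<integral>\<^sup>+t. Dv t \<partial>?M)"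
    using mv by (simp add: nn_integral_add Ibv)
  also have "\<dots> \<le> ennreal (2 * pi * B) + ennreal (2 * pi * (A + Re (G 0) + C - L))"
    using IDv by (rule add_left_mono)
  finally have fin: "(ennreal (2 * pi * A) + ennreal (2 * pi * Re (h 0))) + ennreal (2 * pi * C)
      \<le> ennreal (2 * pi * B) + ennreal (2 * pi * (A + Re (G 0) + C - L))" .
  \<comment> \<open>Nonnegativity allows the return from \<open>ennreal\<close> to the reals; a
    negative quantity would have been read as 0.\<close>
  have nn: "0 \<le> A + Re (G 0) + C - L"
  proof (rule LIMSEQ_le_const)
    show "(\<lambda>n. poisson_integral (a n) 0 + Re (G 0) + C - poisson_integral (b n) 0) \<longlonglongrightarrow> A + Re (G 0) + C - L"
      by (intro tendsto_intros A(1)) (use L in \<open>simp add: b_def\<close>)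
    have "0 \<le> poisson_integral (D n) 0" for n using cD D0 by (intro poisson_integral_nonneg) auto
    then have "0 \<le> poisson_integral (a n) 0 + Re (G 0) + C - poisson_integral (b n) 0" for n by (simp only: PD)
    then show "\<exists>N. \<forall>n\<ge>N. 0 \<le> poisson_integral (a n) 0 + Re (G 0) + C - poisson_integral (b n) 0" by metis
  qed
  have "0 \<le> Re (h 0)" by (rule h(3)) simp
  then have "ennreal (2 * pi * A + 2 * pi * Re (h 0) + 2 * pi * C) \<le> ennreal (2 * pi * B + 2 * pi * (A + Re (G 0) + C - L))"
    using fin A(2) B(2) C nn by (simp add: ennreal_plus)
  then have "2 * pi * A + 2 * pi * Re (h 0) + 2 * pi * C \<le> 2 * pi * B + 2 * pi * (A + Re (G 0) + C - L)"
    using B(2) nn by (subst (asm) ennreal_le_iff) auto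
  then have "2 * pi * (A + Re (h 0) + C) \<le> 2 * pi * (B + (A + Re (G 0) + C - L))" by (simp add: algebra_simps)
  then have "A + Re (h 0) + C \<le> B + (A + Re (G 0) + C - L)" by (subst (asm) mult_le_cancel_left_pos) auto
  then show ?thesis by linarith
qed

text \<open>The product of all denominators is zero-free on the closed disc, hence on a larger disc;
  it is entire, so the starting radius 2 is arbitrary.\<close>

lemma holomorphic_herglotz_finite_sum:
  assumes "finite S" "S \<subseteq> ball 0 1"
  obtains R where "1 < R" "(\<lambda>z. \<Sum>a\<in>S. of_real (c a) / (1 - cnj a * z)) holomorphic_on ball 0 R"
proof -
  define p where "p = (\<lambda>z. \<Prod>a\<in>S. 1 - cnj a * z)"
  have hp: "p holomorphic_on ball 0 2" unfolding p_def by (intro holomorphic_intros)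
  have nz: "p z \<noteq> 0" if "norm z \<le> 1" for z
    unfolding p_def prod_zero_iff[OF assms(1)] using assms(2) one_minus_cnj_mult_nonzero[OF _ that] by auto
  have "(1::real) < 2" by simp
  then obtain R where R: "1 < R" "\<And>z. norm z < R \<Longrightarrow> p z \<noteq> 0"
    using zero_free_neighbourhood[OF hp _ nz] by metis
  have "1 - cnj a * z \<noteq> 0" if "a \<in> S" "norm z < R" for a z
    using R(2)[OF that(2)] that(1) unfolding p_def prod_zero_iff[OF assms(1)] by blast
  then have "(\<lambda>z. \<Sum>a\<in>S. of_real (c a) / (1 - cnj a * z)) holomorphic_on ball 0 R"
    by (intro holomorphic_intros) auto
  then show ?thesis using that R(1) by blast
qed

text \<open>log^+ of a product is at most the sum, and log^+ |exp G| = Re G because Re G is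
  nonnegative. The circle means of Re G are constantly Re G(0), so all means stay bounded.\<close>

lemma nevanlinna_mult_exp_bounded:
  assumes f: "f \<in> nevanlinna_class" and G: "G holomorphic_on ball 0 1" "\<And>z. norm z < 1 \<Longrightarrow> 0 \<le> Re (G z)"
    and g: "g holomorphic_on ball 0 1" "\<And>z. norm z < 1 \<Longrightarrow> norm (g z) \<le> M"
  shows "(\<lambda>z. f z * exp (G z) * g z) \<in> nevanlinna_class"
    and "\<And>z. norm z < 1 \<Longrightarrow> log_plus (norm (f z * exp (G z) * g z)) \<le> log_plus (norm (f z)) + Re (G z) + log_plus M"
proof -
  obtain C where C: "0 \<le> C" "f holomorphic_on ball 0 1"
    "\<And>r. 0 < r \<Longrightarrow> r < 1 \<Longrightarrow> poisson_integral (\<lambda>x. log_plus (norm (dilate f r x))) 0 \<le> C"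
    using nevanlinna_classD[OF f] by metis
  show le: "log_plus (norm (f z * exp (G z) * g z)) \<le> log_plus (norm (f z)) + Re (G z) + log_plus M" if z: "norm z < 1" for z
  proof -
    have "log_plus (norm (f z * exp (G z) * g z)) \<le> log_plus (norm (f z)) + log_plus (exp (Re (G z))) + log_plus (norm (g z))"
      unfolding norm_mult norm_exp_eq_Re
      by (rule order_trans[OF log_plus_mult_le]) (intro add_right_mono log_plus_mult_le)
    also have "log_plus (exp (Re (G z))) = Re (G z)" by (rule log_plus_exp[OF G(2)[OF z]])
    also have "log_plus (norm (g z)) \<le> log_plus M" using g(2)[OF z] by (intro log_plus_mono) simp
    finally show ?thesis by simp
  qed
  let ?F = "\<lambda>z. f z * exp (G z) * g z"
  have hF: "?F holomorphic_on ball 0 1" by (intro holomorphic_intros C G g)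
  show "?F \<in> nevanlinna_class"
  proof (rule nevanlinna_classI[OF hF])
    fix r :: real assume r: "0 < r" "r < 1"
    have cf: "continuous_on (sphere 0 1) (\<lambda>x. log_plus (norm (dilate f r x)))"
      using r C(2) by (intro continuous_on_log_plus_dilate holomorphic_on_imp_continuous_on) auto
    have cG: "continuous_on (sphere 0 1) (\<lambda>x. Re (dilate G r x))" using r by (intro continuous_on_Re_dilate G) auto
    have "poisson_integral (\<lambda>x. log_plus (norm (dilate ?F r x))) 0
        \<le> poisson_integral (\<lambda>x. (log_plus (norm (dilate f r x)) + Re (dilate G r x)) + log_plus M) 0"
    proof (rule poisson_integral_mono)
      show "continuous_on (sphere 0 1) (\<lambda>x. log_plus (norm (dilate ?F r x)))"
        using r hF by (intro continuous_on_log_plus_dilate holomorphic_on_imp_continuous_on) auto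
      show "continuous_on (sphere 0 1) (\<lambda>x. (log_plus (norm (dilate f r x)) + Re (dilate G r x)) + log_plus M)"
        by (intro continuous_on_add cf cG continuous_on_const)
      fix x :: complex assume "norm x = 1"
      then have "norm (of_real r * x) < 1" using r by (simp add: norm_mult)
      from le[OF this] show "log_plus (norm (dilate ?F r x)) \<le> (log_plus (norm (dilate f r x)) + Re (dilate G r x)) + log_plus M"
        by (simp add: dilate_def)
    qed simp
    also have "\<dots> = poisson_integral (\<lambda>x. log_plus (norm (dilate f r x))) 0 + Re (G 0) + log_plus M"
      using cf cG mean_Re_dilate[OF G(1) r] by (simp add: poisson_integral_add continuous_on_add poisson_integral_const)
    also have "\<dots> \<le> C + Re (G 0) + log_plus M" using C(3)[OF r] by simp
    finally show "poisson_integral (\<lambda>x. log_plus (norm (dilate ?F r x))) 0 \<le> C + Re (G 0) + log_plus M" .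
  qed
qed

text \<open>Fatou's lemma puts the boundary mean below the limit of the means. Conversely
  \<open>smirnov_majorant_gap\<close> with a finite subsum h of G bounds the excess by Re G(0) - Re
  h(0), the part of the sum of \<open>c\<close> left out of h, which can be made smaller than any
  e.\<close>

lemma smirnov_mult_exp_herglotz:
  assumes f: "f \<in> smirnov_class"
    and \<Lambda>: "\<Lambda> \<subseteq> ball 0 1" and c: "c summable_on \<Lambda>" "\<And>a. a \<in> \<Lambda> \<Longrightarrow> 0 \<le> c a"
    and g: "g holomorphic_on ball 0 1" "\<And>z. norm z < 1 \<Longrightarrow> norm (g z) \<le> M"
  shows "(\<lambda>z. f z * exp (herglotz_sum c \<Lambda> z) * g z) \<in> smirnov_class"
proof -
  let ?M = "restrict_space lebesgue {0..2*pi}"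
  define G where "G = herglotz_sum c \<Lambda>"
  define F where "F = (\<lambda>z. f z * exp (G z) * g z)"
  have fN: "f \<in> nevanlinna_class" using f smirnov_subset_nevanlinna by blast
  have G: "G holomorphic_on ball 0 1" "\<And>z. norm z < 1 \<Longrightarrow> 0 \<le> Re (G z)"
    unfolding G_def by (rule holomorphic_herglotz_sum[OF \<Lambda> c], assumption)
      (rule Re_herglotz_sum_nonneg[OF \<Lambda> c])
  have F: "F \<in> nevanlinna_class"
    and le: "\<And>z. norm z < 1 \<Longrightarrow> log_plus (norm (F z)) \<le> log_plus (norm (f z)) + Re (G z) + log_plus M"
    unfolding F_def by (rule nevanlinna_mult_exp_bounded[OF fN G g]; assumption)+
  have Fh: "F holomorphic_on ball 0 1" using F by (simp add: nevanlinna_class_def)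
  have Fc: "continuous_on (ball 0 1) F" using Fh by (rule holomorphic_on_imp_continuous_on)
  obtain L where L: "L < \<infinity>" "(log_plus_mean F \<longlongrightarrow> L) (at_left 1)" using F by (auto simp: nevanlinna_class_def)
  obtain l where l: "L = ennreal l" "0 \<le> l" using L(1) by (cases L rule: ennreal_cases) auto
  define b where "b = (\<lambda>n x. log_plus (norm (dilate F (radius n) x)))"
  have cb: "continuous_on (sphere 0 1) (b n)" for n
    unfolding b_def using radius_bounds[of n] by (intro continuous_on_log_plus_dilate Fc) auto
  have bn: "0 \<le> poisson_integral (b n) 0" for n using cb by (intro poisson_integral_nonneg) (auto simp: b_def)
  have "(\<lambda>n. ennreal (poisson_integral (b n) 0)) \<longlonglongrightarrow> ennreal l"
    using log_plus_mean_radius_tendsto[OF L(2)] radius_bounds log_plus_mean_eq[OF Fc]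
    unfolding l(1) b_def by (simp add: less_imp_le)
  then have lim: "(\<lambda>n. poisson_integral (b n) 0) \<longlonglongrightarrow> l" using bn l(2) by (simp add: tendsto_ennreal_iff)
  define I where "I = (\<integral>\<^sup>+t. ennreal (log_plus (norm (boundary_value F (cis t)))) \<partial>?M)"
  have AEF: "AE t in ?M. (\<lambda>n. b n (cis t)) \<longlonglongrightarrow> log_plus (norm (boundary_value F (cis t)))"
    using AE_log_plus_radial[OF F] by (simp add: b_def)
  have "I = (\<integral>\<^sup>+t. liminf (\<lambda>n. ennreal (b n (cis t))) \<partial>?M)"
    unfolding I_def
  proof (rule nn_integral_cong_AE)
    show "AE t in ?M. ennreal (log_plus (norm (boundary_value F (cis t)))) = liminf (\<lambda>n. ennreal (b n (cis t)))"
      using AEF by eventually_elim (auto intro!: lim_imp_Liminf[symmetric] tendsto_ennrealI)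
  qed
  also have "\<dots> \<le> liminf (\<lambda>n. \<integral>\<^sup>+t. ennreal (b n (cis t)) \<partial>?M)"
    by (rule nn_integral_liminf) (use measurable_circle[OF cb] in measurable)
  also have "(\<lambda>n. \<integral>\<^sup>+t. ennreal (b n (cis t)) \<partial>?M) = (\<lambda>n. ennreal (2 * pi * poisson_integral (b n) 0))"
    by (rule ext, rule nn_integral_circle[OF cb]) (simp add: b_def)
  also have "liminf \<dots> = ennreal (2 * pi * l)"
    by (intro lim_imp_Liminf tendsto_ennrealI tendsto_intros lim) simp
  finally have Ile: "I \<le> ennreal (2 * pi * l)" .
  then have "I < \<infinity>" by (rule le_less_trans) simp
  then obtain i where i: "I = ennreal i" "0 \<le> i" by (cases I rule: ennreal_cases) auto
  define B where "B = i / (2 * pi)"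
  have B: "I = ennreal (2 * pi * B)" "0 \<le> B" using i by (auto simp: B_def)
  have "B \<le> l"
  proof -
    have "2 * pi * B \<le> 2 * pi * l" using Ile l(2) unfolding B(1) by (subst (asm) ennreal_le_iff) auto
    then show ?thesis by simp
  qed
  moreover have "l \<le> B"
  proof (rule field_le_epsilon)
    fix e :: real assume e: "0 < e"
    have hs: "(c has_sum Re (G 0)) \<Lambda>"
      unfolding G_def herglotz_sum_0[OF c(1)] using has_sum_infsum[OF c(1)] by simp
    \<comment> \<open>G(0) is the sum of the coefficients, so a finite part of them comes within
      e.\<close>
    have "\<exists>S. finite S \<and> S \<subseteq> \<Lambda> \<and> Re (G 0) - e < sum c S"
    proof (rule ccontr)
      assume n: "\<not> ?thesis"
      have "sum c S \<le> Re (G 0) - e" if "finite S" "S \<subseteq> \<Lambda>" for S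
      proof (rule ccontr)
        assume "\<not> ?thesis"
        then have "Re (G 0) - e < sum c S" by (simp only: not_le)
        with that have "\<exists>S. finite S \<and> S \<subseteq> \<Lambda> \<and> Re (G 0) - e < sum c S" by (intro exI[of _ S] conjI)
        with n show False by (rule notE)
      qed
      then have "Re (G 0) \<le> Re (G 0) - e" by (rule has_sum_le_finite_sums[OF hs])
      then show False using e by simp
    qed
    then obtain S where S: "finite S" "S \<subseteq> \<Lambda>" "Re (G 0) - e < sum c S" by (elim exE conjE)
    define h where "h = (\<lambda>z. \<Sum>a\<in>S. of_real (c a) / (1 - cnj a * z))"
    obtain R where R: "1 < R" "h holomorphic_on ball 0 R"
      using holomorphic_herglotz_finite_sum[of S c] S \<Lambda> unfolding h_def by blast
    have Reh: "Re (h z) = (\<Sum>a\<in>S. Re (of_real (c a) / (1 - cnj a * z)))" for z by (simp add: h_def)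
    have "l \<le> B + (Re (G 0) - Re (h 0))"
    proof (rule smirnov_majorant_gap[OF f F G(1) log_plus_nonneg le R(2,1)])
      show "0 \<le> Re (h z)" if "norm z \<le> 1" for z
        unfolding Reh using S(2) \<Lambda> c(2) that by (intro sum_nonneg Re_herglotz_term_nonneg) auto
      show "Re (h z) \<le> Re (G z)" if "norm z < 1" for z
        unfolding Reh G_def by (rule Re_herglotz_sum_ge[OF \<Lambda> c that S(1,2)])
      show "(\<lambda>n. poisson_integral (\<lambda>x. log_plus (norm (dilate F (radius n) x))) 0) \<longlonglongrightarrow> l"
        using lim by (simp add: b_def)
      show "(\<integral>\<^sup>+t. ennreal (log_plus (norm (boundary_value F (cis t)))) \<partial>?M) = ennreal (2 * pi * B)"
        using B(1) by (simp add: I_def)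
    qed (assumption | fact)+
    moreover have "Re (h 0) = sum c S" unfolding Reh by simp
    ultimately show "l \<le> B + e" using S(3) by linarith
  qed
  ultimately have "B = l" by simp
  have "circle_mean (\<lambda>\<theta>. log_plus (norm (boundary_value F (cis \<theta>)))) = ennreal (2 * pi * l) / ennreal (2 * pi)"
    unfolding circle_mean_eq_restrict I_def[symmetric] B(1) \<open>B = l\<close> ..
  also have "\<dots> = ennreal l" using l(2) by (simp add: divide_ennreal)
  finally show ?thesis
    using F L(2) l(1) unfolding smirnov_class_def F_def G_def by simp
qed

section \<open>The two implications, for a general class of functions\<close>

lemma trace_space_memI: "f \<in> X \<Longrightarrow> restrict f \<Lambda> \<in> trace_space X \<Lambda>"
  by (simp add: trace_space_def)

text \<open>Multiplying the trace of the constant 1 by the indicator of \<open>\<Lambda> - A\<close>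
  gives 0-1 data, and the inclusion places the interpolating function in the Nevanlinna
  class.\<close>

lemma summable_of_free_interpolating:
  assumes L: "\<Lambda> \<subseteq> ball 0 1" "blaschke_condition \<Lambda>" "bounded_balayage (point_measure_of \<Lambda>)"
    and X: "X \<subseteq> nevanlinna_class" "(\<lambda>_. 1) \<in> X" and free: "free_interpolating X \<Lambda>"
  shows "(\<lambda>a. (1 - norm a) * ln (inverse (norm (blaschke_without \<Lambda> a a)))) summable_on \<Lambda>"
proof (rule summable_of_zero_one_interpolation[OF L])
  fix A assume A: "A \<subseteq> \<Lambda>"
  define \<omega> where "\<omega> = (\<lambda>a. if a \<in> A then 0 else (1::complex))"
  have "bounded (\<omega> ` \<Lambda>)" by (rule bounded_subset[of "{0, 1}"]) (auto simp: \<omega>_def)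
  then have "(\<lambda>a\<in>\<Lambda>. \<omega> a * restrict (\<lambda>_. 1) \<Lambda> a) \<in> trace_space X \<Lambda>"
    using free trace_space_memI[OF X(2), of \<Lambda>] unfolding free_interpolating_def ideal_space_def by blast
  then obtain f where f: "f \<in> X" "(\<lambda>a\<in>\<Lambda>. \<omega> a * restrict (\<lambda>_. 1) \<Lambda> a) = restrict f \<Lambda>"
    by (auto simp: trace_space_def)
  have "f a = \<omega> a" if "a \<in> \<Lambda>" for a using fun_cong[OF f(2), of a] that by simp
  then have "(\<forall>a\<in>A. f a = 0) \<and> (\<forall>a\<in>\<Lambda> - A. f a = 1)" using A by (auto simp: \<omega>_def)
  then show "\<exists>f\<in>nevanlinna_class. (\<forall>a\<in>A. f a = 0) \<and> (\<forall>a\<in>\<Lambda> - A. f a = 1)" using f(1) X(1) by blast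
qed

text \<open>Multiplication by exp(G) and a bounded function is abstracted into the closure
  hypothesis on \<open>X\<close>, so one construction serves both classes.\<close>

lemma free_interpolating_of_summable:
  assumes L: "\<Lambda> \<subseteq> ball 0 1" "blaschke_condition \<Lambda>" "bounded_balayage (point_measure_of \<Lambda>)"
    and sm: "(\<lambda>a. (1 - norm a) * ln (inverse (norm (blaschke_without \<Lambda> a a)))) summable_on \<Lambda>"
    and X: "\<And>f c g M. f \<in> X \<Longrightarrow> c summable_on \<Lambda> \<Longrightarrow> (\<And>a. a \<in> \<Lambda> \<Longrightarrow> 0 \<le> c a) \<Longrightarrow> g holomorphic_on ball 0 1 \<Longrightarrow>
        (\<And>z. norm z < 1 \<Longrightarrow> norm (g z) \<le> M) \<Longrightarrow> (\<lambda>z. f z * exp (herglotz_sum c \<Lambda> z) * g z) \<in> X"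
  shows "free_interpolating X \<Lambda>"
  unfolding free_interpolating_def ideal_space_def
proof (intro ballI allI impI)
  fix s \<omega> :: "complex \<Rightarrow> complex" assume s: "s \<in> trace_space X \<Lambda>" and \<omega>: "bounded (\<omega> ` \<Lambda>)"
  obtain f where f: "f \<in> X" "s = restrict f \<Lambda>" using s by (auto simp: trace_space_def)
  obtain W0 where "\<forall>x\<in>\<omega> ` \<Lambda>. norm x \<le> W0" using \<omega> unfolding bounded_iff by blast
  then obtain W where W: "0 \<le> W" "\<And>a. a \<in> \<Lambda> \<Longrightarrow> norm (\<omega> a) \<le> W"
    using that[of "max 0 W0"] by (metis image_eqI max.cobounded1 max.coboundedI2)
  obtain K where K: "0 \<le> K" "\<And>T \<zeta>. finite T \<Longrightarrow> T \<subseteq> \<Lambda> \<Longrightarrow> norm \<zeta> = 1 \<Longrightarrow>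
     (\<Sum>a\<in>T. (1 - norm a) * poisson_kernel a \<zeta>) \<le> K"
    using sum_poisson_le_of_bounded_balayage[OF L(3,1)] by metis
  define \<phi> where "\<phi> = (\<lambda>a. ln (inverse (norm (blaschke_without \<Lambda> a a))))"
  \<comment> \<open>1 - |a|^2 cancels the denominator 1 - cnj a a, so the term of a in G(a) is
    exactly \<open>\<phi> a\<close>.\<close>
  define c where "c = (\<lambda>a. \<phi> a * (1 - (norm a)\<^sup>2))"
  have n1: "norm a < 1" if "a \<in> \<Lambda>" for a using that L(1) by auto
  have \<phi>0: "0 \<le> \<phi> a" if "a \<in> \<Lambda>" for a
    unfolding \<phi>_def by (rule ln_inverse_blaschke_without_nonneg[OF L(1,2) that])
  have c0: "0 \<le> c a" if "a \<in> \<Lambda>" for a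
    using \<phi>0[OF that] n1[OF that] by (simp add: c_def abs_square_le_1)
  have cs: "c summable_on \<Lambda>"
  proof (rule summable_on_comparison_test)
    show "(\<lambda>a. 2 * ((1 - norm a) * \<phi> a)) summable_on \<Lambda>"
      using sm unfolding \<phi>_def by (rule summable_on_cmult_right)
    fix a assume a: "a \<in> \<Lambda>"
    have "1 - (norm a)\<^sup>2 = (1 + norm a) * (1 - norm a)" by (simp add: power2_eq_square algebra_simps)
    also have "\<dots> \<le> 2 * (1 - norm a)" using n1[OF a] by (intro mult_right_mono) auto
    finally have "\<phi> a * (1 - (norm a)\<^sup>2) \<le> \<phi> a * (2 * (1 - norm a))" using \<phi>0[OF a] by (rule mult_left_mono)
    then show "c a \<le> 2 * ((1 - norm a) * \<phi> a)" by (simp add: c_def mult_ac)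
  qed (rule c0)
  let ?G = "herglotz_sum c \<Lambda>"
  have ReG: "\<phi> a \<le> Re (?G a)" if a: "a \<in> \<Lambda>" for a
  proof -
    have "(\<Sum>b\<in>{a}. Re (of_real (c b) / (1 - cnj b * a))) \<le> Re (?G a)"
      by (rule Re_herglotz_sum_ge[OF L(1) cs c0 n1[OF a]]) (use a in auto)
    moreover have "1 - cnj a * a = of_real (1 - (norm a)\<^sup>2)"
      by (simp only: of_real_diff of_real_1 complex_norm_square mult.commute)
    moreover have "1 - (norm a)\<^sup>2 \<noteq> 0" using n1[OF a] by (simp add: abs_square_eq_1)
    ultimately show ?thesis by (simp only: sum.insert finite.emptyI empty_iff not_False_eq_True sum.empty add_0_right
        of_real_divide[symmetric] Re_complex_of_real c_def nonzero_mult_div_cancel_right)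
  qed
  \<comment> \<open>Here exp(-Re G(a)) is at most exp of \<open>- \<phi> a\<close>, which is
    |B_a(a)|: the size required by \<open>bounded_interpolation\<close>.\<close>
  have v: "norm (\<omega> a / exp (?G a)) \<le> W * norm (blaschke_without \<Lambda> a a)" if a: "a \<in> \<Lambda>" for a
  proof -
    have "norm (blaschke_without \<Lambda> a a) = exp (- \<phi> a)"
      using blaschke_without_has_sum(2)[OF L(1,2) a] by (simp add: \<phi>_def ln_inverse)
    moreover have "exp (- Re (?G a)) \<le> exp (- \<phi> a)" using ReG[OF a] by simp
    moreover have "norm (\<omega> a / exp (?G a)) = norm (\<omega> a) * exp (- Re (?G a))"
      by (simp only: norm_divide norm_exp_eq_Re) (simp add: exp_minus divide_inverse)
    ultimately show ?thesis using W(1) W(2)[OF a] by (simp add: mult_mono)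
  qed
  have "\<exists>g. g holomorphic_on ball 0 1 \<and> (\<forall>z. norm z < 1 \<longrightarrow> norm (g z) \<le> 2 * W * K) \<and>
      (\<forall>a\<in>\<Lambda>. g a = \<omega> a / exp (?G a))"
    by (rule bounded_interpolation[where v = "\<lambda>a. \<omega> a / exp (?G a)", OF L(1,2) W(1) v K(2)]) blast+
  then obtain g where g: "g holomorphic_on ball 0 1" "\<And>z. norm z < 1 \<Longrightarrow> norm (g z) \<le> 2 * W * K"
    "\<And>a. a \<in> \<Lambda> \<Longrightarrow> g a = \<omega> a / exp (?G a)" by blast
  define F where "F = (\<lambda>z. f z * exp (?G z) * g z)"
  have "F \<in> X" unfolding F_def by (rule X[OF f(1) cs c0 g(1,2)])
  moreover have "(\<lambda>a\<in>\<Lambda>. \<omega> a * s a) = restrict F \<Lambda>"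
    by (rule ext) (simp add: F_def f(2) g(3) restrict_def)
  ultimately show "(\<lambda>a\<in>\<Lambda>. \<omega> a * s a) \<in> trace_space X \<Lambda>" by (simp add: trace_space_memI)
qed

theorem proposition1p12:
  fixes \<Lambda> :: "complex set"
  assumes "\<Lambda> \<subseteq> ball 0 1"
    and "\<Lambda> sparse_in ball 0 1"
    and "blaschke_condition \<Lambda>"
    and "bounded_balayage (point_measure_of \<Lambda>)"
  shows "(free_interpolating nevanlinna_class \<Lambda> \<longleftrightarrow> free_interpolating smirnov_class \<Lambda>) \<and>
         (free_interpolating smirnov_class \<Lambda> \<longleftrightarrow>
            (\<lambda>a. (1 - norm a) * ln (inverse (norm (blaschke_without \<Lambda> a a)))) summable_on \<Lambda>)"
proof -
  let ?S = "(\<lambda>a. (1 - norm a) * ln (inverse (norm (blaschke_without \<Lambda> a a)))) summable_on \<Lambda>"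
  note L = assms(1,3,4)
  \<comment> \<open>The two interpolation properties are not compared with each other; each is
    linked to the summability condition separately.\<close>
  have "?S" if "free_interpolating nevanlinna_class \<Lambda>"
    by (rule summable_of_free_interpolating[OF L order_refl _ that]) (use one_in_smirnov smirnov_subset_nevanlinna in blast)
  moreover have "?S" if "free_interpolating smirnov_class \<Lambda>"
    by (rule summable_of_free_interpolating[OF L smirnov_subset_nevanlinna one_in_smirnov that])
  moreover have "free_interpolating smirnov_class \<Lambda>" if "?S"
    by (rule free_interpolating_of_summable[OF L that]) (rule smirnov_mult_exp_herglotz[OF _ L(1)])
  moreover have "free_interpolating nevanlinna_class \<Lambda>" if "?S"
  proof (rule free_interpolating_of_summable[OF L that])
    fix f g :: "complex \<Rightarrow> complex" and c :: "complex \<Rightarrow> real" and M :: real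
    assume f: "f \<in> nevanlinna_class" and c: "c summable_on \<Lambda>" "\<And>a. a \<in> \<Lambda> \<Longrightarrow> 0 \<le> c a"
      and g: "g holomorphic_on ball 0 1" "\<And>z. norm z < 1 \<Longrightarrow> norm (g z) \<le> M"
    show "(\<lambda>z. f z * exp (herglotz_sum c \<Lambda> z) * g z) \<in> nevanlinna_class"
      by (rule nevanlinna_mult_exp_bounded(1)[OF f holomorphic_herglotz_sum[OF L(1) c] Re_herglotz_sum_nonneg[OF L(1) c] g])
  qed
  ultimately show ?thesis by blast
qed

end
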